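(* Let $\alpha=-1$ and $\kappa>0$. Let $z^0=(u^0,\rho^0)\in H^2(\mathbb S)\times H^1(\mathbb S)$ and assume that either $\rho^0(x)>0$ for all $x\in\mathbb S$, or $\rho^0(x)<0$ for all $x\in\mathbb S$. Then the solution $z=(u,\rho)$ of the generalized two-component Hunter–Saxton system with initial datum $z^0$ is global, i.e. it exists for all $t\in[0,\infty)$.
   Context: $\mathbb S=\mathbb R/\mathbb Z$; $H^r(\mathbb S)$ are the $L^2$-based Sobolev spaces. For $(\alpha,\kappa)\in\mathbb R\times\mathbb R$, the generalized two-component Hunter–Saxton system is $$u_{txx}+(1-\alpha)u_xu_{xx}+uu_{xxx}-\kappa\rho\rho_x=0,\qquad \rho_t+u\rho_x=\alpha u_x\rho,\qquad t>0,\ x\in\mathbb R,$$ with $u(t,x+1)=u(t,x)$, $\rho(t,x+1)=\rho(t,x)$, $u(0,x)=u^0(x)$, $\rho(0,x)=\rho^0(x)$. Integrating the first equation twice in space gives $$u_t+uu_x=\partial_x^{-1}\Big(\tfrac{\kappa}{2}\rho^2+\tfrac{\alpha+2}{2}u_x^2+a(t)\Big)+h(t),\qquad \partial_x^{-1}f(x)=\int_0^x f(y)\,dy,$$ with $a(t)=-\frac{\kappa}{2}\int_{\mathbb S}\rho^2dx-\frac{\alpha+2}{2}\int_{\mathbb S}u_x^2dx$ and $h:[0,\infty)\to\mathbb R$ an arbitrary continuous function, which is fixed once and for all (e.g. $h\equiv0$); "the solution" means the solution of this integrated equation together with the $\rho$-equation. For $z^0\in H^s\times H^{s-1}$, $s\ge2$,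 there is a unique solution of class $C([0,T);H^s\times H^{s-1})\cap C^1([0,T);H^{s-1}\times H^{s-2})$ with maximal existence time $T=T(\|z^0\|_{H^s\times H^{s-1}})>0$. Here $s=2$, and "global" means $T=\infty$. *)

theory Defs
  imports "HOL-Analysis.Analysis"
begin

text \<open>Functions on the circle \<open>\<real>/\<int>\<close> are 1-periodic functions on the real line, integrated over the
  period \<open>[0,1]\<close>.\<close>

definition periodic1 :: "(real \<Rightarrow> real) \<Rightarrow> bool" where
  "periodic1 f \<longleftrightarrow> (\<forall>x. f (x + 1) = f x)"

abbreviation circle :: "real measure" where
  "circle \<equiv> lebesgue_on {0..1}"

definition L2_circle :: "(real \<Rightarrow> real) \<Rightarrow> bool" where
  "L2_circle f \<longleftrightarrow> periodic1 f \<and> f \<in> borel_measurable circle \<and> integrable circle (\<lambda>x. (f x)\<^sup>2)"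

definition L2_norm :: "(real \<Rightarrow> real) \<Rightarrow> real" where
  "L2_norm f = sqrt (LINT x|circle. (f x)\<^sup>2)"

definition test_function :: "(real \<Rightarrow> real) \<Rightarrow> bool" where
  "test_function \<phi> \<longleftrightarrow> periodic1 \<phi> \<and> (\<forall>n. (deriv ^^ n) \<phi> differentiable_on UNIV)"

definition is_weak_deriv :: "(real \<Rightarrow> real) \<Rightarrow> (real \<Rightarrow> real) \<Rightarrow> bool" where
  "is_weak_deriv f g \<longleftrightarrow>
     (\<forall>\<phi>. test_function \<phi> \<longrightarrow> (LINT x|circle. f x * deriv \<phi> x) = - (LINT x|circle. g x * \<phi> x))"

text \<open>A square-integrable weak derivative is unique only up to a null set; \<open>wderiv\<close> picks one
  representative, and is used only under integrals and in almost-everywhere statements.\<close>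

definition wderiv :: "(real \<Rightarrow> real) \<Rightarrow> real \<Rightarrow> real" where
  "wderiv f = (SOME g. L2_circle g \<and> is_weak_deriv f g)"

primrec weakly_diff :: "nat \<Rightarrow> (real \<Rightarrow> real) \<Rightarrow> bool" where
  "weakly_diff 0 f \<longleftrightarrow> L2_circle f"
| "weakly_diff (Suc r) f \<longleftrightarrow> L2_circle f \<and> (\<exists>g. is_weak_deriv f g \<and> weakly_diff r g)"

text \<open>The Sobolev space \<open>H\<^sup>r\<close> of the circle. For \<open>r \<ge> 1\<close> every class has exactly one continuous
  representative, and elements are identified with it; this gives pointwise values a meaning.\<close>

definition sobolev :: "nat \<Rightarrow> (real \<Rightarrow> real) \<Rightarrow> bool" where
  "sobolev r f \<longleftrightarrow> weakly_diff r f \<and> (r \<ge> 1 \<longrightarrow> continuous_on UNIV f)"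

definition sobolev_norm :: "nat \<Rightarrow> (real \<Rightarrow> real) \<Rightarrow> real" where
  "sobolev_norm r f = sqrt (\<Sum>k\<le>r. (L2_norm ((wderiv ^^ k) f))\<^sup>2)"

text \<open>Curves \<open>t \<mapsto> u t\<close> with values in \<open>H\<^sup>r\<close>: continuity on \<open>I\<close>, and \<open>v\<close> being the derivative of
  \<open>u\<close> on \<open>I\<close> (one-sided at an endpoint), both in the \<open>H\<^sup>r\<close> norm.\<close>

definition sobolev_continuous_on :: "nat \<Rightarrow> real set \<Rightarrow> (real \<Rightarrow> real \<Rightarrow> real) \<Rightarrow> bool" where
  "sobolev_continuous_on r I u \<longleftrightarrow>
     (\<forall>t\<in>I. sobolev r (u t)) \<and>
     (\<forall>t\<in>I. ((\<lambda>s. sobolev_norm r (\<lambda>x. u s x - u t x)) \<longlongrightarrow> 0) (at t within I))"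

definition sobolev_has_deriv_on ::
  "nat \<Rightarrow> real set \<Rightarrow> (real \<Rightarrow> real \<Rightarrow> real) \<Rightarrow> (real \<Rightarrow> real \<Rightarrow> real) \<Rightarrow> bool" where
  "sobolev_has_deriv_on r I u v \<longleftrightarrow>
     (\<forall>t\<in>I. sobolev r (u t) \<and> sobolev r (v t)) \<and>
     (\<forall>t\<in>I. ((\<lambda>s. sobolev_norm r (\<lambda>x. (u s x - u t x) / (s - t) - v t x)) \<longlongrightarrow> 0) (at t within I))"

definition hs_a :: "real \<Rightarrow> real \<Rightarrow> (real \<Rightarrow> real) \<Rightarrow> (real \<Rightarrow> real) \<Rightarrow> real" where
  "hs_a \<alpha> \<kappa> u \<rho> =
     - (\<kappa> / 2) * (LINT x|circle. (\<rho> x)\<^sup>2) - ((\<alpha> + 2) / 2) * (LINT x|circle. (wderiv u x)\<^sup>2)"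

text \<open>The integrand has mean zero by the choice of \<open>hs_a\<close>, so its primitive is 1-periodic and it
  suffices to consider \<open>0 \<le> x \<le> 1\<close>.\<close>

definition hs_primitive ::
  "real \<Rightarrow> real \<Rightarrow> (real \<Rightarrow> real) \<Rightarrow> (real \<Rightarrow> real) \<Rightarrow> real \<Rightarrow> real" where
  "hs_primitive \<alpha> \<kappa> u \<rho> x =
     (LINT y|lebesgue_on {0..x}.
        \<kappa> / 2 * (\<rho> y)\<^sup>2 + (\<alpha> + 2) / 2 * (wderiv u y)\<^sup>2 + hs_a \<alpha> \<kappa> u \<rho>)"

text \<open>Solutions on \<open>[0,T)\<close> of class
  \<open>C([0,T); H\<^sup>2 \<times> H\<^sup>1) \<inter> C\<^sup>1([0,T); H\<^sup>1 \<times> L\<^sup>2)\<close>, for the fixed function \<open>h\<close>.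
  The equations are identities in \<open>H\<^sup>1\<close> and \<open>L\<^sup>2\<close> respectively, hence hold for almost every \<open>x\<close>.\<close>

definition hs_solution ::
  "real \<Rightarrow> real \<Rightarrow> (real \<Rightarrow> real) \<Rightarrow> (real \<Rightarrow> real) \<Rightarrow> (real \<Rightarrow> real) \<Rightarrow> ereal \<Rightarrow>
   (real \<Rightarrow> real \<Rightarrow> real) \<Rightarrow> (real \<Rightarrow> real \<Rightarrow> real) \<Rightarrow> bool" where
  "hs_solution \<alpha> \<kappa> h u0 \<rho>0 T u \<rho> \<longleftrightarrow>
     0 < T \<and> u 0 = u0 \<and> \<rho> 0 = \<rho>0 \<and>
     (let I = {t. 0 \<le> t \<and> ereal t < T} in
        sobolev_continuous_on 2 I u \<and> sobolev_continuous_on 1 I \<rho> \<and>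
        (\<exists>u' \<rho>'.
           sobolev_has_deriv_on 1 I u u' \<and> sobolev_continuous_on 1 I u' \<and>
           sobolev_has_deriv_on 0 I \<rho> \<rho>' \<and> sobolev_continuous_on 0 I \<rho>' \<and>
           (\<forall>t\<in>I.
              (AE x in circle. u' t x + u t x * wderiv (u t) x
                 = hs_primitive \<alpha> \<kappa> (u t) (\<rho> t) x + h t) \<and>
              (AE x in circle. \<rho>' t x + u t x * wderiv (\<rho> t) x
                 = \<alpha> * wderiv (u t) x * \<rho> t x))))"

text \<open>\<open>(u, \<rho>)\<close> is \<^emph>\<open>the\<close> solution and \<open>T\<close> its maximal existence time: every solution with the same
  initial datum lives on a subinterval of \<open>[0,T)\<close> and is a restriction of \<open>(u, \<rho>)\<close>.\<close>

definition hs_maximal_solution ::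
  "real \<Rightarrow> real \<Rightarrow> (real \<Rightarrow> real) \<Rightarrow> (real \<Rightarrow> real) \<Rightarrow> (real \<Rightarrow> real) \<Rightarrow> ereal \<Rightarrow>
   (real \<Rightarrow> real \<Rightarrow> real) \<Rightarrow> (real \<Rightarrow> real \<Rightarrow> real) \<Rightarrow> bool" where
  "hs_maximal_solution \<alpha> \<kappa> h u0 \<rho>0 T u \<rho> \<longleftrightarrow>
     hs_solution \<alpha> \<kappa> h u0 \<rho>0 T u \<rho> \<and>
     (\<forall>T' v \<sigma>. hs_solution \<alpha> \<kappa> h u0 \<rho>0 T' v \<sigma> \<longrightarrow>
        T' \<le> T \<and> (\<forall>t. 0 \<le> t \<and> ereal t < T' \<longrightarrow> v t = u t \<and> \<sigma> t = \<rho> t))"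

end

theory Submission
  imports Defs
begin

text \<open>
  For \<open>\<alpha> = - 1\<close> the system can be solved explicitly along particle paths. Let \<open>J\<close> be the Jacobian of the flow
  map of \<open>u\<close>. Then \<open>\<rho> = \<rho>\<^sub>0 / J\<close> and \<open>u\<^sub>x = J\<^sub>t / J\<close> along the paths, and the first equation, differentiated in
  space, becomes an Ermakov equation for the square root of \<open>J\<close>. Its solution is the modulus of a
  complex oscillation:
  \<open>J = |cos (\<omega> t / 2) + sin (\<omega> t / 2) (u\<^sub>0' + \<i> \<surd>\<kappa> \<rho>\<^sub>0) / \<omega>|\<^sup>2\<close>, where
  \<open>\<omega>\<^sup>2 = \<integral> (u\<^sub>0')\<^sup>2 + \<kappa> \<rho>\<^sub>0\<^sup>2\<close> is the conserved energy. Since \<open>\<rho>\<^sub>0\<close> has no zeros, the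
  oscillation never passes through \<open>0\<close>, and periodicity in time makes \<open>J\<close> bounded below uniformly
  (\<open>J_pos\<close>, \<open>uniform_bounds\<close>). The flow map therefore remains a diffeomorphism, and the solution exists for all times.

  The Jacobian determines the flow map up to a translation \<open>\<zeta> t\<close>. The primitive in the equation for \<open>u\<close>
  starts at the fixed position \<open>0\<close>, so \<open>\<zeta>\<close> solves an ordinary differential equation of second order, with
  the forcing \<open>h\<close> and an otherwise bounded, Lipschitz continuous right-hand side
  (\<open>particle_path\<close>, \<open>second_order_ode_global\<close>).

  Going back to fixed positions, \<open>u\<^sub>x\<close> and \<open>\<rho>\<close> are functions in \<open>H\<^sup>1\<close> composed with the inverse flow.
  Composition operators depend only strongly continuously on the diffeomorphism; that the solution is
  a continuous curve in \<open>H\<^sup>2 \<times> H\<^sup>1\<close> and differentiable in \<open>H\<^sup>1 \<times> L\<^sup>2\<close> follows by approximation with smooth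
  functions and bounds that are uniform in time (\<open>L2_tendsto_compose\<close>,
  \<open>L2_difference_quotient_compose\<close>).

  The second half of maximality, uniqueness, holds for all parameters: the squared norm of the
  difference of two solutions in \<open>H\<^sup>1 \<times> L\<^sup>2\<close> satisfies a linear differential inequality
  (\<open>energy_inequality\<close>, \<open>hs_solution_unique\<close>).

  Underneath lies an elementary theory of \<open>H\<^sup>1\<close> of the circle in which a weak derivative is a limit of
  classical ones (\<open>H1_deriv\<close>); it agrees with the definition by test functions because
  trigonometric polynomials are dense (\<open>du_Bois_Reymond\<close>).
\<close>



section \<open>Square-integrable functions on the circle\<close>

text \<open>Square integrability over one period is kept apart from periodicity, because the estimates
  only see the interval \<open>[0,1]\<close>.\<close>

definition sq_int :: "(real \<Rightarrow> real) \<Rightarrow> bool" where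
  "sq_int f \<longleftrightarrow> f \<in> borel_measurable circle \<and> integrable circle (\<lambda>x. (f x)\<^sup>2)"

lemma L2_circle_iff: "L2_circle f \<longleftrightarrow> periodic1 f \<and> sq_int f"
  by (auto simp: L2_circle_def sq_int_def)

lemma sq_int_measurable [measurable_dest]: "sq_int f \<Longrightarrow> f \<in> borel_measurable circle"
  by (simp add: sq_int_def)

lemma finite_measure_circle: "finite_measure circle"
  by (rule finite_measure_lebesgue_on) auto

lemma measure_circle [simp]: "measure circle {0..1} = 1"
  by (simp add: measure_restrict_space)

lemma integrable_circle_const [simp]: "integrable circle (\<lambda>x. c::real)"
  using finite_measure_circle by (intro finite_measure.integrable_const)

lemma integral_circle_const [simp]: "(LINT x|circle. (c::real)) = c"
  using measure_circle by simp

lemma continuous_integrable_circle: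
  "continuous_on {0..1} f \<Longrightarrow> integrable circle (f :: real \<Rightarrow> real)"
  by (rule continuous_imp_integrable_real)

lemma continuous_measurable_circle:
  "continuous_on {0..1} f \<Longrightarrow> (f :: real \<Rightarrow> real) \<in> borel_measurable circle"
  using continuous_integrable_circle by blast

lemma sq_int_continuous: "continuous_on {0..1} f \<Longrightarrow> sq_int f"
  unfolding sq_int_def
  by (intro conjI continuous_integrable_circle continuous_measurable_circle continuous_intros)

lemma AE_circleI: "(\<And>x. 0 \<le> x \<Longrightarrow> x \<le> 1 \<Longrightarrow> P x) \<Longrightarrow> AE x in circle. P x"
  by (intro AE_I2) auto

lemma integrable_circle_bound:
  fixes f g :: "real \<Rightarrow> real"
  assumes "integrable circle g" "f \<in> borel_measurable circle"
    "\<And>x. 0 \<le> x \<Longrightarrow> x \<le> 1 \<Longrightarrow> \<bar>f x\<bar> \<le> \<bar>g x\<bar>"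
  shows "integrable circle f"
  using assms(1,2)
  by (rule Bochner_Integration.integrable_bound) (auto intro!: AE_circleI assms(3))

lemma sq_int_mult_integrable:
  assumes "sq_int f" "sq_int g"
  shows "integrable circle (\<lambda>x. f x * g x)"
proof -
  note [measurable] = assms[THEN sq_int_measurable]
  have int: "integrable circle (\<lambda>x. (f x)\<^sup>2 + (g x)\<^sup>2)"
    using assms by (auto simp: sq_int_def)
  have "norm (f x * g x) \<le> norm ((f x)\<^sup>2 + (g x)\<^sup>2)" for x
  proof -
    have "0 \<le> (\<bar>f x\<bar> - \<bar>g x\<bar>)\<^sup>2" by simp
    then have "2 * (\<bar>f x\<bar> * \<bar>g x\<bar>) \<le> (f x)\<^sup>2 + (g x)\<^sup>2"
      by (simp add: power2_diff algebra_simps)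
    moreover have "0 \<le> \<bar>f x\<bar> * \<bar>g x\<bar>" by simp
    ultimately have "\<bar>f x\<bar> * \<bar>g x\<bar> \<le> (f x)\<^sup>2 + (g x)\<^sup>2" by linarith
    then show ?thesis by (simp add: abs_mult)
  qed
  then show ?thesis
    by (intro integrable_circle_bound[OF int]) auto
qed

lemma sq_int_add [intro]:
  assumes "sq_int f" "sq_int g" shows "sq_int (\<lambda>x. f x + g x)"
proof -
  note [measurable] = assms[THEN sq_int_measurable]
  have "integrable circle (\<lambda>x. (f x)\<^sup>2 + (g x)\<^sup>2 + 2 * (f x * g x))"
    using assms sq_int_mult_integrable[OF assms] by (auto simp: sq_int_def)
  then show ?thesis
    unfolding sq_int_def by (auto simp: power2_sum algebra_simps)
qed

lemma sq_int_mult_bounded: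
  assumes "sq_int f" "a \<in> borel_measurable circle" "\<And>x. 0 \<le> x \<Longrightarrow> x \<le> 1 \<Longrightarrow> \<bar>a x\<bar> \<le> C"
  shows "sq_int (\<lambda>x. a x * f x)"
proof -
  note [measurable] = assms(2) sq_int_measurable[OF assms(1)]
  have int: "integrable circle (\<lambda>x. C\<^sup>2 * (f x)\<^sup>2)"
    using assms by (auto simp: sq_int_def)
  have "norm ((a x * f x)\<^sup>2) \<le> norm (C\<^sup>2 * (f x)\<^sup>2)" if "0 \<le> x" "x \<le> 1" for x
    using assms(3)[OF that] abs_le_square_iff[of "a x" C]
    by (auto simp: power_mult_distrib intro!: mult_right_mono)
  then have "integrable circle (\<lambda>x. (a x * f x)\<^sup>2)"
    by (intro integrable_circle_bound[OF int]) auto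
  then show ?thesis unfolding sq_int_def by auto
qed

lemma continuous_bounded_01:
  assumes "continuous_on {0..1} (a :: real \<Rightarrow> real)"
  obtains C where "\<And>x. 0 \<le> x \<Longrightarrow> x \<le> 1 \<Longrightarrow> \<bar>a x\<bar> \<le> C"
proof -
  have "bounded (a ` {0..1})"
    using assms by (intro compact_imp_bounded compact_continuous_image) auto
  then obtain C where "\<forall>y\<in>a ` {0..1}. norm y \<le> C"
    unfolding bounded_iff by metis
  then show ?thesis by (intro that[of C]) auto
qed

lemma sq_int_mult_continuous [intro]:
  assumes "continuous_on {0..1} a" "sq_int f"
  shows "sq_int (\<lambda>x. a x * f x)"
proof -
  obtain C where "\<And>x. 0 \<le> x \<Longrightarrow> x \<le> 1 \<Longrightarrow> \<bar>a x\<bar> \<le> C"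
    using continuous_bounded_01[OF assms(1)] by blast
  then show ?thesis
    using sq_int_mult_bounded[OF assms(2) continuous_measurable_circle[OF assms(1)]] by blast
qed

lemma sq_int_const [intro, simp]: "sq_int (\<lambda>x. c)"
  by (intro sq_int_continuous continuous_intros)

lemma sq_int_cmult [intro]: "sq_int f \<Longrightarrow> sq_int (\<lambda>x. c * f x)"
  by (intro sq_int_mult_continuous continuous_intros)

lemma sq_int_minus [intro]: "sq_int f \<Longrightarrow> sq_int (\<lambda>x. - f x)"
  using sq_int_cmult[of f "-1"] by simp

lemma sq_int_diff [intro]: "sq_int f \<Longrightarrow> sq_int g \<Longrightarrow> sq_int (\<lambda>x. f x - g x)"
  using sq_int_add[OF _ sq_int_minus] by simp

lemma sq_int_divide [intro]: "sq_int f \<Longrightarrow> sq_int (\<lambda>x. f x / c)"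
  using sq_int_cmult[of f "1/c"] by simp

lemma sq_int_integrable: "sq_int f \<Longrightarrow> integrable circle f"
  using sq_int_mult_integrable[of f "\<lambda>x. 1"] by simp

lemma sq_int_sq_integrable: "sq_int f \<Longrightarrow> integrable circle (\<lambda>x. (f x)\<^sup>2)"
  by (simp add: sq_int_def)

lemma sq_int_abs [intro]: "sq_int f \<Longrightarrow> sq_int (\<lambda>x. \<bar>f x\<bar>)"
  by (auto simp: sq_int_def)

lemma L2_norm_nonneg [simp]: "0 \<le> L2_norm f"
  by (simp add: L2_norm_def)

lemma L2_norm_sq: "(L2_norm f)\<^sup>2 = (LINT x|circle. (f x)\<^sup>2)"
  by (simp add: L2_norm_def)

lemma L2_norm_cong_AE:
  assumes "AE x in circle. f x = g x" "f \<in> borel_measurable circle" "g \<in> borel_measurable circle"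
  shows "L2_norm f = L2_norm g"
proof -
  note [measurable] = assms(2,3)
  show ?thesis unfolding L2_norm_def
    by (intro arg_cong[where f=sqrt] integral_cong_AE) (use assms(1) in auto)
qed

lemma L2_norm_mono:
  assumes "sq_int g" "sq_int f" "AE x in circle. \<bar>f x\<bar> \<le> \<bar>g x\<bar>"
  shows "L2_norm f \<le> L2_norm g"
  unfolding L2_norm_def
  by (intro real_sqrt_le_mono integral_mono_AE)
    (use assms in \<open>auto simp: sq_int_def abs_le_square_iff\<close>)

lemma L2_norm_const: "L2_norm (\<lambda>x. c) = \<bar>c\<bar>"
  by (simp add: L2_norm_def)

lemma L2_norm_cmult: "L2_norm (\<lambda>x. c * f x) = \<bar>c\<bar> * L2_norm f"
  by (simp add: L2_norm_def power_mult_distrib real_sqrt_mult)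

lemma L2_norm_minus_commute: "L2_norm (\<lambda>x. f x - g x) = L2_norm (\<lambda>x. g x - f x)"
  unfolding L2_norm_def by (simp add: power2_commute)

lemma L2_norm_le_bound:
  assumes "sq_int f" "\<And>x. 0 \<le> x \<Longrightarrow> x \<le> 1 \<Longrightarrow> \<bar>f x\<bar> \<le> C"
  shows "L2_norm f \<le> C"
proof -
  have "0 \<le> C" using assms(2)[of 0] by auto
  then show ?thesis
    using L2_norm_mono[OF sq_int_const[of C] assms(1)] AE_circleI[of "\<lambda>x. \<bar>f x\<bar> \<le> \<bar>C\<bar>"] assms(2)
    by (simp add: L2_norm_const)
qed

lemma L2_norm_mult_le:
  assumes "sq_int f" "a \<in> borel_measurable circle" "\<And>x. 0 \<le> x \<Longrightarrow> x \<le> 1 \<Longrightarrow> \<bar>a x\<bar> \<le> C"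
  shows "L2_norm (\<lambda>x. a x * f x) \<le> C * L2_norm f"
proof -
  have C: "0 \<le> C" using assms(3)[of 0] by auto
  have "L2_norm (\<lambda>x. a x * f x) \<le> L2_norm (\<lambda>x. C * f x)"
    using assms C by (intro L2_norm_mono sq_int_mult_bounded[OF assms] sq_int_cmult AE_circleI)
      (auto simp: abs_mult intro!: mult_right_mono)
  then show ?thesis using C by (simp add: L2_norm_cmult)
qed

text \<open>The quadratic form \<open>\<integral> (s f + t g)\<^sup>2\<close> is nonnegative, so its discriminant is not positive.\<close>

lemma L2_Cauchy_Schwarz:
  assumes "sq_int f" "sq_int g"
  shows "\<bar>LINT x|circle. f x * g x\<bar> \<le> L2_norm f * L2_norm g"
proof -
  define A B D where "A = (LINT x|circle. (f x)\<^sup>2)" "B = (LINT x|circle. f x * g x)"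
    "D = (LINT x|circle. (g x)\<^sup>2)"
  have *: "0 \<le> A * s\<^sup>2 + 2 * B * s * t + D * t\<^sup>2" for s t
  proof -
    have "0 \<le> (LINT x|circle. (s * f x + t * g x)\<^sup>2)" by simp
    also have "\<dots> = (LINT x|circle. s\<^sup>2 * (f x)\<^sup>2 + 2 * s * t * (f x * g x) + t\<^sup>2 * (g x)\<^sup>2)"
      by (simp add: power2_sum power_mult_distrib algebra_simps)
    also have "\<dots> = A * s\<^sup>2 + 2 * B * s * t + D * t\<^sup>2"
      using assms sq_int_mult_integrable[OF assms]
      by (simp add: A_B_D_def sq_int_def)
    finally show ?thesis .
  qed
  have "B\<^sup>2 \<le> A * D"
  proof (cases "A = 0")
    case True
    have nn: "0 \<le> D" by (simp add: A_B_D_def)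
    have "B = 0"
    proof (rule ccontr)
      assume "B \<noteq> 0"
      have "0 \<le> 2 * B * (-(D + 1) / B) * 1 + D" using *[of "-(D+1)/B" 1] True by simp
      also have "\<dots> = - D - 2" using \<open>B \<noteq> 0\<close> by simp
      finally show False using nn by simp
    qed
    then show ?thesis using True by simp
  next
    case False
    then have A: "A > 0" by (simp add: A_B_D_def order_less_le)
    have "0 \<le> A * (B/A)\<^sup>2 - 2 * B * (B/A) + D" using *[of "B/A" "-1"] by simp
    also have "\<dots> = D - B\<^sup>2 / A" using A by (simp add: power2_eq_square field_simps)
    finally show ?thesis using A by (simp add: field_simps)
  qed
  then have "sqrt (B\<^sup>2) \<le> sqrt (A * D)" by (rule real_sqrt_le_mono)
  then show ?thesis by (simp add: A_B_D_def L2_norm_def real_sqrt_mult)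
qed

lemma L2_norm_triangle:
  assumes "sq_int f" "sq_int g"
  shows "L2_norm (\<lambda>x. f x + g x) \<le> L2_norm f + L2_norm g"
proof -
  have "(L2_norm (\<lambda>x. f x + g x))\<^sup>2 = (LINT x|circle. (f x)\<^sup>2 + 2 * (f x * g x) + (g x)\<^sup>2)"
    by (simp add: L2_norm_sq power2_sum algebra_simps)
  also have "\<dots> = (L2_norm f)\<^sup>2 + 2 * (LINT x|circle. f x * g x) + (L2_norm g)\<^sup>2"
    using assms sq_int_mult_integrable[OF assms] by (simp add: L2_norm_sq sq_int_def)
  also have "\<dots> \<le> (L2_norm f + L2_norm g)\<^sup>2"
    using L2_Cauchy_Schwarz[OF assms] by (simp add: power2_sum)
  finally show ?thesis by (rule power2_le_imp_le) auto
qed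

lemma L2_norm_triangle3:
  assumes "sq_int f" "sq_int g" "sq_int h"
  shows "L2_norm (\<lambda>x. f x - h x) \<le> L2_norm (\<lambda>x. f x - g x) + L2_norm (\<lambda>x. g x - h x)"
  using L2_norm_triangle[OF sq_int_diff[OF assms(1,2)] sq_int_diff[OF assms(2,3)]] by simp

lemma L2_norm_abs_diff:
  assumes "sq_int f" "sq_int g"
  shows "\<bar>L2_norm f - L2_norm g\<bar> \<le> L2_norm (\<lambda>x. f x - g x)"
  using L2_norm_triangle3[OF assms(1,2) sq_int_const[of 0]]
    L2_norm_triangle3[OF assms(2,1) sq_int_const[of 0]] L2_norm_minus_commute[of f g] by simp

lemma L2_norm_eq_0_AE:
  assumes "sq_int f" "L2_norm f = 0"
  shows "AE x in circle. f x = 0"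
proof -
  have "(LINT x|circle. (f x)\<^sup>2) = 0" using assms(2) by (simp add: L2_norm_def)
  then have "AE x in circle. (f x)\<^sup>2 = 0"
    using assms(1) integral_nonneg_eq_0_iff_AE[of circle "\<lambda>x. (f x)\<^sup>2"] by (auto simp: sq_int_def)
  then show ?thesis by simp
qed

subsection \<open>Convergence in the mean\<close>

text \<open>The filter is arbitrary: sequences of approximants and curves \<open>t \<mapsto> f t\<close> are treated alike.\<close>

definition L2_tendsto :: "('a \<Rightarrow> real \<Rightarrow> real) \<Rightarrow> (real \<Rightarrow> real) \<Rightarrow> 'a filter \<Rightarrow> bool" where
  "L2_tendsto f g F \<longleftrightarrow> sq_int g \<and> (\<forall>\<^sub>F s in F. sq_int (f s)) \<and>
     ((\<lambda>s. L2_norm (\<lambda>x. f s x - g x)) \<longlongrightarrow> 0) F"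

lemma L2_tendstoD:
  assumes "L2_tendsto f g F" "e > 0"
  shows "\<forall>\<^sub>F s in F. sq_int (f s) \<and> L2_norm (\<lambda>x. f s x - g x) < e"
proof -
  have "\<forall>\<^sub>F s in F. L2_norm (\<lambda>x. f s x - g x) < e"
    using assms by (intro order_tendstoD(2)) (auto simp: L2_tendsto_def)
  then show ?thesis using assms by (auto simp: L2_tendsto_def eventually_conj_iff)
qed

lemma L2_tendstoI_le:
  assumes "sq_int g" "\<forall>\<^sub>F s in F. sq_int (f s)" "\<forall>\<^sub>F s in F. L2_norm (\<lambda>x. f s x - g x) \<le> b s"
    "(b \<longlongrightarrow> 0) F"
  shows "L2_tendsto f g F"
  unfolding L2_tendsto_def
  using assms(1,2) tendsto_sandwich[OF _ assms(3) tendsto_const assms(4)] by auto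

lemma L2_tendstoI:
  assumes "sq_int g" "\<forall>\<^sub>F s in F. sq_int (f s)"
    "\<And>e. e > 0 \<Longrightarrow> \<forall>\<^sub>F s in F. L2_norm (\<lambda>x. f s x - g x) < e"
  shows "L2_tendsto f g F"
  unfolding L2_tendsto_def using assms by (auto simp: tendsto_iff)

lemma L2_tendsto_const: "sq_int g \<Longrightarrow> L2_tendsto (\<lambda>_. g) g F"
  by (auto simp: L2_tendsto_def L2_norm_const)

lemma L2_tendsto_add:
  assumes "L2_tendsto f f' F" "L2_tendsto g g' F"
  shows "L2_tendsto (\<lambda>s x. f s x + g s x) (\<lambda>x. f' x + g' x) F"
proof (rule L2_tendstoI_le)
  show "((\<lambda>s. L2_norm (\<lambda>x. f s x - f' x) + L2_norm (\<lambda>x. g s x - g' x)) \<longlongrightarrow> 0) F"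
    using tendsto_add[of _ 0 F _ 0] assms by (auto simp: L2_tendsto_def)
  have "\<forall>\<^sub>F s in F. sq_int (f s) \<and> sq_int (g s)"
    using assms by (auto simp: L2_tendsto_def eventually_conj_iff)
  then show "\<forall>\<^sub>F s in F. L2_norm (\<lambda>x. f s x + g s x - (f' x + g' x))
      \<le> L2_norm (\<lambda>x. f s x - f' x) + L2_norm (\<lambda>x. g s x - g' x)"
  proof eventually_elim
    case (elim s)
    then show ?case
      using L2_norm_triangle[of "\<lambda>x. f s x - f' x" "\<lambda>x. g s x - g' x"] assms
      by (auto simp: L2_tendsto_def algebra_simps)
  qed
qed (use assms in \<open>auto simp: L2_tendsto_def elim: eventually_elim2\<close>)

lemma L2_tendsto_imp_tendsto_norm:
  assumes "L2_tendsto f f' F"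
  shows "((\<lambda>s. L2_norm (f s)) \<longlongrightarrow> L2_norm f') F"
proof -
  have "((\<lambda>s. L2_norm (f s) - L2_norm f') \<longlongrightarrow> 0) F"
  proof (rule Lim_null_comparison)
    show "((\<lambda>s. L2_norm (\<lambda>x. f s x - f' x)) \<longlongrightarrow> 0) F" using assms by (simp add: L2_tendsto_def)
    have "\<forall>\<^sub>F s in F. sq_int (f s)" using assms by (simp add: L2_tendsto_def)
    then show "\<forall>\<^sub>F s in F. norm (L2_norm (f s) - L2_norm f') \<le> L2_norm (\<lambda>x. f s x - f' x)"
      by eventually_elim (use assms L2_norm_abs_diff in \<open>auto simp: L2_tendsto_def\<close>)
  qed
  then show ?thesis by (simp add: LIM_zero_iff)
qed

lemma L2_tendsto_integral_mult:
  assumes "L2_tendsto f f' F" "L2_tendsto g g' F"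
  shows "((\<lambda>s. LINT x|circle. f s x * g s x) \<longlongrightarrow> (LINT x|circle. f' x * g' x)) F"
proof -
  have "((\<lambda>s. (LINT x|circle. f s x * g s x) - (LINT x|circle. f' x * g' x)) \<longlongrightarrow> 0) F"
  proof (rule Lim_null_comparison)
    show "((\<lambda>s. L2_norm (\<lambda>x. f s x - f' x) * L2_norm (g s)
        + L2_norm f' * L2_norm (\<lambda>x. g s x - g' x)) \<longlongrightarrow> 0) F"
      using assms L2_tendsto_imp_tendsto_norm[OF assms(2)]
      by (auto intro!: tendsto_eq_intros simp: L2_tendsto_def)
    have "\<forall>\<^sub>F s in F. sq_int (f s) \<and> sq_int (g s)"
      using assms by (auto simp: L2_tendsto_def eventually_conj_iff)
    then show "\<forall>\<^sub>F s in F. norm ((LINT x|circle. f s x * g s x) - (LINT x|circle. f' x * g' x))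
        \<le> L2_norm (\<lambda>x. f s x - f' x) * L2_norm (g s) + L2_norm f' * L2_norm (\<lambda>x. g s x - g' x)"
    proof eventually_elim
      case (elim s)
      then have s: "sq_int (f s)" "sq_int (g s)" by auto
      have s': "sq_int f'" "sq_int g'" using assms by (auto simp: L2_tendsto_def)
      have "(LINT x|circle. f s x * g s x) - (LINT x|circle. f' x * g' x)
        = (LINT x|circle. (f s x - f' x) * g s x) + (LINT x|circle. f' x * (g s x - g' x))"
        using s s' by (simp add: algebra_simps sq_int_mult_integrable)
      then show ?case
        using L2_Cauchy_Schwarz[of "\<lambda>x. f s x - f' x" "g s"]
          L2_Cauchy_Schwarz[of f' "\<lambda>x. g s x - g' x"] s s' by (auto simp: sq_int_diff)
    qed
  qed
  then show ?thesis by (simp add: LIM_zero_iff)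
qed

lemma L2_tendsto_integral:
  "L2_tendsto f f' F \<Longrightarrow> ((\<lambda>s. LINT x|circle. f s x) \<longlongrightarrow> (LINT x|circle. f' x)) F"
  using L2_tendsto_integral_mult[of f f' F "\<lambda>_ _. 1" "\<lambda>_. 1"] L2_tendsto_const[of "\<lambda>_. 1" F] by simp

lemma uniform_limit_imp_L2_tendsto:
  assumes "uniform_limit {0..1} f f' F" "\<forall>\<^sub>F s in F. sq_int (f s)" "sq_int f'"
  shows "L2_tendsto f f' F"
proof (rule L2_tendstoI[OF assms(3,2)])
  fix e :: real assume "e > 0"
  then have "\<forall>\<^sub>F s in F. \<forall>x\<in>{0..1}. dist (f s x) (f' x) < e / 2"
    using assms(1) \<open>e > 0\<close> unfolding uniform_limit_iff by (meson half_gt_zero)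
  with assms(2) show "\<forall>\<^sub>F s in F. L2_norm (\<lambda>x. f s x - f' x) < e"
  proof eventually_elim
    case (elim s)
    then have "L2_norm (\<lambda>x. f s x - f' x) \<le> e / 2"
      using assms(3) by (intro L2_norm_le_bound) (auto simp: dist_real_def intro: less_imp_le)
    then show ?case using \<open>e > 0\<close> by simp
  qed
qed

lemma L2_tendsto_mult:
  assumes a: "uniform_limit {0..1} a a' F" "\<forall>\<^sub>F s in F. continuous_on {0..1} (a s)"
    "continuous_on {0..1} a'"
    and f: "L2_tendsto f f' F"
  shows "L2_tendsto (\<lambda>s x. a s x * f s x) (\<lambda>x. a' x * f' x) F"
proof -
  obtain C where C: "\<And>x. 0 \<le> x \<Longrightarrow> x \<le> 1 \<Longrightarrow> \<bar>a' x\<bar> \<le> C"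
    using continuous_bounded_01[OF a(3)] by blast
  have C0: "0 \<le> C" using C[of 0] by auto
  have f': "sq_int f'" using f by (simp add: L2_tendsto_def)
  show ?thesis
  proof (rule L2_tendstoI)
    show "sq_int (\<lambda>x. a' x * f' x)" using a(3) f' by auto
    have ev: "\<forall>\<^sub>F s in F. sq_int (f s)" using f by (simp add: L2_tendsto_def)
    with a(2) show "\<forall>\<^sub>F s in F. sq_int (\<lambda>x. a s x * f s x)"
      by eventually_elim auto
    fix e :: real assume e: "e > 0"
    define d where "d = min 1 (e / (2 * (C + 1 + L2_norm f' + 1)))"
    have den: "0 < C + 1 + L2_norm f' + 1" using C0 L2_norm_nonneg[of f'] by linarith
    have d: "d > 0" "d \<le> 1" using e den by (auto simp: d_def)
    have de: "d * (C + 1 + L2_norm f' + 1) \<le> e / 2"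
    proof -
      have "d * (C + 1 + L2_norm f' + 1) \<le> e / (2 * (C + 1 + L2_norm f' + 1)) * (C + 1 + L2_norm f' + 1)"
        using den by (intro mult_right_mono) (auto simp: d_def)
      also have "\<dots> = e / 2" using den by (simp add: field_simps)
      finally show ?thesis .
    qed
    have "\<forall>\<^sub>F s in F. \<forall>x\<in>{0..1}. dist (a s x) (a' x) < d"
      using a(1) d by (auto simp: uniform_limit_iff)
    with L2_tendstoD[OF f d(1)] a(2) show "\<forall>\<^sub>F s in F. L2_norm (\<lambda>x. a s x * f s x - a' x * f' x) < e"
    proof eventually_elim
      case (elim s)
      have 1: "L2_norm (\<lambda>x. a s x * (f s x - f' x)) \<le> (C + 1) * L2_norm (\<lambda>x. f s x - f' x)"
      proof (rule L2_norm_mult_le)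
        fix x :: real assume "0 \<le> x" "x \<le> 1"
        then have "\<bar>a s x - a' x\<bar> < d" using elim by (auto simp: dist_real_def)
        then show "\<bar>a s x\<bar> \<le> C + 1" using \<open>0 \<le> x\<close> \<open>x \<le> 1\<close> C[of x] d(2) by linarith
      qed (use elim f' continuous_measurable_circle in auto)
      have 2: "L2_norm (\<lambda>x. (a s x - a' x) * f' x) \<le> d * L2_norm f'"
        using elim f' a(3) by (intro L2_norm_mult_le continuous_measurable_circle continuous_intros)
          (auto simp: dist_real_def intro: less_imp_le)
      have "L2_norm (\<lambda>x. a s x * f s x - a' x * f' x) = 
          L2_norm (\<lambda>x. a s x * (f s x - f' x) + (a s x - a' x) * f' x)"
        by (simp add: algebra_simps)
      also have "\<dots> \<le> L2_norm (\<lambda>x. a s x * (f s x - f' x)) + L2_norm (\<lambda>x. (a s x - a' x) * f' x)"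
        using elim f' a(3) by (intro L2_norm_triangle sq_int_mult_continuous continuous_intros) auto
      also have "\<dots> \<le> (C + 1) * d + d * L2_norm f'"
        using 1 2 elim C0 mult_left_mono[of "L2_norm (\<lambda>x. f s x - f' x)" d "C + 1"] by linarith
      also have "\<dots> \<le> d * (C + 1 + L2_norm f' + 1)" using d by (simp add: algebra_simps)
      also have "\<dots> < e" using de e by simp
      finally show ?case .
    qed
  qed
qed

lemma L2_tendsto_cmult: "L2_tendsto f f' F \<Longrightarrow> L2_tendsto (\<lambda>s x. c * f s x) (\<lambda>x. c * f' x) F"
  by (rule L2_tendsto_mult[where a="\<lambda>_ _. c"]) (auto intro: uniform_limit_const)

lemma L2_tendsto_minus: "L2_tendsto f f' F \<Longrightarrow> L2_tendsto (\<lambda>s x. - f s x) (\<lambda>x. - f' x) F"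
  using L2_tendsto_cmult[of f f' F "-1"] by simp

lemma L2_tendsto_diff:
  "L2_tendsto f f' F \<Longrightarrow> L2_tendsto g g' F \<Longrightarrow>
    L2_tendsto (\<lambda>s x. f s x - g s x) (\<lambda>x. f' x - g' x) F"
  using L2_tendsto_add[OF _ L2_tendsto_minus] by simp

lemma L2_tendsto_cong:
  assumes "L2_tendsto f f' F" "\<forall>\<^sub>F s in F. sq_int (g s) \<and> (AE x in circle. f s x = g s x)"
    "sq_int g'" "AE x in circle. f' x = g' x"
  shows "L2_tendsto g g' F"
proof (rule L2_tendstoI_le)
  show "((\<lambda>s. L2_norm (\<lambda>x. f s x - f' x)) \<longlongrightarrow> 0) F" using assms by (simp add: L2_tendsto_def)
  have "\<forall>\<^sub>F s in F. sq_int (f s)" using assms by (simp add: L2_tendsto_def)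
  with assms(2) show "\<forall>\<^sub>F s in F. L2_norm (\<lambda>x. g s x - g' x) \<le> L2_norm (\<lambda>x. f s x - f' x)"
  proof eventually_elim
    case (elim s)
    have "AE x in circle. g s x - g' x = f s x - f' x"
      using elim assms(4) by auto
    then show ?case
      using elim assms(1,3) by (intro eq_refl L2_norm_cong_AE) (auto simp: L2_tendsto_def intro!: sq_int_measurable)
  qed
qed (use assms in \<open>auto elim: eventually_mono\<close>)


section \<open>Density of continuous periodic functions\<close>

lemma periodic1_int: "periodic1 f \<Longrightarrow> f (x + of_int k) = f x"
proof -
  assume p: "periodic1 f"
  have nat: "f (x + of_nat n) = f x" for n x
  proof (induction n)
    case (Suc n)
    have "f (x + of_nat n + 1) = f (x + of_nat n)" using p by (simp add: periodic1_def)
    then show ?case using Suc by (simp add: add_ac)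
  qed simp
  show ?thesis
  proof (cases "k \<ge> 0")
    case True
    then show ?thesis using nat[of x "nat k"] by simp
  next
    case False
    then show ?thesis using nat[of "x + of_int k" "nat (-k)"] by simp
  qed
qed

lemma periodic1_frac: "periodic1 f \<Longrightarrow> f (frac x) = f x"
  using periodic1_int[of f "frac x" "floor x"] by (simp add: frac_def)

lemma frac_01: "0 \<le> frac x" "frac x \<le> 1" for x :: real
  using frac_lt_1[of x] by (auto intro: less_imp_le)

lemma periodic_extension:
  assumes f: "continuous_on {0..1} f" "f 0 = f (1::real)"
  shows "continuous_on UNIV (\<lambda>x. f (frac x) :: real)" "periodic1 (\<lambda>x. f (frac x))"
    "\<And>x. 0 \<le> x \<Longrightarrow> x \<le> 1 \<Longrightarrow> f (frac x) = f x"
proof -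
  show p: "periodic1 (\<lambda>x. f (frac x))" by (simp add: periodic1_def frac_1_eq)
  show eq: "f (frac x) = f x" if "0 \<le> x" "x \<le> 1" for x
    using that f(2) by (cases "x = 1") (auto simp: frac_eq)
  have piece: "continuous_on {of_int k..of_int k + 1} (\<lambda>x. f (frac x))" for k :: int
  proof -
    have "f (frac x) = f (x - of_int k)" if "x \<in> {of_int k..of_int k + 1}" for x
      using eq[of "x - of_int k"] periodic1_int[OF p, of "x - of_int k" k] that by auto
    moreover have "continuous_on {of_int k..of_int k + 1} (\<lambda>x. f (x - of_int k))"
      by (rule continuous_on_compose2[OF f(1)]) (auto intro!: continuous_intros)
    ultimately show ?thesis by (metis (no_types, lifting) continuous_on_cong)
  qed
  have "isCont (\<lambda>x. f (frac x)) x" for x :: real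
  proof -
    define k where "k = (if x = of_int \<lfloor>x\<rfloor> then \<lfloor>x\<rfloor> - 1 else \<lfloor>x\<rfloor>)"
    have k: "of_int k < x" "x < of_int k + 2"
      unfolding k_def by (auto split: if_splits) linarith+
    have "continuous_on ({of_int k..of_int k + 1} \<union> {of_int (k+1)..of_int (k+1) + 1}) (\<lambda>x. f (frac x))"
      by (intro continuous_on_closed_Un piece) auto
    moreover have "({of_int k..of_int k + 1} \<union> {of_int (k+1)..of_int (k+1) + 1 :: real}) = {of_int k..of_int k + 2}"
      by auto
    ultimately have "continuous_on {of_int k..of_int k + 2} (\<lambda>x. f (frac x))" by simp
    then show ?thesis
      using k by (intro continuous_on_interior[of "{of_int k..of_int k + 2}"]) auto
  qed
  then show "continuous_on UNIV (\<lambda>x. f (frac x))"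
    by (simp add: continuous_on_eq_continuous_at)
qed

lemma L2_tendsto_dominated:
  fixes f :: "nat \<Rightarrow> real \<Rightarrow> real"
  assumes w: "sq_int w" and m: "\<And>n. f n \<in> borel_measurable circle" "g \<in> borel_measurable circle"
    and b: "\<And>n x. 0 \<le> x \<Longrightarrow> x \<le> 1 \<Longrightarrow> \<bar>f n x\<bar> \<le> \<bar>w x\<bar>"
      "\<And>x. 0 \<le> x \<Longrightarrow> x \<le> 1 \<Longrightarrow> \<bar>g x\<bar> \<le> \<bar>w x\<bar>"
    and lim: "AE x in circle. (\<lambda>n. f n x) \<longlonglongrightarrow> g x"
  shows "L2_tendsto f g sequentially"
proof -
  note [measurable] = m
  have iw: "integrable circle (\<lambda>x. (w x)\<^sup>2)" using w by (simp add: sq_int_def)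
  have sq: "sq_int h" if "h \<in> borel_measurable circle" "\<And>x. 0 \<le> x \<Longrightarrow> x \<le> 1 \<Longrightarrow> \<bar>h x\<bar> \<le> \<bar>w x\<bar>" for h
    unfolding sq_int_def using that
    by (auto intro!: integrable_circle_bound[OF iw] simp: abs_le_square_iff)
  have "(\<lambda>n. LINT x|circle. (f n x - g x)\<^sup>2) \<longlonglongrightarrow> (LINT x|circle. 0)"
  proof (rule integral_dominated_convergence[where w="\<lambda>x. 4 * (w x)\<^sup>2"])
    show "AE x in circle. (\<lambda>n. (f n x - g x)\<^sup>2) \<longlonglongrightarrow> 0"
      using lim by eventually_elim (auto intro!: tendsto_eq_intros simp: LIM_zero)
    fix n
    show "AE x in circle. norm ((f n x - g x)\<^sup>2) \<le> 4 * (w x)\<^sup>2"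
    proof (rule AE_circleI)
      fix x :: real assume x: "0 \<le> x" "x \<le> 1"
      have "\<bar>f n x - g x\<bar> \<le> \<bar>2 * w x\<bar>" using b(1)[OF x, of n] b(2)[OF x] by linarith
      then have "(f n x - g x)\<^sup>2 \<le> (2 * w x)\<^sup>2" by (simp add: abs_le_square_iff)
      then show "norm ((f n x - g x)\<^sup>2) \<le> 4 * (w x)\<^sup>2" by (simp add: power_mult_distrib)
    qed
  qed (use iw in auto)
  then have "(\<lambda>n. sqrt (LINT x|circle. (f n x - g x)\<^sup>2)) \<longlonglongrightarrow> sqrt 0"
    by (intro tendsto_real_sqrt) simp
  then show ?thesis
    using sq[OF m(1) b(1)] sq[OF m(2) b(2)] by (auto simp: L2_tendsto_def L2_norm_def)
qed

text \<open>A Lebesgue measurable function is almost everywhere a limit of continuous functions; truncating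
  these at the bound of \<open>g\<close> turns pointwise convergence into convergence in the mean.\<close>

lemma L2_approx_bounded:
  assumes m: "g \<in> borel_measurable circle" and b: "\<And>x. \<bar>g x\<bar> \<le> M"
  shows "\<exists>G. (\<forall>n. continuous_on UNIV (G n) \<and> periodic1 (G n)) \<and> L2_tendsto G g sequentially"
proof -
  have "g measurable_on {0..1}"
    using m by (simp add: measurable_on_iff_borel_measurable)
  then obtain N h where N: "negligible N" "\<And>n. continuous_on UNIV (h n)"
      "\<And>x. x \<notin> N \<Longrightarrow> (\<lambda>n. h n x) \<longlonglongrightarrow> (if x \<in> {0..1} then g x else 0)"
    unfolding measurable_on_def by blast
  \<comment> \<open>Cut off near the endpoints so that the approximants close up to periodic functions.\<close>
  define H where "H n x = min 1 (real n * min x (1 - x)) * max (- M) (min M (h n x))" for n and x :: real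
  have cH: "continuous_on A (H n)" for n A
    unfolding H_def by (intro continuous_intros continuous_on_subset[OF N(2)]) auto
  have H01: "H n 0 = 0" "H n 1 = 0" for n by (auto simp: H_def)
  have M: "0 \<le> M" using b[of 0] by auto
  have HM: "\<bar>H n x\<bar> \<le> M" if "0 \<le> x" "x \<le> 1" for n x
  proof -
    have "\<bar>min 1 (real n * min x (1 - x))\<bar> \<le> 1" 
    proof -
      have "0 \<le> real n * min x (1 - x)" using that by (intro mult_nonneg_nonneg) auto
      then show ?thesis by auto
    qed
    moreover have "\<bar>max (- M) (min M (h n x))\<bar> \<le> M" using M by auto
    ultimately have "\<bar>min 1 (real n * min x (1 - x))\<bar> * \<bar>max (- M) (min M (h n x))\<bar> \<le> 1 * M"
      by (intro mult_mono) auto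
    then show ?thesis by (simp add: H_def abs_mult)
  qed
  have "L2_tendsto H g sequentially"
  proof (rule L2_tendsto_dominated[where w="\<lambda>_. M"])
    have "AE x in lebesgue. x \<notin> N \<union> {0,1}"
      using N(1) by (intro AE_not_in) (auto simp: negligible_iff_null_sets[symmetric])
    then have "AE x in lebesgue. x \<in> {0..1} \<longrightarrow> x \<notin> N \<union> {0,1}" by eventually_elim auto
    then have "AE x in circle. x \<notin> N \<union> {0,1}"
      by (subst AE_restrict_space_iff) auto
    moreover have "AE x in circle. 0 \<le> x \<and> x \<le> 1" by (rule AE_circleI) auto
    ultimately show "AE x in circle. (\<lambda>n. H n x) \<longlonglongrightarrow> g x"
    proof eventually_elim
      case (elim x)
      then have x: "x > 0" "x < 1" "x \<notin> N" by auto
      have "(\<lambda>n. max (- M) (min M (h n x))) \<longlonglongrightarrow> max (- M) (min M (g x))"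
        using N(3)[OF x(3)] x by (intro tendsto_max tendsto_min tendsto_const) auto
      moreover have "max (- M) (min M (g x)) = g x" using b[of x] by auto
      moreover have "(\<lambda>n. min 1 (real n * min x (1 - x))) \<longlonglongrightarrow> 1"
      proof (rule tendsto_eventually)
        define c where "c = min x (1 - x)"
        have c: "c > 0" using x by (simp add: c_def)
        obtain n0 where n0: "real n0 > 1 / c" using reals_Archimedean2 by blast
        have "1 \<le> real n * c" if "n \<ge> n0" for n
        proof -
          have "1 / c \<le> real n" using n0 that by linarith
          then show ?thesis using c by (simp add: field_simps)
        qed
        then have "\<forall>n\<ge>n0. min 1 (real n * c) = 1" by (auto simp: min_def)
        then show "\<forall>\<^sub>F n in sequentially. min 1 (real n * min x (1 - x)) = 1"
          unfolding c_def eventually_sequentially by blast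
      qed
      ultimately show ?case unfolding H_def using tendsto_mult by fastforce
    qed
  qed (use HM M b m in \<open>auto intro!: continuous_measurable_circle cH\<close>)
  note HL = this
  define G where "G n x = H n (frac x)" for n x
  note ext = periodic_extension[OF cH[of "{0..1}"], folded G_def]
  have "L2_tendsto G g sequentially"
  proof (rule L2_tendsto_cong[OF HL])
    show "\<forall>\<^sub>F n in sequentially. sq_int (G n) \<and> (AE x in circle. H n x = G n x)"
      using ext H01 by (intro always_eventually allI conjI AE_circleI sq_int_continuous)
        (auto intro: continuous_on_subset)
  qed (use HL in \<open>auto simp: L2_tendsto_def\<close>)
  moreover have "\<forall>n. continuous_on UNIV (G n) \<and> periodic1 (G n)"
    using ext H01 by auto
  ultimately show ?thesis by blast
qed

lemma L2_approx_continuous: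
  assumes "sq_int g"
  obtains G where "\<And>n. continuous_on UNIV (G n)" "\<And>n. periodic1 (G n)" "L2_tendsto G g sequentially"
proof -
  note [measurable] = sq_int_measurable[OF assms]
  define c where "c n x = max (- real n) (min (real n) (g x))" for n x
  have cm: "c n \<in> borel_measurable circle" for n unfolding c_def by measurable
  have cL: "L2_tendsto c g sequentially"
  proof (rule L2_tendsto_dominated[OF assms cm])
    show "AE x in circle. (\<lambda>n. c n x) \<longlonglongrightarrow> g x"
    proof (rule AE_circleI)
      fix x
      obtain n0 where "real n0 > \<bar>g x\<bar>" using reals_Archimedean2 by blast
      then have "c n x = g x" if "n \<ge> n0" for n
        using that unfolding c_def by auto
      then show "(\<lambda>n. c n x) \<longlonglongrightarrow> g x"
        by (intro tendsto_eventually) (auto simp: eventually_sequentially)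
    qed
    show "\<bar>c n x\<bar> \<le> \<bar>g x\<bar>" for n x unfolding c_def by auto
  qed auto
  have "\<exists>G. continuous_on UNIV G \<and> periodic1 G \<and> L2_norm (\<lambda>x. G x - c n x) < 1 / real (Suc n)" for n
  proof -
    have "\<bar>c n x\<bar> \<le> real n" for x by (auto simp: c_def)
    from L2_approx_bounded[OF cm this] obtain G where
      G: "\<forall>n. continuous_on UNIV (G n) \<and> periodic1 (G n)" "L2_tendsto G (c n) sequentially" by blast
    have "\<forall>\<^sub>F k in sequentially. sq_int (G k) \<and> L2_norm (\<lambda>x. G k x - c n x) < 1 / real (Suc n)"
      by (rule L2_tendstoD[OF G(2)]) simp
    then show ?thesis using G(1) by (auto simp: eventually_sequentially)
  qed
  then obtain G where G: "\<And>n. continuous_on UNIV (G n)" "\<And>n. periodic1 (G n)"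
      "\<And>n. L2_norm (\<lambda>x. G n x - c n x) < 1 / real (Suc n)"
    by metis
  have sG: "sq_int (G n)" for n
    using G(1) by (intro sq_int_continuous) (auto intro: continuous_on_subset)
  have sc: "\<forall>\<^sub>F n in sequentially. sq_int (c n)" using cL by (simp add: L2_tendsto_def)
  have "L2_tendsto G g sequentially"
  proof (rule L2_tendstoI_le[OF assms])
    show "(\<lambda>n. 1 / real (Suc n) + L2_norm (\<lambda>x. c n x - g x)) \<longlonglongrightarrow> 0"
      using tendsto_add[OF LIMSEQ_inverse_real_of_nat, of "\<lambda>n. L2_norm (\<lambda>x. c n x - g x)" 0] cL
      by (simp add: L2_tendsto_def inverse_eq_divide)
    from sc show "\<forall>\<^sub>F n in sequentially. L2_norm (\<lambda>x. G n x - g x) \<le> 1 / real (Suc n) + L2_norm (\<lambda>x. c n x - g x)"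
    proof eventually_elim
      case (elim n)
      then show ?case using L2_norm_triangle3[OF sG elim assms, of n] G(3)[of n] by linarith
    qed
  qed (use sG in auto)
  then show ?thesis using that G by blast
qed

section \<open>Trigonometric test functions and uniqueness of weak derivatives\<close>

text \<open>Test functions have to be differentiable infinitely often. Trigonometric polynomials form a class
  that is closed under differentiation, so that one derivative suffices to see this.\<close>

inductive trig_poly :: "(real \<Rightarrow> real) \<Rightarrow> bool" where
  const: "trig_poly (\<lambda>x. c)"
| cos: "trig_poly (\<lambda>x. cos (2 * pi * x))"
| sin: "trig_poly (\<lambda>x. sin (2 * pi * x))"
| add: "trig_poly f \<Longrightarrow> trig_poly g \<Longrightarrow> trig_poly (\<lambda>x. f x + g x)"
| mult: "trig_poly f \<Longrightarrow> trig_poly g \<Longrightarrow> trig_poly (\<lambda>x. f x * g x)"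

lemma trig_poly_deriv:
  "trig_poly f \<Longrightarrow> \<exists>f'. trig_poly f' \<and> (\<forall>x. (f has_real_derivative f' x) (at x))"
proof (induction rule: trig_poly.induct)
  case (const c)
  show ?case by (rule exI[of _ "\<lambda>x. 0"]) (auto intro: trig_poly.const)
next
  case cos
  show ?case
    by (rule exI[of _ "\<lambda>x. (- 2 * pi) * sin (2 * pi * x)"])
      (rule conjI, intro trig_poly.mult trig_poly.const trig_poly.sin,
        auto intro!: derivative_eq_intros)
next
  case sin
  show ?case
    by (rule exI[of _ "\<lambda>x. (2 * pi) * cos (2 * pi * x)"])
      (rule conjI, intro trig_poly.mult trig_poly.const trig_poly.cos,
        auto intro!: derivative_eq_intros)
next
  case (add f g)
  then obtain f' g' where "trig_poly f'" "trig_poly g'" "\<forall>x. (f has_real_derivative f' x) (at x)"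
    "\<forall>x. (g has_real_derivative g' x) (at x)" by blast
  then show ?case
    by (intro exI[of _ "\<lambda>x. f' x + g' x"]) (auto intro!: trig_poly.add DERIV_add)
next
  case (mult f g)
  then obtain f' g' where "trig_poly f'" "trig_poly g'" "\<forall>x. (f has_real_derivative f' x) (at x)"
    "\<forall>x. (g has_real_derivative g' x) (at x)" by blast
  then show ?case using mult.hyps
    by (intro exI[of _ "\<lambda>x. f' x * g x + g' x * f x"])
      (auto intro!: trig_poly.add trig_poly.mult DERIV_mult)
qed

lemma trig_poly_continuous: "trig_poly f \<Longrightarrow> continuous_on A f"
  using trig_poly_deriv by (meson DERIV_continuous continuous_at_imp_continuous_on)

lemma trig_poly_periodic: "trig_poly f \<Longrightarrow> periodic1 f"
  unfolding periodic1_def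
proof (induction rule: trig_poly.induct)
  case cos show ?case by (simp add: distrib_left cos_add)
next
  case sin show ?case by (simp add: distrib_left sin_add)
qed auto

lemma trig_poly_funpow_deriv: "trig_poly f \<Longrightarrow> trig_poly ((deriv ^^ n) f)"
proof (induction n arbitrary: f)
  case (Suc n)
  obtain f' where f': "trig_poly f'" "\<And>x. (f has_real_derivative f' x) (at x)"
    using trig_poly_deriv[OF Suc.prems] by blast
  then have "deriv f = f'" by (auto intro!: DERIV_imp_deriv)
  then show ?case using Suc.IH[OF f'(1)] by (simp add: funpow_swap1)
qed simp

lemma trig_poly_differentiable: "trig_poly f \<Longrightarrow> f differentiable_on UNIV"
  using trig_poly_deriv unfolding differentiable_on_def
  by (metis differentiableI has_field_derivative_def)

lemma trig_poly_test_function: "trig_poly f \<Longrightarrow> test_function f"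
  unfolding test_function_def
  using trig_poly_periodic trig_poly_funpow_deriv trig_poly_differentiable by blast

lemma FTC_integral:
  fixes F f :: "real \<Rightarrow> real"
  assumes "a \<le> b" "\<And>x. a \<le> x \<Longrightarrow> x \<le> b \<Longrightarrow> (F has_real_derivative f x) (at x within {a..b})"
    "continuous_on {a..b} f"
  shows "(LINT x|lebesgue_on {a..b}. f x) = F b - F a"
proof -
  have "(f has_integral (F b - F a)) {a..b}"
    using assms by (intro fundamental_theorem_of_calculus)
      (auto simp: has_real_derivative_iff_has_vector_derivative)
  then show ?thesis
    using assms(3) by (simp add: lebesgue_integral_eq_integral continuous_imp_integrable_real
        integral_unique)
qed

lemma continuous_antiderivative:
  fixes f :: "real \<Rightarrow> real"
  assumes "continuous_on UNIV f"
  obtains F where "\<And>x. (F has_real_derivative f x) (at x)" "F a = 0"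
proof -
  have "\<exists>F. \<forall>x::real. - \<infinity> < ereal x \<longrightarrow> ereal x < \<infinity> \<longrightarrow> (F has_vector_derivative f x) (at x)"
    using assms by (intro einterval_antiderivative) (auto simp: continuous_on_eq_continuous_at)
  then obtain F where F: "\<And>x. (F has_real_derivative f x) (at x)"
    by (auto simp: has_real_derivative_iff_has_vector_derivative)
  have "((\<lambda>x. F x - F a) has_real_derivative f x) (at x)" for x
    by (auto intro!: derivative_eq_intros F)
  then show ?thesis using that[of "\<lambda>x. F x - F a"] by auto
qed

lemma periodic_antiderivative:
  assumes d: "\<And>x. (F has_real_derivative f x) (at x)" and f: "periodic1 f" "continuous_on UNIV f"
    and 0: "(LINT x|circle. f x) = 0"
  shows "periodic1 F"
proof -
  have "((\<lambda>x. F (x + 1) - F x) has_real_derivative f (x + 1) * 1 - f x) (at x)" for x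
    by (intro DERIV_diff d DERIV_chain2[OF d]) (auto intro!: derivative_eq_intros)
  then have "((\<lambda>x. F (x + 1) - F x) has_real_derivative 0) (at x)" for x
    using f(1) by (simp add: periodic1_def)
  then have "F (x + 1) - F x = F (0 + 1) - F 0" for x
    using DERIV_isconst_all[of "\<lambda>x. F (x + 1) - F x"] by blast
  moreover have "F 1 - F 0 = 0"
    using FTC_integral[of 0 1 F f] 0 f(2)
    by (auto intro: continuous_on_subset has_field_derivative_at_within d)
  ultimately show ?thesis by (simp add: periodic1_def)
qed

text \<open>Periodic functions are functions on the unit circle of the complex plane, where the theorem of
  Stone and Weierstrass applies; the coordinates of the circle are cosine and sine.\<close>

lemma trig_poly_approx:
  assumes f: "continuous_on UNIV f" "periodic1 f" and e: "e > 0"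
  obtains p where "trig_poly p" "\<And>x. \<bar>f x - p x\<bar> < e"
proof -
  define c where "c x = cis (2 * pi * x)" for x
  have c: "continuous_on A c" for A unfolding c_def by (intro continuous_intros)
  have c_eq: "f x = f y" if "c x = c y" for x y
  proof -
    have "sin (2*pi*x) = sin (2*pi*y) \<and> cos (2*pi*x) = cos (2*pi*y)"
      using that by (auto simp: c_def complex_eq_iff)
    then obtain k :: int where "2*pi*x = 2*pi*y + 2 * pi * of_int k"
      unfolding sin_cos_eq_iff by (auto simp: mult_ac)
    then have "2*pi*x = 2 * pi * (y + of_int k)" by (simp add: algebra_simps)
    then have "x = y + of_int k" by simp
    then show ?thesis using periodic1_int[OF f(2)] by simp
  qed
  have surj: "\<exists>x\<in>{0..1}. c x = z" if nz: "norm z = 1" for z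
  proof -
    obtain t where t: "0 \<le> t" "t < 2 * pi" "z = Complex (cos t) (sin t)"
      using complex_unimodular_polar[OF nz] by blast
    then have "c (t / (2*pi)) = z" by (auto simp: c_def complex_eq_iff)
    then show ?thesis using t by (intro bexI[of _ "t / (2*pi)"]) auto
  qed
  define F where "F z = f (SOME x. c x = z)" for z
  have Fc: "F (c x) = f x" for x
    unfolding F_def by (rule c_eq, rule someI[of "\<lambda>y. c y = c x"]) simp
  \<comment> \<open>\<open>x \<mapsto> cis (2 \<pi> x)\<close> is a quotient map of \<open>[0,1]\<close> onto the unit circle, so \<open>F\<close> is continuous.\<close>
  have "continuous_on (sphere 0 1) F"
    unfolding continuous_on_closed_invariant
  proof (intro allI impI)
    fix C :: "real set" assume C: "closed C"
    have "closed (f -` C)" using C f(1) by (simp add: closed_vimage)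
    then have "compact ({0..1} \<inter> f -` C)" by (intro compact_Int_closed) auto
    then have "closed (c ` ({0..1} \<inter> f -` C))"
      by (intro compact_imp_closed compact_continuous_image c)
    moreover have "c ` ({0..1} \<inter> f -` C) \<inter> sphere 0 1 = F -` C \<inter> sphere 0 1"
    proof (intro set_eqI iffI)
      fix z assume "z \<in> F -` C \<inter> sphere 0 1"
      then have z: "F z \<in> C" "norm z = 1" by auto
      then obtain x where "x \<in> {0..1}" "c x = z" using surj by blast
      then show "z \<in> c ` ({0..1} \<inter> f -` C) \<inter> sphere 0 1" using z Fc[of x] by auto
    qed (use Fc in auto)
    ultimately show "\<exists>A. closed A \<and> A \<inter> sphere 0 1 = F -` C \<inter> sphere 0 1" by blast
  qed
  then obtain g where g: "real_polynomial_function g" "\<And>z. z \<in> sphere 0 1 \<Longrightarrow> \<bar>F z - g z\<bar> < e"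
    using Stone_Weierstrass_real_polynomial_function[of "sphere (0::complex) 1" F e] e by auto
  have "trig_poly (\<lambda>x. g (c x))" using g(1)
  proof (induction rule: real_polynomial_function.induct)
    case (linear f)
    interpret bounded_linear f by fact
    have "f (c x) = f 1 * cos (2*pi*x) + f \<i> * sin (2*pi*x)" for x
    proof -
      have "c x = cos (2*pi*x) *\<^sub>R 1 + sin (2*pi*x) *\<^sub>R \<i>" by (simp add: c_def complex_eq_iff)
      then show ?thesis by (simp add: add scaleR)
    qed
    then have "(\<lambda>x. f (c x)) = (\<lambda>x. f 1 * cos (2*pi*x) + f \<i> * sin (2*pi*x))" by (intro ext)
    then show ?case
      by (simp only:) (intro trig_poly.add trig_poly.mult trig_poly.const trig_poly.cos trig_poly.sin)
  qed (auto intro: trig_poly.intros)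
  moreover have "\<bar>f x - g (c x)\<bar> < e" for x
    using g(2)[of "c x"] Fc[of x] by (simp add: c_def)
  ultimately show ?thesis using that by blast
qed

text \<open>Orthogonality extends to continuous periodic functions by uniform approximation and then, by
  density, to \<open>k\<close> itself.\<close>

lemma orthogonal_trig_poly_imp_zero:
  assumes k: "sq_int k" and o: "\<And>p. trig_poly p \<Longrightarrow> (LINT x|circle. k x * p x) = 0"
  shows "AE x in circle. k x = 0"
proof -
  have *: "(LINT x|circle. k x * f x) = 0" if f: "continuous_on UNIV f" "periodic1 f" for f
  proof (rule ccontr)
    assume n: "(LINT x|circle. k x * f x) \<noteq> 0"
    define e where "e = \<bar>LINT x|circle. k x * f x\<bar> / (2 * (L2_norm k + 1))"
    have k1: "0 < L2_norm k + 1" using L2_norm_nonneg[of k] by linarith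
    then have e: "e > 0" using n by (simp add: e_def)
    obtain p where p: "trig_poly p" "\<And>x. \<bar>f x - p x\<bar> < e" using trig_poly_approx[OF f e] by blast
    have sf: "sq_int f" "sq_int p"
      using f trig_poly_continuous[OF p(1)] by (auto intro!: sq_int_continuous continuous_on_subset[OF f(1)])
    have "(LINT x|circle. k x * f x) = (LINT x|circle. k x * (f x - p x))"
      using o[OF p(1)] sq_int_mult_integrable[OF k sf(1)] sq_int_mult_integrable[OF k sf(2)]
      by (simp add: right_diff_distrib)
    also have "\<bar>\<dots>\<bar> \<le> L2_norm k * L2_norm (\<lambda>x. f x - p x)"
      by (rule L2_Cauchy_Schwarz) (use k sf in auto)
    also have "\<dots> \<le> L2_norm k * e"
      using p(2) sf by (intro mult_left_mono L2_norm_le_bound) (auto intro: less_imp_le)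
    also have "\<dots> < (L2_norm k + 1) * e" using e by simp
    also have "\<dots> = \<bar>LINT x|circle. k x * f x\<bar> / 2" using k1 by (simp add: e_def field_simps)
    finally show False by simp
  qed
  obtain G where G: "\<And>n. continuous_on UNIV (G n)" "\<And>n. periodic1 (G n)" "L2_tendsto G k sequentially"
    using L2_approx_continuous[OF k] by blast
  have "(\<lambda>n. LINT x|circle. k x * G n x) \<longlonglongrightarrow> (LINT x|circle. k x * k x)"
    by (intro L2_tendsto_integral_mult L2_tendsto_const k G)
  then have "(LINT x|circle. k x * k x) = 0"
    using *[OF G(1,2)] by (simp add: LIMSEQ_const_iff)
  then have "L2_norm k = 0" by (simp add: L2_norm_def power2_eq_square)
  then show ?thesis using L2_norm_eq_0_AE k by blast
qed

lemma weak_deriv_unique: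
  assumes "is_weak_deriv f g" "is_weak_deriv f g'" "sq_int g" "sq_int g'"
  shows "AE x in circle. g x = g' x"
proof -
  have "AE x in circle. g x - g' x = 0"
  proof (rule orthogonal_trig_poly_imp_zero)
    fix p assume p: "trig_poly p"
    then have t: "test_function p" and sp: "sq_int p"
      by (auto intro: trig_poly_test_function sq_int_continuous trig_poly_continuous)
    have "(LINT x|circle. g x * p x) = (LINT x|circle. g' x * p x)"
      using assms(1,2) t unfolding is_weak_deriv_def by fastforce
    then show "(LINT x|circle. (g x - g' x) * p x) = 0"
      using assms(3,4) sp by (simp add: left_diff_distrib sq_int_mult_integrable)
  qed (use assms in auto)
  then show ?thesis by simp
qed

text \<open>Every trigonometric polynomial of mean zero is the derivative of a test function. Hence \<open>k\<close> minus
  its mean is orthogonal to all trigonometric polynomials.\<close>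

lemma du_Bois_Reymond:
  assumes k: "sq_int k" and z: "is_weak_deriv k (\<lambda>x. 0)"
  shows "AE x in circle. k x = (LINT x|circle. k x)"
proof -
  define m where "m = (LINT x|circle. k x)"
  have "AE x in circle. k x - m = 0"
  proof (rule orthogonal_trig_poly_imp_zero)
    show "sq_int (\<lambda>x. k x - m)" using k by auto
    fix p assume p: "trig_poly p"
    have sp: "sq_int p" using p by (auto intro: sq_int_continuous trig_poly_continuous)
    define q where "q x = p x + (- (LINT x|circle. p x))" for x
    have q: "trig_poly q" unfolding q_def by (intro trig_poly.add trig_poly.const p)
    have q0: "(LINT x|circle. q x) = 0"
      unfolding q_def using sp by (subst Bochner_Integration.integral_add) (auto intro: sq_int_integrable)
    obtain Q where Q: "\<And>x. (Q has_real_derivative q x) (at x)"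
      using continuous_antiderivative[OF trig_poly_continuous[OF q]] by blast
    have dQ: "deriv Q = q" using Q by (auto intro!: DERIV_imp_deriv)
    have "(deriv ^^ n) Q differentiable_on UNIV" for n
    proof (cases n)
      case 0
      then show ?thesis using Q unfolding differentiable_on_def
        by (metis differentiableI has_field_derivative_def funpow_0)
    next
      case (Suc j)
      then show ?thesis
        using trig_poly_differentiable[OF trig_poly_funpow_deriv[OF q, of j]] by (simp add: funpow_swap1 dQ)
    qed
    moreover have "periodic1 Q"
      by (rule periodic_antiderivative[OF Q trig_poly_periodic[OF q] trig_poly_continuous[OF q] q0])
    ultimately have "test_function Q" by (simp add: test_function_def)
    then have kq: "(LINT x|circle. k x * q x) = 0"
      using z dQ by (auto simp: is_weak_deriv_def)
    have "(LINT x|circle. (k x - m) * p x) = (LINT x|circle. k x * p x) - m * (LINT x|circle. p x)"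
      using k sp sq_int_mult_integrable[OF k sp] by (simp add: left_diff_distrib sq_int_integrable)
    also have "\<dots> = (LINT x|circle. k x * q x)"
      unfolding q_def distrib_left m_def using k sp sq_int_mult_integrable[OF k sp]
      by (subst Bochner_Integration.integral_add) (auto intro: sq_int_integrable)
    finally show "(LINT x|circle. (k x - m) * p x) = 0" using kq by simp
  qed
  then show ?thesis by (simp add: m_def)
qed


section \<open>Calculus in the Sobolev space of order one\<close>

definition C1_periodic :: "(real \<Rightarrow> real) \<Rightarrow> (real \<Rightarrow> real) \<Rightarrow> bool" where
  "C1_periodic F G \<longleftrightarrow> periodic1 F \<and> continuous_on UNIV G \<and> (\<forall>x. (F has_real_derivative G x) (at x))"

text \<open>Membership in \<open>H\<^sup>1\<close>, with \<open>g\<close> a representative of the weak derivative of \<open>f\<close>. Using approximation by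
  continuously differentiable functions as the definition makes the rules for products, quotients and
  compositions limits of the classical ones; that it agrees with the duality definition is shown
  in the next section.\<close>

definition H1_deriv :: "(real \<Rightarrow> real) \<Rightarrow> (real \<Rightarrow> real) \<Rightarrow> bool" where
  "H1_deriv f g \<longleftrightarrow> L2_circle g \<and>
     (\<exists>F G. (\<forall>n. C1_periodic (F n) (G n)) \<and> uniform_limit UNIV F f sequentially \<and>
        L2_tendsto G g sequentially)"

lemma periodic1_bound:
  assumes "periodic1 f" "\<And>x. 0 \<le> x \<Longrightarrow> x \<le> 1 \<Longrightarrow> P (f x)"
  shows "P (f x)"
  using assms(2)[OF frac_01, of x] periodic1_frac[OF assms(1)] by simp

lemma C1_periodic_continuous: "C1_periodic F G \<Longrightarrow> continuous_on A F" "C1_periodic F G \<Longrightarrow> continuous_on A G"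
  unfolding C1_periodic_def
  by (meson DERIV_continuous continuous_at_imp_continuous_on, meson continuous_on_subset subset_UNIV)

lemma C1_periodic_deriv_periodic:
  assumes "C1_periodic F G" shows "periodic1 G"
  unfolding periodic1_def
proof
  fix x
  have "((\<lambda>x. F (x + 1)) has_real_derivative G (x + 1)) (at x)"
    using assms DERIV_shift[of F "G (x + 1)" x 1] unfolding C1_periodic_def by auto
  moreover have "(\<lambda>x. F (x + 1)) = F" using assms by (auto simp: C1_periodic_def periodic1_def)
  moreover have "(F has_real_derivative G x) (at x)" using assms by (auto simp: C1_periodic_def)
  ultimately show "G (x + 1) = G x" using DERIV_unique by metis
qed

lemma C1_periodic_sq_int: "C1_periodic F G \<Longrightarrow> sq_int F" "C1_periodic F G \<Longrightarrow> sq_int G"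
  by (auto intro: sq_int_continuous C1_periodic_continuous)

lemma C1_periodic_integral_deriv: "C1_periodic F G \<Longrightarrow> (LINT x|circle. G x) = 0"
  using FTC_integral[of 0 1 F G] C1_periodic_continuous[of F G]
  by (auto simp: C1_periodic_def periodic1_def has_field_derivative_at_within)
     (metis add.left_neutral)

lemma L1_le_L2_norm: "sq_int g \<Longrightarrow> (LINT x|circle. \<bar>g x\<bar>) \<le> L2_norm g"
  using L2_Cauchy_Schwarz[of "\<lambda>x. \<bar>g x\<bar>" "\<lambda>x. 1"] sq_int_abs[of g]
  by (simp add: L2_norm_const L2_norm_def)

text \<open>Through this inequality, convergence of derivatives in the mean forces uniform convergence of the
  functions, up to constants.\<close>

lemma C1_periodic_oscillation:
  assumes "C1_periodic F G"
  shows "\<bar>F x - F y\<bar> \<le> L2_norm G"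
proof -
  have FG: "periodic1 F" "continuous_on A G" "\<And>x. (F has_real_derivative G x) (at x)" for A
    using assms C1_periodic_continuous(2)[OF assms] by (auto simp: C1_periodic_def)
  have *: "\<bar>F b - F a\<bar> \<le> L2_norm G" if "0 \<le> a" "a \<le> b" "b \<le> 1" for a b
  proof -
    have hi: "(G has_integral (F b - F a)) {a..b}"
      using FG that by (intro fundamental_theorem_of_calculus)
        (auto simp: has_real_derivative_iff_has_vector_derivative intro: has_vector_derivative_at_within)
    have cG: "(\<lambda>x. \<bar>G x\<bar>) integrable_on {c..d}" for c d
      using FG(2) by (intro integrable_continuous_real continuous_intros)
    have "\<bar>F b - F a\<bar> \<le> integral {a..b} (\<lambda>x. \<bar>G x\<bar>)"
      using hi cG integral_norm_bound_integral[of G "{a..b}" "\<lambda>x. \<bar>G x\<bar>"]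
      by (auto simp: has_integral_iff)
    also have "\<dots> \<le> integral {0..1} (\<lambda>x. \<bar>G x\<bar>)"
      using that cG by (intro integral_subset_le) auto
    also have "\<dots> = (LINT x|circle. \<bar>G x\<bar>)"
      using FG(2) by (intro lebesgue_integral_eq_integral[symmetric] continuous_integrable_circle continuous_intros) auto
    also have "\<dots> \<le> L2_norm G" using C1_periodic_sq_int[OF assms] by (intro L1_le_L2_norm)
    finally show ?thesis .
  qed
  have "\<bar>F (frac x) - F (frac y)\<bar> \<le> L2_norm G"
    using *[of "frac x" "frac y"] *[of "frac y" "frac x"] frac_01[of x] frac_01[of y]
    by (cases "frac x \<le> frac y") (auto simp: abs_minus_commute)
  then show ?thesis using periodic1_frac[OF FG(1)] by simp
qed

lemma H1_derivE:
  assumes "H1_deriv f g"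
  obtains F G where "\<And>n. C1_periodic (F n) (G n)" "uniform_limit UNIV F f sequentially"
    "L2_tendsto G g sequentially"
  using assms unfolding H1_deriv_def by blast

lemma C1_periodic_imp_H1_deriv:
  assumes "C1_periodic F G" shows "H1_deriv F G"
  unfolding H1_deriv_def L2_circle_iff
  using assms C1_periodic_deriv_periodic[OF assms] C1_periodic_sq_int[OF assms]
  by (intro conjI exI[of _ "\<lambda>_. F"] exI[of _ "\<lambda>_. G"])
    (auto intro: uniform_limit_const L2_tendsto_const)

lemma H1_deriv_L2: "H1_deriv f g \<Longrightarrow> L2_circle g" "H1_deriv f g \<Longrightarrow> sq_int g" "H1_deriv f g \<Longrightarrow> periodic1 g"
  by (auto simp: H1_deriv_def L2_circle_iff)

lemma H1_deriv_continuous: "H1_deriv f g \<Longrightarrow> continuous_on A f"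
proof -
  assume "H1_deriv f g"
  then obtain F G where FG: "\<And>n. C1_periodic (F n) (G n)" "uniform_limit UNIV F f sequentially"
    using H1_derivE by blast
  then have "continuous_on UNIV f"
    using C1_periodic_continuous(1)[OF FG(1)] by (intro uniform_limit_theorem[OF _ FG(2)]) auto
  then show ?thesis by (rule continuous_on_subset) auto
qed

lemma H1_deriv_periodic: "H1_deriv f g \<Longrightarrow> periodic1 f"
proof -
  assume "H1_deriv f g"
  then obtain F G where FG: "\<And>n. C1_periodic (F n) (G n)" "uniform_limit UNIV F f sequentially"
    using H1_derivE by blast
  have "f (x + 1) = f x" for x
  proof (rule LIMSEQ_unique)
    show "(\<lambda>n. F n x) \<longlonglongrightarrow> f x" using FG(2) by (rule tendsto_uniform_limitI) auto
    have "(\<lambda>n. F n (x + 1)) \<longlonglongrightarrow> f (x + 1)" using FG(2) by (rule tendsto_uniform_limitI) auto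
    then show "(\<lambda>n. F n x) \<longlonglongrightarrow> f (x + 1)" using FG(1) by (simp add: C1_periodic_def periodic1_def)
  qed
  then show ?thesis by (simp add: periodic1_def)
qed

lemma H1_deriv_sq_int: "H1_deriv f g \<Longrightarrow> sq_int f"
  by (intro sq_int_continuous H1_deriv_continuous)

lemma H1_deriv_oscillation:
  assumes "H1_deriv f g"
  shows "\<bar>f x - f y\<bar> \<le> L2_norm g"
proof -
  obtain F G where FG: "\<And>n. C1_periodic (F n) (G n)" "uniform_limit UNIV F f sequentially"
     "L2_tendsto G g sequentially" using H1_derivE[OF assms] by blast
  have "(\<lambda>n. \<bar>F n x - F n y\<bar>) \<longlonglongrightarrow> \<bar>f x - f y\<bar>"
    by (intro tendsto_intros tendsto_uniform_limitI[OF FG(2)]) auto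
  then show ?thesis
    using C1_periodic_oscillation[OF FG(1)]
    by (intro LIMSEQ_le[OF _ L2_tendsto_imp_tendsto_norm[OF FG(3)]]) auto
qed

lemma periodic_continuous_bounded:
  assumes "periodic1 f" "continuous_on UNIV f"
  shows "bounded (range f)"
proof -
  have "compact (f ` {0..1})"
    by (intro compact_continuous_image continuous_on_subset[OF assms(2)]) auto
  moreover have "range f \<subseteq> f ` {0..1}"
    using periodic1_frac[OF assms(1)] frac_01 by (metis (no_types, lifting) atLeastAtMost_iff image_iff image_subsetI)
  ultimately show ?thesis using bounded_subset compact_imp_bounded by blast
qed

lemma H1_deriv_bounded: "H1_deriv f g \<Longrightarrow> bounded (range f)"
  by (intro periodic_continuous_bounded H1_deriv_periodic H1_deriv_continuous)

lemma H1_deriv_integral_0: "H1_deriv f g \<Longrightarrow> (LINT x|circle. g x) = 0"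
proof -
  assume "H1_deriv f g"
  then obtain F G where FG: "\<And>n. C1_periodic (F n) (G n)" "L2_tendsto G g sequentially"
    using H1_derivE by blast
  from L2_tendsto_integral[OF FG(2)] show ?thesis
    using C1_periodic_integral_deriv[OF FG(1)] by (simp add: LIMSEQ_const_iff)
qed

lemma H1_deriv_cong:
  assumes "H1_deriv f g" "L2_circle g'" "AE x in circle. g x = g' x"
  shows "H1_deriv f g'"
proof -
  obtain F G where FG: "\<And>n. C1_periodic (F n) (G n)" "uniform_limit UNIV F f sequentially"
     "L2_tendsto G g sequentially" using H1_derivE[OF assms(1)] by blast
  have "L2_tendsto G g' sequentially"
    by (rule L2_tendsto_cong[OF FG(3)])
      (use assms C1_periodic_sq_int(2)[OF FG(1)] in \<open>auto simp: L2_circle_iff\<close>)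
  then show ?thesis using FG assms(2) unfolding H1_deriv_def by blast
qed

lemma C1_periodic_add: "C1_periodic f g \<Longrightarrow> C1_periodic f' g' \<Longrightarrow> C1_periodic (\<lambda>x. f x + f' x) (\<lambda>x. g x + g' x)"
  unfolding C1_periodic_def periodic1_def by (auto intro!: continuous_intros derivative_eq_intros)

lemma C1_periodic_mult: "C1_periodic f g \<Longrightarrow> C1_periodic f' g' \<Longrightarrow>
    C1_periodic (\<lambda>x. f x * f' x) (\<lambda>x. f' x * g x + f x * g' x)"
  using C1_periodic_continuous[of f g UNIV] C1_periodic_continuous[of f' g' UNIV]
  unfolding C1_periodic_def periodic1_def by (auto intro!: continuous_intros derivative_eq_intros)

lemma H1_deriv_const: "H1_deriv (\<lambda>x. c) (\<lambda>x. 0)"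
  by (rule C1_periodic_imp_H1_deriv) (auto simp: C1_periodic_def periodic1_def)

lemma H1_deriv_add:
  assumes "H1_deriv f g" "H1_deriv f' g'"
  shows "H1_deriv (\<lambda>x. f x + f' x) (\<lambda>x. g x + g' x)"
proof -
  obtain F G where FG: "\<And>n. C1_periodic (F n) (G n)" "uniform_limit UNIV F f sequentially"
     "L2_tendsto G g sequentially" using H1_derivE[OF assms(1)] by blast
  obtain F' G' where FG': "\<And>n. C1_periodic (F' n) (G' n)" "uniform_limit UNIV F' f' sequentially"
     "L2_tendsto G' g' sequentially" using H1_derivE[OF assms(2)] by blast
  show ?thesis
    unfolding H1_deriv_def
  proof (intro conjI exI allI)
    show "L2_circle (\<lambda>x. g x + g' x)"
      using assms[THEN H1_deriv_L2(2)] assms[THEN H1_deriv_L2(3)] by (auto simp: L2_circle_iff periodic1_def)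
    show "C1_periodic (\<lambda>x. F n x + F' n x) (\<lambda>x. G n x + G' n x)" for n
      by (intro C1_periodic_add FG FG')
    show "uniform_limit UNIV (\<lambda>n x. F n x + F' n x) (\<lambda>x. f x + f' x) sequentially"
      by (intro uniform_limit_add FG FG')
    show "L2_tendsto (\<lambda>n x. G n x + G' n x) (\<lambda>x. g x + g' x) sequentially"
      by (intro L2_tendsto_add FG FG')
  qed
qed

lemma H1_deriv_mult:
  assumes "H1_deriv f g" "H1_deriv f' g'"
  shows "H1_deriv (\<lambda>x. f x * f' x) (\<lambda>x. f' x * g x + f x * g' x)"
proof -
  obtain F G where FG: "\<And>n. C1_periodic (F n) (G n)" "uniform_limit UNIV F f sequentially"
     "L2_tendsto G g sequentially" using H1_derivE[OF assms(1)] by blast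
  obtain F' G' where FG': "\<And>n. C1_periodic (F' n) (G' n)" "uniform_limit UNIV F' f' sequentially"
     "L2_tendsto G' g' sequentially" using H1_derivE[OF assms(2)] by blast
  have p: "periodic1 f" "periodic1 g" "periodic1 f'" "periodic1 g'"
    using assms by (auto intro: H1_deriv_periodic H1_deriv_L2)
  note c = H1_deriv_continuous[OF assms(1)] H1_deriv_continuous[OF assms(2)]
  show ?thesis
    unfolding H1_deriv_def
  proof (intro conjI exI allI)
    show "L2_circle (\<lambda>x. f' x * g x + f x * g' x)"
      using p assms[THEN H1_deriv_L2(2)] c unfolding L2_circle_iff
      by (auto simp: periodic1_def intro!: sq_int_add sq_int_mult_continuous)
    show "C1_periodic (\<lambda>x. F n x * F' n x) (\<lambda>x. F' n x * G n x + F n x * G' n x)" for n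
      by (intro C1_periodic_mult FG FG')
    show "uniform_limit UNIV (\<lambda>n x. F n x * F' n x) (\<lambda>x. f x * f' x) sequentially"
      by (intro uniform_lim_mult FG FG' H1_deriv_bounded[OF assms(1)] H1_deriv_bounded[OF assms(2)])
    show "L2_tendsto (\<lambda>n x. F' n x * G n x + F n x * G' n x) (\<lambda>x. f' x * g x + f x * g' x) sequentially"
      using C1_periodic_continuous[OF FG(1)] C1_periodic_continuous[OF FG'(1)]
      by (intro L2_tendsto_add L2_tendsto_mult FG FG' c always_eventually allI
          uniform_limit_on_subset[OF FG(2)] uniform_limit_on_subset[OF FG'(2)]) auto
  qed
qed

lemma H1_deriv_cmult: "H1_deriv f g \<Longrightarrow> H1_deriv (\<lambda>x. c * f x) (\<lambda>x. c * g x)"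
  using H1_deriv_mult[OF H1_deriv_const[of c], of f g] by simp

lemma H1_deriv_diff:
  "H1_deriv f g \<Longrightarrow> H1_deriv f' g' \<Longrightarrow> H1_deriv (\<lambda>x. f x - f' x) (\<lambda>x. g x - g' x)"
  using H1_deriv_add[OF _ H1_deriv_cmult[of f' g' "-1"]] by simp

lemma H1_deriv_inverse:
  assumes "H1_deriv f g" and pos: "\<And>x. f x > 0"
  shows "H1_deriv (\<lambda>x. inverse (f x)) (\<lambda>x. - (inverse (f x) * inverse (f x)) * g x)"
proof -
  obtain F G where FG: "\<And>n. C1_periodic (F n) (G n)" "uniform_limit UNIV F f sequentially"
     "L2_tendsto G g sequentially" using H1_derivE[OF assms(1)] by blast
  note c = H1_deriv_continuous[OF assms(1)]
  have per: "periodic1 f" "periodic1 g" using assms by (auto intro: H1_deriv_periodic H1_deriv_L2)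
  obtain x0 where x0: "x0 \<in> {0..1}" "\<And>x. x \<in> {0..1} \<Longrightarrow> f x0 \<le> f x"
    using continuous_attains_inf[of "{0..1::real}" f] c by auto
  define d where "d = f x0"
  have d: "d > 0" using pos by (simp add: d_def)
  have fd: "d \<le> f x" for x
    using periodic1_bound[OF per(1), of "\<lambda>y. d \<le> y"] x0 by (auto simp: d_def)
  have "\<forall>\<^sub>F n in sequentially. \<forall>x\<in>UNIV. dist (F n x) (f x) < d / 2"
    using FG(2) d unfolding uniform_limit_iff by (meson half_gt_zero)
  then obtain N where N: "\<And>n x. n \<ge> N \<Longrightarrow> \<bar>F n x - f x\<bar> < d / 2"
    by (auto simp: eventually_sequentially dist_real_def)
  have Fpos: "F (n + N) x > 0" for n x
  proof -
    have "\<bar>F (n + N) x - f x\<bar> < d / 2" by (rule N) simp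
    then show ?thesis using fd[of x] d by linarith
  qed
  have ul: "uniform_limit UNIV (\<lambda>n. F (n + N)) f sequentially"
    using FG(2) by (rule filterlim_compose) (rule filterlim_add_const_nat_at_top)
  have lt: "L2_tendsto (\<lambda>n. G (n + N)) g sequentially"
    using FG(3) C1_periodic_sq_int(2)[OF FG(1)]
      LIMSEQ_ignore_initial_segment[of "\<lambda>n. L2_norm (\<lambda>x. G n x - g x)" 0 N]
    unfolding L2_tendsto_def by auto
  have ui: "uniform_limit UNIV (\<lambda>n x. inverse (F (n + N) x)) (\<lambda>x. inverse (f x)) sequentially"
    using uniform_lim_inverse[OF ul, of d] fd d
    by (simp add: comp_def order_trans[OF _ abs_ge_self])
  have ci: "continuous_on A (\<lambda>x. inverse (f x))" for A
    using pos by (intro continuous_intros c) (simp add: less_imp_neq[symmetric])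
  have bi: "bounded (range (\<lambda>x. inverse (f x)))"
    by (intro periodic_continuous_bounded ci) (use per in \<open>auto simp: periodic1_def\<close>)
  have cF: "continuous_on A (\<lambda>x. inverse (F (n + N) x))" for A n
    using Fpos C1_periodic_continuous[OF FG(1)]
    by (intro continuous_intros) (simp_all add: less_imp_neq[symmetric])
  have cG: "continuous_on A (G (n + N))" for n A using C1_periodic_continuous(2)[OF FG(1)] .
  show ?thesis
    unfolding H1_deriv_def
  proof (intro conjI exI allI)
    show "L2_circle (\<lambda>x. - (inverse (f x) * inverse (f x)) * g x)"
      using per H1_deriv_L2(2)[OF assms(1)] unfolding L2_circle_iff
      by (intro conjI sq_int_mult_continuous continuous_intros ci) (auto simp: periodic1_def)
    show "C1_periodic (\<lambda>x. inverse (F (n + N) x))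
      (\<lambda>x. - (inverse (F (n + N) x) * inverse (F (n + N) x)) * G (n + N) x)" for n
      unfolding C1_periodic_def
    proof (intro conjI allI)
      show "continuous_on UNIV (\<lambda>x. - (inverse (F (n + N) x) * inverse (F (n + N) x)) * G (n + N) x)"
        by (intro continuous_intros cF cG)
      show "((\<lambda>x. inverse (F (n + N) x)) has_real_derivative
          - (inverse (F (n + N) x) * inverse (F (n + N) x)) * G (n + N) x) (at x)" for x
        using FG(1)[of "n + N"] Fpos[of n x] unfolding C1_periodic_def
        by (auto intro!: derivative_eq_intros simp: mult_ac)
    qed (use FG(1) in \<open>auto simp: C1_periodic_def periodic1_def\<close>)
    have "uniform_limit UNIV (\<lambda>n x. - (inverse (F (n + N) x) * inverse (F (n + N) x)))
       (\<lambda>x. - (inverse (f x) * inverse (f x))) sequentially"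
      by (intro uniform_limit_uminus uniform_lim_mult ui bi)
    then have "uniform_limit {0..1} (\<lambda>n x. - (inverse (F (n + N) x) * inverse (F (n + N) x)))
       (\<lambda>x. - (inverse (f x) * inverse (f x))) sequentially"
      by (rule uniform_limit_on_subset) auto
    then show "L2_tendsto (\<lambda>n x. - (inverse (F (n + N) x) * inverse (F (n + N) x)) * G (n + N) x)
       (\<lambda>x. - (inverse (f x) * inverse (f x)) * g x) sequentially"
      by (rule L2_tendsto_mult[OF _ _ _ lt]) (intro always_eventually allI continuous_intros ci cF)+
  qed (rule ui)
qed

text \<open>Continuous approximants of \<open>g\<close>, corrected to have mean zero, have periodic primitives; by the
  oscillation bound these converge uniformly.\<close>

lemma H1_deriv_primitive:
  assumes g: "L2_circle g" and m: "(LINT x|circle. g x) = 0"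
  obtains f where "H1_deriv f g" "f 0 = 0"
proof -
  have sg: "sq_int g" using g by (simp add: L2_circle_iff)
  obtain G0 where G0: "\<And>n. continuous_on UNIV (G0 n)" "\<And>n. periodic1 (G0 n)" "L2_tendsto G0 g sequentially"
    using L2_approx_continuous[OF sg] by blast
  define G where "G n x = G0 n x - (LINT x|circle. G0 n x)" for n x
  have G: "continuous_on A (G n)" "periodic1 (G n)" for n A
    using G0(1,2) unfolding G_def by (auto intro!: continuous_intros continuous_on_subset[OF G0(1)] simp: periodic1_def)
  have sG0: "sq_int (G0 n)" for n using G0(1) by (intro sq_int_continuous) (auto intro: continuous_on_subset)
  have sG: "sq_int (G n)" for n using G(1) by (intro sq_int_continuous)
  have Gm: "(LINT x|circle. G n x) = 0" for n
    unfolding G_def using sG0 by (simp add: sq_int_integrable)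
  have "L2_tendsto (\<lambda>n x. (LINT x|circle. G0 n x)) (\<lambda>x. 0) sequentially"
    using L2_tendsto_integral[OF G0(3)] m unfolding L2_tendsto_def
    by (auto simp: L2_norm_const intro: tendsto_rabs_zero)
  then have GL: "L2_tendsto G g sequentially"
    using L2_tendsto_diff[OF G0(3)] unfolding G_def by fastforce
  have "\<exists>F. \<forall>x. (F has_real_derivative G n x) (at x) \<and> F 0 = 0" for n
    using continuous_antiderivative[OF G(1)] by metis
  then obtain F where F: "\<And>n x. (F n has_real_derivative G n x) (at x)" "\<And>n. F n 0 = 0" by metis
  have C: "C1_periodic (F n) (G n)" for n
    unfolding C1_periodic_def using periodic_antiderivative[OF F(1) G(2,1) Gm] F G by auto
  have "uniformly_Cauchy_on UNIV F"
    unfolding uniformly_Cauchy_on_def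
  proof (intro allI impI)
    fix e :: real assume "e > 0"
    then have "\<forall>\<^sub>F n in sequentially. L2_norm (\<lambda>x. G n x - g x) < e / 2"
      using L2_tendstoD[OF GL, of "e / 2"] by (auto elim: eventually_mono)
    then obtain N where N: "\<And>n. n \<ge> N \<Longrightarrow> L2_norm (\<lambda>x. G n x - g x) < e / 2"
      by (auto simp: eventually_sequentially)
    have "dist (F i x) (F j x) < e" if "i \<ge> N" "j \<ge> N" for i j x
    proof -
      have "C1_periodic (\<lambda>x. F i x - F j x) (\<lambda>x. G i x - G j x)"
        using C[of i] C[of j] unfolding C1_periodic_def periodic1_def
        by (auto intro!: continuous_intros derivative_eq_intros)
      from C1_periodic_oscillation[OF this, of x 0] have "\<bar>F i x - F j x\<bar> \<le> L2_norm (\<lambda>x. G i x - G j x)"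
        by (simp add: F)
      also have "\<dots> \<le> L2_norm (\<lambda>x. G i x - g x) + L2_norm (\<lambda>x. g x - G j x)"
        by (rule L2_norm_triangle3[OF sG sg sG])
      also have "\<dots> < e" using N[OF that(1)] N[OF that(2)] L2_norm_minus_commute[of g "G j"] by linarith
      finally show ?thesis by (simp add: dist_real_def)
    qed
    then show "\<exists>M. \<forall>x\<in>UNIV. \<forall>m\<ge>M. \<forall>n\<ge>M. dist (F m x) (F n x) < e" by blast
  qed
  then obtain f where f: "uniform_limit UNIV F f sequentially"
    unfolding uniformly_convergent_eq_Cauchy[symmetric] uniformly_convergent_on_def by blast
  have "H1_deriv f g"
    unfolding H1_deriv_def using g C f GL by blast
  moreover have "f 0 = 0"
    using tendsto_uniform_limitI[OF f, of 0] F(2) by (simp add: LIMSEQ_const_iff)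
  ultimately show ?thesis using that by blast
qed

lemma H1_deriv_zero:
  assumes "H1_deriv f g" "AE x in circle. g x = 0"
  shows "f x = f y"
proof -
  have "L2_norm g = L2_norm (\<lambda>x. 0)"
    using assms(2) H1_deriv_L2(2)[OF assms(1)] by (intro L2_norm_cong_AE) auto
  then show ?thesis using H1_deriv_oscillation[OF assms(1), of x y] by (simp add: L2_norm_const)
qed

text \<open>Integration over \<open>[0,x]\<close> is pairing with an indicator function, hence continuous in the mean.\<close>

lemma H1_deriv_integral:
  assumes "H1_deriv f g" "0 \<le> x" "x \<le> 1"
  shows "(LINT y|lebesgue_on {0..x}. g y) = f x - f 0"
proof -
  obtain F G where FG: "\<And>n. C1_periodic (F n) (G n)" "uniform_limit UNIV F f sequentially"
     "L2_tendsto G g sequentially" using H1_derivE[OF assms(1)] by blast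
  have im[measurable]: "indicat_real {0..x} \<in> borel_measurable circle"
    by (intro borel_measurable_indicator) (use assms in \<open>auto simp: sets_restrict_space_iff\<close>)
  have ind: "sq_int (indicat_real {0..x})"
    unfolding sq_int_def using im
    by (auto intro!: integrable_circle_bound[OF integrable_circle_const[of 1]] simp: indicator_def[abs_def])
  have restr: "(LINT y|lebesgue_on {0..x}. h y) = (LINT y|circle. indicat_real {0..x} y * h y)" for h :: "real \<Rightarrow> real"
  proof -
    have "(LINT y|lebesgue_on {0..x}. h y) = (LINT y|lebesgue. indicat_real {0..x} y * h y)"
      by (simp add: integral_restrict_space)
    also have "\<dots> = (LINT y|lebesgue. indicat_real {0..1} y * (indicat_real {0..x} y * h y))"
      using assms by (intro Bochner_Integration.integral_cong) (auto simp: indicator_def)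
    also have "\<dots> = (LINT y|circle. indicat_real {0..x} y * h y)"
      by (simp add: integral_restrict_space)
    finally show ?thesis .
  qed
  have "(\<lambda>n. LINT y|circle. indicat_real {0..x} y * G n y) \<longlonglongrightarrow> (LINT y|circle. indicat_real {0..x} y * g y)"
    by (intro L2_tendsto_integral_mult L2_tendsto_const FG ind)
  moreover have "(LINT y|circle. indicat_real {0..x} y * G n y) = F n x - F n 0" for n
    unfolding restr[symmetric]
    using assms FG(1)[of n] C1_periodic_continuous[OF FG(1)]
    by (intro FTC_integral) (auto simp: C1_periodic_def has_field_derivative_at_within)
  moreover have "(\<lambda>n. F n x - F n 0) \<longlonglongrightarrow> f x - f 0"
    by (intro tendsto_intros tendsto_uniform_limitI[OF FG(2)]) auto
  ultimately have "(LINT y|circle. indicat_real {0..x} y * g y) = f x - f 0"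
    by (simp add: LIMSEQ_unique)
  then show ?thesis by (simp add: restr[of g])
qed

lemma integral_lebesgue_on_singleton: "(LINT y|lebesgue_on {a..a::real}. g y :: real) = 0"
proof (rule integral_eq_zero_AE)
  have "AE y in lebesgue. y \<notin> {a}"
    by (intro AE_not_in) (simp add: negligible_iff_null_sets[symmetric])
  then have "AE y in lebesgue. y \<in> {a..a} \<longrightarrow> g y = 0" by eventually_elim auto
  then show "AE y in lebesgue_on {a..a}. g y = 0"
    by (subst AE_restrict_space_iff) auto
qed

lemma H1_derivI_integral:
  assumes f: "periodic1 f" and g: "L2_circle g"
    and i: "\<And>x. 0 \<le> x \<Longrightarrow> x \<le> 1 \<Longrightarrow> f x = c + (LINT y|lebesgue_on {0..x}. g y)"
  shows "H1_deriv f g"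
proof -
  have "f 1 = f 0" using f by (metis periodic1_def add_0)
  moreover have "f 0 = c" using i[of 0] integral_lebesgue_on_singleton[of 0 g] by simp
  ultimately have "(LINT x|circle. g x) = 0" using i[of 1] by simp
  then obtain h where h: "H1_deriv h g" "h 0 = 0" using H1_deriv_primitive[OF g] by blast
  have "f x = c + h x" for x
  proof -
    have "f (frac x) = c + h (frac x)"
      using i[OF frac_01] H1_deriv_integral[OF h(1) frac_01] h(2) by simp
    then show ?thesis using periodic1_frac[OF f] periodic1_frac[OF H1_deriv_periodic[OF h(1)]] by simp
  qed
  then have "f = (\<lambda>x. c + h x)" by auto
  then show ?thesis using H1_deriv_add[OF H1_deriv_const[of c] h(1)] by simp
qed

lemma H1_deriv_classical:
  assumes "H1_deriv f g" "continuous_on UNIV g"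
  shows "(f has_real_derivative g x) (at x)"
proof -
  obtain F where F: "\<And>x. (F has_real_derivative g x) (at x)"
    using continuous_antiderivative[OF assms(2)] by metis
  have "periodic1 F"
    by (rule periodic_antiderivative[OF F]) (use assms H1_deriv_L2 H1_deriv_integral_0 in auto)
  then have "H1_deriv F g"
    by (intro C1_periodic_imp_H1_deriv) (use F assms(2) in \<open>auto simp: C1_periodic_def\<close>)
  then have "H1_deriv (\<lambda>x. f x - F x) (\<lambda>x. g x - g x)" using H1_deriv_diff assms(1) by blast
  then have "f y - F y = f 0 - F 0" for y by (rule H1_deriv_zero) auto
  then have "f = (\<lambda>y. F y + (f 0 - F 0))" by (auto simp: algebra_simps)
  moreover have "((\<lambda>y. F y + (f 0 - F 0)) has_real_derivative g x) (at x)"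
    using F by (auto intro!: derivative_eq_intros)
  ultimately show ?thesis by simp
qed

lemma H1_integration_by_parts:
  assumes "H1_deriv f g" "H1_deriv f' g'"
  shows "(LINT x|circle. f x * g' x) = - (LINT x|circle. g x * f' x)"
proof -
  have "(LINT x|circle. f' x * g x + f x * g' x) = 0"
    by (rule H1_deriv_integral_0[OF H1_deriv_mult[OF assms]])
  then show ?thesis
    using assms[THEN H1_deriv_sq_int] assms[THEN H1_deriv_L2(2)]
    by (simp add: sq_int_mult_integrable mult.commute)
qed

section \<open>Comparison with weak derivatives\<close>

lemma test_function_C1: "test_function \<phi> \<Longrightarrow> C1_periodic \<phi> (deriv \<phi>)"
proof -
  assume t: "test_function \<phi>"
  then have "(deriv ^^ 0) \<phi> differentiable_on UNIV" "(deriv ^^ 1) \<phi> differentiable_on UNIV"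
    unfolding test_function_def by blast+
  then have d: "\<phi> differentiable_on UNIV" "deriv \<phi> differentiable_on UNIV" by auto
  have "continuous_on UNIV (deriv \<phi>)" by (rule differentiable_imp_continuous_on[OF d(2)])
  moreover have "(\<phi> has_real_derivative deriv \<phi> x) (at x)" for x
    using d(1) by (simp add: differentiable_on_def DERIV_deriv_iff_real_differentiable)
  ultimately show ?thesis
    using t unfolding C1_periodic_def test_function_def by auto
qed

lemma H1_deriv_is_weak_deriv: "H1_deriv f g \<Longrightarrow> is_weak_deriv f g"
  unfolding is_weak_deriv_def
  using H1_integration_by_parts C1_periodic_imp_H1_deriv test_function_C1 by blast

lemma is_weak_deriv_cong_AE:
  assumes "AE x in circle. f x = f' x" "f \<in> borel_measurable circle" "f' \<in> borel_measurable circle"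
  shows "is_weak_deriv f g \<longleftrightarrow> is_weak_deriv f' g"
proof -
  have "(LINT x|circle. f x * deriv \<phi> x) = (LINT x|circle. f' x * deriv \<phi> x)" if "test_function \<phi>" for \<phi>
  proof -
    have [measurable]: "deriv \<phi> \<in> borel_measurable circle"
      using C1_periodic_sq_int[OF test_function_C1[OF that]] sq_int_measurable by blast
    show ?thesis using assms by (intro integral_cong_AE) auto
  qed
  then show ?thesis unfolding is_weak_deriv_def by simp
qed

lemma wderiv_H1:
  assumes "H1_deriv f g"
  shows "L2_circle (wderiv f)" "AE x in circle. wderiv f x = g x"
proof -
  have "L2_circle (wderiv f) \<and> is_weak_deriv f (wderiv f)"
    unfolding wderiv_def
    by (rule someI[of _ g]) (use assms H1_deriv_L2 H1_deriv_is_weak_deriv in blast)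
  then show "L2_circle (wderiv f)" "AE x in circle. wderiv f x = g x"
    using weak_deriv_unique[OF _ H1_deriv_is_weak_deriv[OF assms]] H1_deriv_L2[OF assms]
    by (auto simp: L2_circle_iff)
qed

lemma H1_deriv_unique:
  "H1_deriv f g \<Longrightarrow> H1_deriv f g' \<Longrightarrow> AE x in circle. g x = g' x"
  using weak_deriv_unique H1_deriv_is_weak_deriv H1_deriv_L2 by blast

text \<open>Since the constant \<open>1\<close> is a test function, \<open>g\<close> has mean zero and a periodic primitive. The difference
  of \<open>f\<close> and this primitive has weak derivative zero.\<close>

lemma weak_deriv_imp_H1:
  assumes f: "L2_circle f" and g: "L2_circle g" and w: "is_weak_deriv f g"
  obtains k where "H1_deriv k g" "AE x in circle. f x = k x"
proof -
  have sf: "sq_int f" using f by (auto simp: L2_circle_iff)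
  have "test_function (\<lambda>x. 1)" by (intro trig_poly_test_function trig_poly.const)
  then have "(LINT x|circle. g x) = 0" using w unfolding is_weak_deriv_def by fastforce
  then obtain h where h: "H1_deriv h g" using H1_deriv_primitive[OF g] by blast
  have sh: "sq_int h" using H1_deriv_sq_int[OF h] .
  have "AE x in circle. f x - h x = (LINT x|circle. f x - h x)"
  proof (rule du_Bois_Reymond)
    show "is_weak_deriv (\<lambda>x. f x - h x) (\<lambda>x. 0)"
      unfolding is_weak_deriv_def
    proof (intro allI impI)
      fix \<phi> assume t: "test_function \<phi>"
      have sp: "sq_int \<phi>" "sq_int (deriv \<phi>)"
        using C1_periodic_sq_int[OF test_function_C1[OF t]] by auto
      have "(LINT x|circle. f x * deriv \<phi> x) = (LINT x|circle. h x * deriv \<phi> x)"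
        using w H1_deriv_is_weak_deriv[OF h] t by (simp add: is_weak_deriv_def)
      then show "(LINT x|circle. (f x - h x) * deriv \<phi> x) = - (LINT x|circle. 0 * \<phi> x)"
        using sf sh sp by (simp add: left_diff_distrib sq_int_mult_integrable)
    qed
  qed (use sf sh in auto)
  then have "AE x in circle. f x = h x + (LINT x|circle. f x - h x)" by eventually_elim auto
  then show ?thesis
    using that H1_deriv_add[OF h H1_deriv_const[of "LINT x|circle. f x - h x"]] by simp
qed

lemma continuous_AE_eq_imp_eq:
  assumes "AE x in circle. f x = g x" "continuous_on {0..1} f" "continuous_on {0..1} g" "0 \<le> x" "x \<le> 1"
  shows "f x = (g x :: real)"
proof -
  have c: "continuous_on {0..1} (\<lambda>y. (f y - g y)\<^sup>2)" by (intro continuous_intros assms)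
  have "(LINT y|circle. (f y - g y)\<^sup>2) = (LINT y|circle. 0)"
    using assms(2,3)[THEN continuous_measurable_circle] continuous_measurable_circle[OF c]
    by (intro integral_cong_AE) (use assms(1) in auto)
  then have "integral {0..1} (\<lambda>y. (f y - g y)\<^sup>2) = 0"
    using lebesgue_integral_eq_integral[OF continuous_integrable_circle[OF c]] by simp
  then have "(f x - g x)\<^sup>2 = 0"
    using integral_eq_0_iff[of 0 1 "\<lambda>y. (f y - g y)\<^sup>2"] c assms by auto
  then show ?thesis by simp
qed

lemma periodic_AE_eq_imp_eq:
  assumes "AE x in circle. f x = g x" "continuous_on {0..1} f" "continuous_on {0..1} g"
    "periodic1 f" "periodic1 g"
  shows "f = (g :: real \<Rightarrow> real)"
proof
  fix x show "f x = g x"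
    using continuous_AE_eq_imp_eq[OF assms(1-3) frac_01] periodic1_frac[OF assms(4)]
      periodic1_frac[OF assms(5)] by metis
qed

lemma sobolev_1_iff: "sobolev 1 f \<longleftrightarrow> (\<exists>g. H1_deriv f g)"
proof
  assume "sobolev 1 f"
  then obtain g where g: "L2_circle f" "is_weak_deriv f g" "L2_circle g" "continuous_on UNIV f"
    by (auto simp: sobolev_def)
  then obtain k where k: "H1_deriv k g" "AE x in circle. f x = k x"
    using weak_deriv_imp_H1 by blast
  then have "f = k"
    using g H1_deriv_continuous[OF k(1)] H1_deriv_periodic[OF k(1)]
    by (intro periodic_AE_eq_imp_eq) (auto simp: L2_circle_iff intro: continuous_on_subset)
  then show "\<exists>g. H1_deriv f g" using k by blast
next
  assume "\<exists>g. H1_deriv f g"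
  then obtain g where g: "H1_deriv f g" by blast
  then have "L2_circle f" using H1_deriv_sq_int H1_deriv_periodic by (auto simp: L2_circle_iff)
  then show "sobolev 1 f"
    using H1_deriv_is_weak_deriv[OF g] H1_deriv_L2(1)[OF g] H1_deriv_continuous[OF g]
    by (auto simp: sobolev_def)
qed

text \<open>The weak derivative of a function in \<open>H\<^sup>2\<close> is replaced by its continuous representative.\<close>

lemma sobolev_2_iff: "sobolev 2 f \<longleftrightarrow> (\<exists>g h. H1_deriv f g \<and> H1_deriv g h)"
proof
  assume "sobolev 2 f"
  then obtain g h where gh: "L2_circle f" "is_weak_deriv f g" "L2_circle g" "is_weak_deriv g h"
      "L2_circle h" "continuous_on UNIV f"
    by (auto simp: sobolev_def numeral_2_eq_2)
  then obtain k where k: "H1_deriv k h" "AE x in circle. g x = k x"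
    using weak_deriv_imp_H1 by blast
  have "H1_deriv f g"
  proof -
    have "sobolev 1 f" using gh by (auto simp: sobolev_def)
    then obtain g' where g': "H1_deriv f g'" using sobolev_1_iff by blast
    show ?thesis
      using H1_deriv_cong[OF g' gh(3)] weak_deriv_unique[OF H1_deriv_is_weak_deriv[OF g'] gh(2)]
        gh(3) H1_deriv_L2[OF g'] by (auto simp: L2_circle_iff)
  qed
  then have "H1_deriv f k"
    using k H1_deriv_periodic[OF k(1)] H1_deriv_sq_int[OF k(1)]
    by (intro H1_deriv_cong[of f g k]) (auto simp: L2_circle_iff)
  then show "\<exists>g h. H1_deriv f g \<and> H1_deriv g h" using k by blast
next
  assume "\<exists>g h. H1_deriv f g \<and> H1_deriv g h"
  then obtain g h where g: "H1_deriv f g" and h: "H1_deriv g h" by blast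
  have "L2_circle f" using g H1_deriv_sq_int H1_deriv_periodic by (auto simp: L2_circle_iff)
  then show "sobolev 2 f"
    using H1_deriv_is_weak_deriv[OF g] H1_deriv_is_weak_deriv[OF h] H1_deriv_L2(1)[OF g]
      H1_deriv_L2(1)[OF h] H1_deriv_continuous[OF g]
    by (auto simp: sobolev_def numeral_2_eq_2)
qed

lemma sobolev_norm_0: "sobolev_norm 0 f = L2_norm f"
  by (simp add: sobolev_norm_def)

lemma L2_norm_wderiv: "H1_deriv f g \<Longrightarrow> L2_norm (wderiv f) = L2_norm g"
  using wderiv_H1[of f g] H1_deriv_L2[of f g] by (intro L2_norm_cong_AE) (auto simp: L2_circle_iff)

lemma sobolev_norm_1:
  assumes "H1_deriv f g"
  shows "sobolev_norm 1 f = sqrt ((L2_norm f)\<^sup>2 + (L2_norm g)\<^sup>2)"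
  using L2_norm_wderiv[OF assms] by (simp add: sobolev_norm_def)

text \<open>Being a weak derivative of a function only depends on the class of that function, so the choice made in
  \<open>wderiv (wderiv f)\<close> is the one made in \<open>wderiv g\<close>.\<close>

lemma sobolev_norm_2:
  assumes "H1_deriv f g" "H1_deriv g h"
  shows "sobolev_norm 2 f = sqrt ((L2_norm f)\<^sup>2 + (L2_norm g)\<^sup>2 + (L2_norm h)\<^sup>2)"
proof -
  have "wderiv (wderiv f) = wderiv g"
    unfolding wderiv_def[of "wderiv f"] wderiv_def[of g]
    using is_weak_deriv_cong_AE[OF wderiv_H1(2)[OF assms(1)]] wderiv_H1(1)[OF assms(1)] H1_deriv_sq_int[OF assms(2)]
    by (simp add: L2_circle_iff sq_int_measurable)
  then show ?thesis
    using L2_norm_wderiv[OF assms(1)] L2_norm_wderiv[OF assms(2)]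
    by (simp add: sobolev_norm_def numeral_2_eq_2)
qed


section \<open>Curves in Sobolev spaces\<close>

lemma L2_tendsto_mono: "L2_tendsto f g F \<Longrightarrow> F' \<le> F \<Longrightarrow> L2_tendsto f g F'"
  unfolding L2_tendsto_def by (auto intro: tendsto_mono filter_leD)

lemma tendsto_0_sqrt_sum_squares_iff:
  fixes a b c :: "'a \<Rightarrow> real"
  assumes "\<And>s. 0 \<le> a s" "\<And>s. 0 \<le> b s" "\<And>s. 0 \<le> c s"
  shows "((\<lambda>s. sqrt ((a s)\<^sup>2 + (b s)\<^sup>2 + (c s)\<^sup>2)) \<longlongrightarrow> 0) F \<longleftrightarrow>
    (a \<longlongrightarrow> 0) F \<and> (b \<longlongrightarrow> 0) F \<and> (c \<longlongrightarrow> 0) F"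
proof
  assume *: "((\<lambda>s. sqrt ((a s)\<^sup>2 + (b s)\<^sup>2 + (c s)\<^sup>2)) \<longlongrightarrow> 0) F"
  have "a s \<le> sqrt ((a s)\<^sup>2 + (b s)\<^sup>2 + (c s)\<^sup>2)" "b s \<le> sqrt ((a s)\<^sup>2 + (b s)\<^sup>2 + (c s)\<^sup>2)"
    "c s \<le> sqrt ((a s)\<^sup>2 + (b s)\<^sup>2 + (c s)\<^sup>2)" for s
    by (auto intro!: real_le_rsqrt)
  then show "(a \<longlongrightarrow> 0) F \<and> (b \<longlongrightarrow> 0) F \<and> (c \<longlongrightarrow> 0) F"
    using assms by (intro conjI tendsto_sandwich[OF _ _ tendsto_const *]) auto
next
  assume "(a \<longlongrightarrow> 0) F \<and> (b \<longlongrightarrow> 0) F \<and> (c \<longlongrightarrow> 0) F"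
  then have "((\<lambda>s. sqrt ((a s)\<^sup>2 + (b s)\<^sup>2 + (c s)\<^sup>2)) \<longlongrightarrow> sqrt (0\<^sup>2 + 0\<^sup>2 + 0\<^sup>2)) F"
    by (intro tendsto_intros) auto
  then show "((\<lambda>s. sqrt ((a s)\<^sup>2 + (b s)\<^sup>2 + (c s)\<^sup>2)) \<longlongrightarrow> 0) F" by simp
qed

lemma eventually_at_within_mem: "(\<And>s. s \<in> I \<Longrightarrow> P s) \<Longrightarrow> \<forall>\<^sub>F s in at t within I. P s"
  by (simp add: eventually_at_filter)

lemma tendsto_cong_mem:
  assumes "\<And>s. s \<in> I \<Longrightarrow> f s = g s"
  shows "(f \<longlongrightarrow> l) (at t within I) \<longleftrightarrow> (g \<longlongrightarrow> l) (at t within I)"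
  by (rule filterlim_cong) (auto intro: eventually_at_within_mem assms)

lemma L2_tendsto_within_iff:
  assumes "\<And>s. s \<in> I \<Longrightarrow> sq_int (f s)" "sq_int g"
  shows "L2_tendsto f g (at t within I) \<longleftrightarrow> ((\<lambda>s. L2_norm (\<lambda>x. f s x - g x)) \<longlongrightarrow> 0) (at t within I)"
  using assms by (auto simp: L2_tendsto_def intro: eventually_at_within_mem)

lemma sobolev_continuous_on_2_iff:
  assumes H: "\<And>t. t \<in> I \<Longrightarrow> H1_deriv (u t) (ux t)" "\<And>t. t \<in> I \<Longrightarrow> H1_deriv (ux t) (uxx t)"
  shows "sobolev_continuous_on 2 I u \<longleftrightarrow>
    (\<forall>t\<in>I. L2_tendsto u (u t) (at t within I) \<and> L2_tendsto ux (ux t) (at t within I)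
       \<and> L2_tendsto uxx (uxx t) (at t within I))"
proof -
  have sq: "sq_int (u s)" "sq_int (ux s)" "sq_int (uxx s)" if "s \<in> I" for s
    using H[OF that] by (auto intro: H1_deriv_sq_int H1_deriv_L2)
  have "sobolev 2 (u t)" if "t \<in> I" for t using H[OF that] sobolev_2_iff by blast
  moreover have "((\<lambda>s. sobolev_norm 2 (\<lambda>x. u s x - u t x)) \<longlongrightarrow> 0) (at t within I) \<longleftrightarrow>
    L2_tendsto u (u t) (at t within I) \<and> L2_tendsto ux (ux t) (at t within I)
       \<and> L2_tendsto uxx (uxx t) (at t within I)" if "t \<in> I" for t
  proof -
    have "sobolev_norm 2 (\<lambda>x. u s x - u t x) = sqrt ((L2_norm (\<lambda>x. u s x - u t x))\<^sup>2
       + (L2_norm (\<lambda>x. ux s x - ux t x))\<^sup>2 + (L2_norm (\<lambda>x. uxx s x - uxx t x))\<^sup>2)" if "s \<in> I" for s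
      by (intro sobolev_norm_2 H1_deriv_diff H that \<open>t \<in> I\<close>)
    then have "((\<lambda>s. sobolev_norm 2 (\<lambda>x. u s x - u t x)) \<longlongrightarrow> 0) (at t within I) \<longleftrightarrow>
      ((\<lambda>s. sqrt ((L2_norm (\<lambda>x. u s x - u t x))\<^sup>2
       + (L2_norm (\<lambda>x. ux s x - ux t x))\<^sup>2 + (L2_norm (\<lambda>x. uxx s x - uxx t x))\<^sup>2)) \<longlongrightarrow> 0) (at t within I)" by (intro tendsto_cong_mem)
    then show ?thesis
      by (simp add: L2_tendsto_within_iff sq that tendsto_0_sqrt_sum_squares_iff)
  qed
  ultimately show ?thesis by (auto simp: sobolev_continuous_on_def)
qed

lemma tendsto_0_sqrt_sum_squares_iff2:
  fixes a b :: "'a \<Rightarrow> real"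
  assumes "\<And>s. 0 \<le> a s" "\<And>s. 0 \<le> b s"
  shows "((\<lambda>s. sqrt ((a s)\<^sup>2 + (b s)\<^sup>2)) \<longlongrightarrow> 0) F \<longleftrightarrow> (a \<longlongrightarrow> 0) F \<and> (b \<longlongrightarrow> 0) F"
  using tendsto_0_sqrt_sum_squares_iff[of a b "\<lambda>_. 0" F] assms by simp

lemma sobolev_continuous_on_1_iff:
  assumes H: "\<And>t. t \<in> I \<Longrightarrow> H1_deriv (u t) (ux t)"
  shows "sobolev_continuous_on 1 I u \<longleftrightarrow>
    (\<forall>t\<in>I. L2_tendsto u (u t) (at t within I) \<and> L2_tendsto ux (ux t) (at t within I))"
proof -
  have sq: "sq_int (u s)" "sq_int (ux s)" if "s \<in> I" for s
    using H[OF that] by (auto intro: H1_deriv_sq_int H1_deriv_L2)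
  have "sobolev 1 (u t)" if "t \<in> I" for t using H[OF that] sobolev_1_iff by blast
  moreover have "((\<lambda>s. sobolev_norm 1 (\<lambda>x. u s x - u t x)) \<longlongrightarrow> 0) (at t within I) \<longleftrightarrow>
    L2_tendsto u (u t) (at t within I) \<and> L2_tendsto ux (ux t) (at t within I)" if "t \<in> I" for t
  proof -
    have "sobolev_norm 1 (\<lambda>x. u s x - u t x) = sqrt ((L2_norm (\<lambda>x. u s x - u t x))\<^sup>2
       + (L2_norm (\<lambda>x. ux s x - ux t x))\<^sup>2)" if "s \<in> I" for s
      by (intro sobolev_norm_1 H1_deriv_diff H that \<open>t \<in> I\<close>)
    then have "((\<lambda>s. sobolev_norm 1 (\<lambda>x. u s x - u t x)) \<longlongrightarrow> 0) (at t within I) \<longleftrightarrow>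
      ((\<lambda>s. sqrt ((L2_norm (\<lambda>x. u s x - u t x))\<^sup>2
       + (L2_norm (\<lambda>x. ux s x - ux t x))\<^sup>2)) \<longlongrightarrow> 0) (at t within I)" by (intro tendsto_cong_mem)
    then show ?thesis
      by (simp add: L2_tendsto_within_iff sq that tendsto_0_sqrt_sum_squares_iff2)
  qed
  ultimately show ?thesis by (auto simp: sobolev_continuous_on_def)
qed

lemma sobolev_continuous_on_0_iff:
  assumes H: "\<And>t. t \<in> I \<Longrightarrow> L2_circle (u t)"
  shows "sobolev_continuous_on 0 I u \<longleftrightarrow> (\<forall>t\<in>I. L2_tendsto u (u t) (at t within I))"
  using H by (auto simp: sobolev_continuous_on_def sobolev_def sobolev_norm_0 L2_circle_iff L2_tendsto_within_iff)

lemma H1_deriv_divide: "H1_deriv f g \<Longrightarrow> H1_deriv (\<lambda>x. f x / c) (\<lambda>x. g x / c)"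
  using H1_deriv_cmult[of f g "1 / c"] by simp

lemma sobolev_has_deriv_on_1_iff:
  assumes H: "\<And>t. t \<in> I \<Longrightarrow> H1_deriv (u t) (ux t)" "\<And>t. t \<in> I \<Longrightarrow> H1_deriv (v t) (vx t)"
  shows "sobolev_has_deriv_on 1 I u v \<longleftrightarrow>
    (\<forall>t\<in>I. L2_tendsto (\<lambda>s x. (u s x - u t x) / (s - t)) (v t) (at t within I) \<and>
       L2_tendsto (\<lambda>s x. (ux s x - ux t x) / (s - t)) (vx t) (at t within I))"
proof -
  have sq: "sq_int (u s)" "sq_int (ux s)" "sq_int (v s)" "sq_int (vx s)" if "s \<in> I" for s
    using H[OF that] by (auto intro: H1_deriv_sq_int H1_deriv_L2)
  have "sobolev 1 (u t)" "sobolev 1 (v t)" if "t \<in> I" for t using H[OF that] sobolev_1_iff by blast+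
  moreover have "((\<lambda>s. sobolev_norm 1 (\<lambda>x. (u s x - u t x) / (s - t) - v t x)) \<longlongrightarrow> 0) (at t within I) \<longleftrightarrow>
    L2_tendsto (\<lambda>s x. (u s x - u t x) / (s - t)) (v t) (at t within I) \<and>
       L2_tendsto (\<lambda>s x. (ux s x - ux t x) / (s - t)) (vx t) (at t within I)" if "t \<in> I" for t
  proof -
    have "sobolev_norm 1 (\<lambda>x. (u s x - u t x) / (s - t) - v t x) = 
       sqrt ((L2_norm (\<lambda>x. (u s x - u t x) / (s - t) - v t x))\<^sup>2
       + (L2_norm (\<lambda>x. (ux s x - ux t x) / (s - t) - vx t x))\<^sup>2)" if "s \<in> I" for s
      by (intro sobolev_norm_1 H1_deriv_diff H1_deriv_divide H that \<open>t \<in> I\<close>)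
    then have "((\<lambda>s. sobolev_norm 1 (\<lambda>x. (u s x - u t x) / (s - t) - v t x)) \<longlongrightarrow> 0) (at t within I) \<longleftrightarrow>
      ((\<lambda>s. sqrt ((L2_norm (\<lambda>x. (u s x - u t x) / (s - t) - v t x))\<^sup>2
       + (L2_norm (\<lambda>x. (ux s x - ux t x) / (s - t) - vx t x))\<^sup>2)) \<longlongrightarrow> 0) (at t within I)" by (intro tendsto_cong_mem)
    then show ?thesis
      by (simp add: L2_tendsto_within_iff sq that sq_int_divide sq_int_diff tendsto_0_sqrt_sum_squares_iff2)
  qed
  ultimately show ?thesis by (auto simp: sobolev_has_deriv_on_def)
qed

lemma sobolev_has_deriv_on_0_iff:
  assumes H: "\<And>t. t \<in> I \<Longrightarrow> L2_circle (u t)" "\<And>t. t \<in> I \<Longrightarrow> L2_circle (v t)"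
  shows "sobolev_has_deriv_on 0 I u v \<longleftrightarrow>
    (\<forall>t\<in>I. L2_tendsto (\<lambda>s x. (u s x - u t x) / (s - t)) (v t) (at t within I))"
proof -
  have "sq_int (u t)" "sq_int (v t)" if "t \<in> I" for t using H that by (auto simp: L2_circle_iff)
  then have "L2_tendsto (\<lambda>s x. (u s x - u t x) / (s - t)) (v t) (at t within I) \<longleftrightarrow>
    ((\<lambda>s. L2_norm (\<lambda>x. (u s x - u t x) / (s - t) - v t x)) \<longlongrightarrow> 0) (at t within I)" if "t \<in> I" for t
    using that by (intro L2_tendsto_within_iff sq_int_divide sq_int_diff) auto
  then show ?thesis
    using H by (auto simp: sobolev_has_deriv_on_def sobolev_def sobolev_norm_0)
qed

section \<open>Uniqueness of solutions: the energy estimate\<close>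

lemma hs_primitive_eq:
  fixes \<alpha> \<kappa> :: real
  assumes u: "H1_deriv u ux" and ux: "H1_deriv ux uxx" and r: "H1_deriv \<rho> \<rho>x" and x: "0 \<le> x" "x \<le> 1"
  shows "hs_primitive \<alpha> \<kappa> u \<rho> x =
    (LINT y|lebesgue_on {0..x}. \<kappa> / 2 * (\<rho> y)\<^sup>2 + (\<alpha> + 2) / 2 * (ux y)\<^sup>2 + hs_a \<alpha> \<kappa> u \<rho>)"
proof -
  have [measurable]: "ux \<in> borel_measurable (lebesgue_on {0..x})" "\<rho> \<in> borel_measurable (lebesgue_on {0..x})"
    by (rule continuous_imp_measurable_on_sets_lebesgue;
        use H1_deriv_continuous[OF ux] H1_deriv_continuous[OF r] in auto)+
  have "wderiv u \<in> borel_measurable circle"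
    using wderiv_H1(1)[OF u] by (auto simp: L2_circle_iff sq_int_measurable)
  then have [measurable]: "wderiv u \<in> borel_measurable (lebesgue_on {0..x})"
    by (rule measurable_restrict_mono) (use x in auto)
  have "AE y in lebesgue. y \<in> {0..1} \<longrightarrow> wderiv u y = ux y"
    using wderiv_H1(2)[OF u] by (subst (asm) AE_restrict_space_iff) auto
  then have "AE y in lebesgue. y \<in> {0..x} \<longrightarrow> wderiv u y = ux y"
    by eventually_elim (use x in auto)
  then have ae: "AE y in lebesgue_on {0..x}. wderiv u y = ux y"
    by (subst AE_restrict_space_iff) auto
  show ?thesis
    unfolding hs_primitive_def
  proof (rule integral_cong_AE)
    from ae show "AE y in lebesgue_on {0..x}.
        \<kappa> / 2 * (\<rho> y)\<^sup>2 + (\<alpha> + 2) / 2 * (wderiv u y)\<^sup>2 + hs_a \<alpha> \<kappa> u \<rho>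
        = \<kappa> / 2 * (\<rho> y)\<^sup>2 + (\<alpha> + 2) / 2 * (ux y)\<^sup>2 + hs_a \<alpha> \<kappa> u \<rho>"
      by eventually_elim simp
  qed auto
qed

lemma hs_a_eq:
  assumes u: "H1_deriv u ux" and ux: "H1_deriv ux uxx" and r: "H1_deriv \<rho> \<rho>x"
  shows "hs_a \<alpha> \<kappa> u \<rho> = - (LINT x|circle. \<kappa> / 2 * (\<rho> x)\<^sup>2 + (\<alpha> + 2) / 2 * (ux x)\<^sup>2)"
proof -
  have "(LINT x|circle. (wderiv u x)\<^sup>2) = (LINT x|circle. (ux x)\<^sup>2)"
    using L2_norm_wderiv[OF u] by (simp add: L2_norm_sq[symmetric])
  then show ?thesis
    using sq_int_sq_integrable[OF H1_deriv_sq_int[OF r]] sq_int_sq_integrable[OF H1_deriv_sq_int[OF ux]]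
    unfolding hs_a_def by (subst Bochner_Integration.integral_add) auto
qed

text \<open>The first equation identifies \<open>u\<^sub>t + u u\<^sub>x - h\<close> with the primitive of a continuous function. It is
  thereby an equation between functions in \<open>H\<^sup>1\<close> that can be differentiated in space, and its value at
  \<open>0\<close> is known.\<close>

lemma hs_primitive_H1:
  fixes \<alpha> \<kappa> :: real
  assumes u: "H1_deriv u ux" and ux: "H1_deriv ux uxx" and r: "H1_deriv \<rho> \<rho>x" and u': "H1_deriv u' u'x"
    and eq: "AE x in circle. u' x + u x * wderiv u x = hs_primitive \<alpha> \<kappa> u \<rho> x + c"
  shows "H1_deriv (\<lambda>x. u' x + u x * ux x - c)
           (\<lambda>x. \<kappa> / 2 * (\<rho> x)\<^sup>2 + (\<alpha> + 2) / 2 * (ux x)\<^sup>2 + hs_a \<alpha> \<kappa> u \<rho>)"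
    and "u' 0 + u 0 * ux 0 = c"
proof -
  define q where "q x = \<kappa> / 2 * (\<rho> x)\<^sup>2 + (\<alpha> + 2) / 2 * (ux x)\<^sup>2 + hs_a \<alpha> \<kappa> u \<rho>" for x
  have p: "periodic1 u" "periodic1 ux" "periodic1 \<rho>" "periodic1 u'"
    using assms by (auto intro: H1_deriv_periodic)
  note cont = H1_deriv_continuous[OF u] H1_deriv_continuous[OF ux] H1_deriv_continuous[OF r] H1_deriv_continuous[OF u']
  have cq: "continuous_on A q" for A unfolding q_def by (intro continuous_intros cont)
  have pq: "periodic1 q" using p by (simp add: q_def periodic1_def)
  obtain K where K: "\<And>x. (K has_real_derivative q x) (at x)" "K 0 = 0"
    using continuous_antiderivative[OF cq] by metis
  have Kint: "(LINT y|lebesgue_on {0..x}. q y) = K x" if "0 \<le> x" for x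
    using FTC_integral[OF that, of K q] K cq by (auto simp: has_field_derivative_at_within)
  have prim: "hs_primitive \<alpha> \<kappa> u \<rho> x = K x" if "0 \<le> x" "x \<le> 1" for x
    using hs_primitive_eq[OF u ux r that, of \<alpha> \<kappa>] Kint[OF that(1)] by (simp add: q_def)
  have "AE x in circle. u' x + u x * ux x - c = K x"
  proof -
    have "AE x in circle. 0 \<le> x \<and> x \<le> 1" by (rule AE_circleI) auto
    with eq wderiv_H1(2)[OF u] show ?thesis by eventually_elim (auto simp: prim)
  qed
  moreover have cK: "continuous_on A K" for A
    using K(1) by (meson DERIV_continuous continuous_at_imp_continuous_on)
  ultimately have eqK: "u' x + u x * ux x - c = K x" if "0 \<le> x" "x \<le> 1" for x
    using that by (intro continuous_AE_eq_imp_eq[where f="\<lambda>x. u' x + u x * ux x - c"] continuous_intros cont) auto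
  have "H1_deriv (\<lambda>x. u' x + u x * ux x - c) q"
  proof (rule H1_derivI_integral[where c=0])
    show "L2_circle q" using pq cq by (auto simp: L2_circle_iff sq_int_continuous)
    show "u' x + u x * ux x - c = 0 + (LINT y|lebesgue_on {0..x}. q y)" if "0 \<le> x" "x \<le> 1" for x
      using eqK[OF that] Kint that by simp
  qed (use p in \<open>simp add: periodic1_def\<close>)
  then show "H1_deriv (\<lambda>x. u' x + u x * ux x - c)
           (\<lambda>x. \<kappa> / 2 * (\<rho> x)\<^sup>2 + (\<alpha> + 2) / 2 * (ux x)\<^sup>2 + hs_a \<alpha> \<kappa> u \<rho>)"
    by (simp add: q_def[abs_def])
  show "u' 0 + u 0 * ux 0 = c" using eqK[of 0] K(2) by simp
qed

lemma L2_differentiable_imp_continuous: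
  assumes "L2_tendsto (\<lambda>s x. (f s x - f t x) / (s - t)) f' (at t within I)"
    "\<And>s. s \<in> I \<Longrightarrow> sq_int (f s)" "t \<in> I"
  shows "L2_tendsto f (f t) (at t within I)"
proof -
  have "((\<lambda>s. \<bar>s - t\<bar> * L2_norm (\<lambda>x. (f s x - f t x) / (s - t))) \<longlongrightarrow> \<bar>t - t\<bar> * L2_norm f') (at t within I)"
    by (intro tendsto_intros L2_tendsto_imp_tendsto_norm assms)
  moreover have "\<forall>\<^sub>F s in at t within I. \<bar>s - t\<bar> * L2_norm (\<lambda>x. (f s x - f t x) / (s - t)) = L2_norm (\<lambda>x. f s x - f t x)"
    unfolding eventually_at_filter
    by (intro always_eventually allI impI) (subst L2_norm_cmult[symmetric], simp)
  ultimately have "((\<lambda>s. L2_norm (\<lambda>x. f s x - f t x)) \<longlongrightarrow> 0) (at t within I)"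
    by (auto dest: Lim_transform_eventually)
  then show ?thesis using assms by (subst L2_tendsto_within_iff) auto
qed

lemma L2_norm_sq_has_derivative:
  assumes d: "L2_tendsto (\<lambda>s x. (f s x - f t x) / (s - t)) f' (at t within I)"
    and sq: "\<And>s. s \<in> I \<Longrightarrow> sq_int (f s)" and t: "t \<in> I"
  shows "((\<lambda>s. (L2_norm (f s))\<^sup>2) has_real_derivative 2 * (LINT x|circle. f t x * f' x)) (at t within I)"
proof -
  have f': "sq_int f'" using d by (simp add: L2_tendsto_def)
  have "L2_tendsto (\<lambda>s x. f s x + f t x) (\<lambda>x. f t x + f t x) (at t within I)"
    by (intro L2_tendsto_add L2_differentiable_imp_continuous[OF d sq t] L2_tendsto_const sq t)
  from L2_tendsto_integral_mult[OF d this]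
  have "((\<lambda>s. LINT x|circle. (f s x - f t x) / (s - t) * (f s x + f t x)) \<longlongrightarrow>
      (LINT x|circle. f' x * (f t x + f t x))) (at t within I)" .
  also have "(LINT x|circle. f' x * (f t x + f t x)) = 2 * (LINT x|circle. f t x * f' x)"
    by (subst integral_mult_right_zero[symmetric]) (simp add: algebra_simps)
  also have "((\<lambda>s. LINT x|circle. (f s x - f t x) / (s - t) * (f s x + f t x)) \<longlongrightarrow>
      2 * (LINT x|circle. f t x * f' x)) (at t within I) \<longleftrightarrow>
     ((\<lambda>s. ((L2_norm (f s))\<^sup>2 - (L2_norm (f t))\<^sup>2) / (s - t)) \<longlongrightarrow> 2 * (LINT x|circle. f t x * f' x)) (at t within I)"
  proof (rule tendsto_cong_mem)
    fix s assume s: "s \<in> I"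
    have "(L2_norm (f s))\<^sup>2 - (L2_norm (f t))\<^sup>2 = (LINT x|circle. (f s x)\<^sup>2 - (f t x)\<^sup>2)"
      using sq[OF s] sq[OF t] by (simp add: L2_norm_sq sq_int_sq_integrable)
    then have "((L2_norm (f s))\<^sup>2 - (L2_norm (f t))\<^sup>2) / (s - t) = (LINT x|circle. ((f s x)\<^sup>2 - (f t x)\<^sup>2) / (s - t))"
      by simp
    also have "\<dots> = (LINT x|circle. (f s x - f t x) / (s - t) * (f s x + f t x))"
      by (intro Bochner_Integration.integral_cong) (auto simp: power2_eq_square algebra_simps)
    finally have "((L2_norm (f s))\<^sup>2 - (L2_norm (f t))\<^sup>2) / (s - t) =
      (LINT x|circle. (f s x - f t x) / (s - t) * (f s x + f t x))" .
    then show "(LINT x|circle. (f s x - f t x) / (s - t) * (f s x + f t x)) =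
       ((L2_norm (f s))\<^sup>2 - (L2_norm (f t))\<^sup>2) / (s - t)" by (rule sym)
  qed
  finally show ?thesis by (simp add: has_field_derivative_iff)
qed

text \<open>The function \<open>exp (- K t) E(t)\<close> does not increase.\<close>

lemma gronwall_zero:
  fixes E :: "real \<Rightarrow> real"
  assumes d: "\<And>t. t \<in> {0..b} \<Longrightarrow> (E has_real_derivative E' t) (at t within {0..b})"
    and le: "\<And>t. t \<in> {0..b} \<Longrightarrow> E' t \<le> K * E t"
    and E: "\<And>t. 0 \<le> E t" "E 0 = 0" and b: "0 \<le> b"
  shows "E b = 0"
proof -
  define g where "g t = exp (- K * t) * E t" for t
  have dg: "(g has_real_derivative (exp (- K * t) * (E' t - K * E t))) (at t within {0..b})" if "t \<in> {0..b}" for t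
    unfolding g_def using d[OF that] by (auto intro!: derivative_eq_intros simp: algebra_simps)
  have "g b \<le> g 0"
  proof (rule DERIV_nonpos_imp_decreasing_open[OF b])
    fix x assume x: "0 < x" "x < b"
    then have "at x within {0..b} = at x" by (intro at_within_interior) auto
    then show "\<exists>y. (g has_real_derivative y) (at x) \<and> y \<le> 0"
      using dg[of x] le[of x] x by (intro exI[of _ "exp (- K * x) * (E' x - K * E x)"]) (auto simp: mult_nonneg_nonpos)
  next
    show "continuous_on {0..b} g"
      by (rule DERIV_continuous_on[OF dg])
  qed
  then have "exp (- K * b) * E b \<le> 0" using E by (simp add: g_def)
  moreover have "exp (- K * b) * E b \<ge> 0" using E(1)[of b] by simp
  ultimately have "exp (- K * b) * E b = 0" by linarith
  then show ?thesis by simp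
qed

text \<open>A function differs from its mean by at most its oscillation.\<close>

lemma H1_deriv_sup:
  assumes "H1_deriv f g"
  shows "\<bar>f x\<bar> \<le> L2_norm f + L2_norm g"
proof -
  have i: "integrable circle f" using H1_deriv_sq_int[OF assms] by (rule sq_int_integrable)
  have "f x = (LINT y|circle. f x - f y) + (LINT y|circle. f y)"
    using i by simp
  moreover have "\<bar>LINT y|circle. f x - f y\<bar> \<le> (LINT y|circle. L2_norm g)"
    using i by (intro integral_abs_bound_integral) (auto simp: H1_deriv_oscillation[OF assms])
  moreover have "\<bar>LINT y|circle. f y\<bar> \<le> L2_norm f"
    using L2_Cauchy_Schwarz[OF H1_deriv_sq_int[OF assms] sq_int_const[of 1]] by (simp add: L2_norm_const)
  ultimately show ?thesis by simp
qed

text \<open>The integral of the derivative of \<open>u f\<^sup>2\<close> vanishes.\<close>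

lemma integral_transport:
  assumes f: "H1_deriv f g" and u: "H1_deriv u ux"
  shows "(LINT x|circle. f x * (u x * g x)) = - (1/2) * (LINT x|circle. f x * (ux x * f x))"
proof -
  have "(LINT x|circle. u x * (f x * g x + f x * g x) + (f x * f x) * ux x) = 0"
    by (rule H1_deriv_integral_0[OF H1_deriv_mult[OF H1_deriv_mult[OF f f] u]])
  then have "(LINT x|circle. 2 * (f x * (u x * g x)) + f x * (ux x * f x)) = 0"
    by (simp add: algebra_simps)
  moreover have "integrable circle (\<lambda>x. f x * (u x * g x))"
    using H1_deriv_sq_int[OF f] H1_deriv_L2(2)[OF f] H1_deriv_continuous[OF u]
    by (intro sq_int_mult_integrable) auto
  moreover have "integrable circle (\<lambda>x. f x * (ux x * f x))"
    using H1_deriv_sq_int[OF f] H1_deriv_L2(2)[OF u] H1_deriv_continuous[OF f]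
      sq_int_mult_continuous[OF H1_deriv_continuous[OF f] H1_deriv_L2(2)[OF u]]
    by (intro sq_int_mult_integrable) (auto simp: mult.commute)
  ultimately show ?thesis by simp
qed

lemma L2_Cauchy_Schwarz_le:
  assumes "sq_int f" "sq_int g" "L2_norm f \<le> a" "L2_norm g \<le> b"
  shows "\<bar>LINT x|circle. f x * g x\<bar> \<le> a * b"
proof -
  have "L2_norm f * L2_norm g \<le> a * b"
    by (intro mult_mono assms order_trans[OF L2_norm_nonneg assms(3)] L2_norm_nonneg)
  then show ?thesis using L2_Cauchy_Schwarz[OF assms(1,2)] by linarith
qed

text \<open>The energy inequality for the difference \<open>w = u - v\<close>, \<open>\<tau> = \<rho> - \<sigma>\<close> of two solutions at a fixed time.
  Second derivatives of \<open>w\<close> and first derivatives of \<open>\<tau>\<close> occur only in the transport terms, where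
  integration by parts removes them.\<close>

lemma energy_inequality:
  fixes \<alpha> \<kappa> M :: real
  assumes u: "H1_deriv u ux" "H1_deriv ux uxx" and v: "H1_deriv v vx" "H1_deriv vx vxx"
    and r: "H1_deriv \<rho> \<rho>x" and s: "H1_deriv \<sigma> \<sigma>x"
    and ut: "H1_deriv ut utx" and vt: "H1_deriv vt vtx" and rt: "sq_int \<rho>t" and st: "sq_int \<sigma>t"
    and equ: "H1_deriv (\<lambda>x. ut x + u x * ux x - c) (\<lambda>x. \<kappa> / 2 * (\<rho> x)\<^sup>2 + (\<alpha> + 2) / 2 * (ux x)\<^sup>2 + a)"
      "ut 0 + u 0 * ux 0 = c"
    and eqv: "H1_deriv (\<lambda>x. vt x + v x * vx x - c) (\<lambda>x. \<kappa> / 2 * (\<sigma> x)\<^sup>2 + (\<alpha> + 2) / 2 * (vx x)\<^sup>2 + b)"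
      "vt 0 + v 0 * vx 0 = c"
    and eqr: "AE x in circle. \<rho>t x + u x * \<rho>x x = \<alpha> * ux x * \<rho> x"
    and eqs: "AE x in circle. \<sigma>t x + v x * \<sigma>x x = \<alpha> * vx x * \<sigma> x"
    and M: "\<And>x. \<bar>u x\<bar> \<le> M" "\<And>x. \<bar>ux x\<bar> \<le> M" "\<And>x. \<bar>vx x\<bar> \<le> M" "\<And>x. \<bar>\<rho> x\<bar> \<le> M" "\<And>x. \<bar>\<sigma> x\<bar> \<le> M"
      "L2_norm vxx \<le> M" "L2_norm \<sigma>x \<le> M"
  defines "w \<equiv> \<lambda>x. u x - v x" and "wx \<equiv> \<lambda>x. ux x - vx x" and "\<tau> \<equiv> \<lambda>x. \<rho> x - \<sigma> x"
    and "wt \<equiv> \<lambda>x. ut x - vt x" and "wtx \<equiv> \<lambda>x. utx x - vtx x" and "\<tau>t \<equiv> \<lambda>x. \<rho>t x - \<sigma>t x"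
  shows "(LINT x|circle. w x * wt x) + (LINT x|circle. wx x * wtx x) + (LINT x|circle. \<tau> x * \<tau>t x)
    \<le> (3 * \<bar>\<kappa>\<bar> + 3 * \<bar>\<alpha> + 2\<bar> + 2 * \<bar>\<alpha>\<bar> + 10) * M * ((L2_norm w)\<^sup>2 + (L2_norm wx)\<^sup>2 + (L2_norm \<tau>)\<^sup>2)"
proof -
  define N where "N = sqrt ((L2_norm w)\<^sup>2 + (L2_norm wx)\<^sup>2 + (L2_norm \<tau>)\<^sup>2)"
  have NN: "N * N = (L2_norm w)\<^sup>2 + (L2_norm wx)\<^sup>2 + (L2_norm \<tau>)\<^sup>2" unfolding N_def by simp
  have nN: "L2_norm w \<le> N" "L2_norm wx \<le> N" "L2_norm \<tau> \<le> N"
    unfolding N_def by (auto intro!: real_le_rsqrt)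
  have N0: "0 \<le> N" by (simp add: N_def)
  have M0: "0 \<le> M" using M(1)[of 0] by linarith
  have w: "H1_deriv w wx" "H1_deriv wx (\<lambda>x. uxx x - vxx x)" "H1_deriv \<tau> (\<lambda>x. \<rho>x x - \<sigma>x x)"
    "H1_deriv wt wtx"
    unfolding w_def wx_def \<tau>_def wt_def wtx_def by (intro H1_deriv_diff u v r s ut vt)+
  note cont = H1_deriv_continuous[OF u(1)] H1_deriv_continuous[OF u(2)] H1_deriv_continuous[OF v(1)]
    H1_deriv_continuous[OF v(2)] H1_deriv_continuous[OF r] H1_deriv_continuous[OF s]
    H1_deriv_continuous[OF w(1)] H1_deriv_continuous[OF w(2)] H1_deriv_continuous[OF w(3)] H1_deriv_continuous[OF w(4)]
  note meas = cont[where A="{0..1}", THEN continuous_measurable_circle]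
  note sq = H1_deriv_sq_int[OF w(1)] H1_deriv_sq_int[OF w(2)] H1_deriv_sq_int[OF w(3)] H1_deriv_sq_int[OF w(4)]
    H1_deriv_L2(2)[OF u(2)] H1_deriv_L2(2)[OF v(2)] H1_deriv_L2(2)[OF r] H1_deriv_L2(2)[OF s]
    H1_deriv_L2(2)[OF w(4)] rt st
  have supw: "\<bar>w x\<bar> \<le> 2 * N" for x using H1_deriv_sup[OF w(1), of x] nN by linarith
  define q where "q x = \<kappa> / 2 * (\<rho> x + \<sigma> x) * \<tau> x + (\<alpha> + 2) / 2 * (ux x + vx x) * wx x" for x
  have sqq: "sq_int q" unfolding q_def by (intro sq_int_continuous continuous_intros cont)
  define L where "L = (\<bar>\<kappa>\<bar> + \<bar>\<alpha> + 2\<bar>) * M * N"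
  have nq: "L2_norm q \<le> L"
  proof -
    have "L2_norm q \<le> L2_norm (\<lambda>x. \<kappa> / 2 * (\<rho> x + \<sigma> x) * \<tau> x) + L2_norm (\<lambda>x. (\<alpha> + 2) / 2 * (ux x + vx x) * wx x)"
      unfolding q_def by (intro L2_norm_triangle sq_int_continuous continuous_intros cont)
    moreover have "L2_norm (\<lambda>x. \<kappa> / 2 * (\<rho> x + \<sigma> x) * \<tau> x) \<le> \<bar>\<kappa>\<bar> * M * L2_norm \<tau>"
    proof (rule L2_norm_mult_le)
      fix x show "\<bar>\<kappa> / 2 * (\<rho> x + \<sigma> x)\<bar> \<le> \<bar>\<kappa>\<bar> * M"
        using mult_left_mono[of "\<bar>\<rho> x + \<sigma> x\<bar>" "2 * M" "\<bar>\<kappa>\<bar> / 2"] M(4,5)[of x] by (simp add: abs_mult)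
    qed (use sq meas in auto)
    moreover have "L2_norm (\<lambda>x. (\<alpha> + 2) / 2 * (ux x + vx x) * wx x) \<le> \<bar>\<alpha> + 2\<bar> * M * L2_norm wx"
    proof (rule L2_norm_mult_le)
      fix x show "\<bar>(\<alpha> + 2) / 2 * (ux x + vx x)\<bar> \<le> \<bar>\<alpha> + 2\<bar> * M"
        using mult_left_mono[of "\<bar>ux x + vx x\<bar>" "2 * M" "\<bar>\<alpha> + 2\<bar> / 2"] M(2,3)[of x] by (simp add: abs_mult)
    qed (use sq meas in auto)
    moreover have "\<bar>\<kappa>\<bar> * M * L2_norm \<tau> \<le> \<bar>\<kappa>\<bar> * M * N" "\<bar>\<alpha> + 2\<bar> * M * L2_norm wx \<le> \<bar>\<alpha> + 2\<bar> * M * N"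
      using nN M0 by (intro mult_left_mono; simp)+
    ultimately show ?thesis by (simp add: L_def algebra_simps)
  qed
  \<comment> \<open>\<open>D\<close> is the difference of the two primitives. It vanishes at \<open>0\<close>, so that its derivative controls it;
    the constant \<open>a - b\<close> is controlled since that derivative has mean zero.\<close>
  define D where "D x = wt x + (u x * wx x + w x * vx x)" for x
  have D: "H1_deriv D (\<lambda>x. q x + (a - b))"
  proof -
    have "D = (\<lambda>x. (ut x + u x * ux x - c) - (vt x + v x * vx x - c))"
      by (auto simp: D_def w_def wx_def wt_def algebra_simps)
    moreover have "(\<lambda>x. q x + (a - b)) = (\<lambda>x. (\<kappa> / 2 * (\<rho> x)\<^sup>2 + (\<alpha> + 2) / 2 * (ux x)\<^sup>2 + a)
       - (\<kappa> / 2 * (\<sigma> x)\<^sup>2 + (\<alpha> + 2) / 2 * (vx x)\<^sup>2 + b))"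
      by (auto simp: q_def wx_def \<tau>_def power2_eq_square algebra_simps add_divide_distrib diff_divide_distrib)
    ultimately show ?thesis using H1_deriv_diff[OF equ(1) eqv(1)] by simp
  qed
  have ab: "\<bar>a - b\<bar> \<le> L"
  proof -
    have "(LINT x|circle. q x) + (a - b) = 0"
      using H1_deriv_integral_0[OF D] sq_int_integrable[OF sqq] by simp
    moreover have "\<bar>LINT x|circle. q x\<bar> \<le> L"
      using L2_Cauchy_Schwarz[OF sqq sq_int_const[of 1]] nq by (simp add: L2_norm_const)
    ultimately show ?thesis by linarith
  qed
  have supD: "\<bar>D x\<bar> \<le> 2 * L" for x
  proof -
    have "D 0 = 0" using equ(2) eqv(2) by (simp add: D_def w_def wx_def wt_def algebra_simps)
    then have "\<bar>D x\<bar> \<le> L2_norm (\<lambda>x. q x + (a - b))" using H1_deriv_oscillation[OF D, of x 0] by simp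
    also have "\<dots> \<le> L2_norm q + L2_norm (\<lambda>x. a - b)" by (intro L2_norm_triangle sqq sq_int_const)
    also have "\<dots> \<le> 2 * L" using nq ab by (simp add: L2_norm_const)
    finally show ?thesis .
  qed
  have sqD: "sq_int D" using H1_deriv_sq_int[OF D] .
  have nD: "L2_norm D \<le> 2 * L" using supD by (intro L2_norm_le_bound sqD)
  have nmult: "L2_norm (\<lambda>x. f x * g x) \<le> C * n"
    if "sq_int g" "f \<in> borel_measurable circle" "\<And>x. \<bar>f x\<bar> \<le> C" "L2_norm g \<le> n" for f g C n
  proof -
    have "0 \<le> C" using that(3)[of 0] by linarith
    then show ?thesis
      using L2_norm_mult_le[OF that(1,2), of C] that(3) mult_left_mono[OF that(4), of C] by fastforce
  qed
  have I1: "(LINT x|circle. w x * wt x) \<le> N * (2 * L) + N * (M * N) + N * (M * N)"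
  proof -
    have "(LINT x|circle. w x * wt x) = (LINT x|circle. w x * D x - w x * (u x * wx x) - w x * (vx x * w x))"
      by (simp add: D_def algebra_simps)
    also have "\<dots> = (LINT x|circle. w x * D x) - (LINT x|circle. w x * (u x * wx x)) - (LINT x|circle. w x * (vx x * w x))"
      by (simp add: sq_int_mult_integrable sq sqD sq_int_mult_continuous cont)
    also have "\<dots> \<le> N * (2 * L) + N * (M * N) + N * (M * N)"
    proof -
      have "\<bar>LINT x|circle. w x * D x\<bar> \<le> N * (2 * L)"
        by (rule L2_Cauchy_Schwarz_le[OF sq(1) sqD nN(1) nD])
      moreover have "\<bar>LINT x|circle. w x * (u x * wx x)\<bar> \<le> N * (M * N)"
        by (intro L2_Cauchy_Schwarz_le sq nN nmult M meas sq_int_mult_continuous cont)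
      moreover have "\<bar>LINT x|circle. w x * (vx x * w x)\<bar> \<le> N * (M * N)"
        by (intro L2_Cauchy_Schwarz_le sq nN nmult M meas sq_int_mult_continuous cont)
      ultimately show ?thesis by linarith
    qed
    finally show ?thesis .
  qed
  have I2: "(LINT x|circle. wx x * wtx x) \<le> N * L + N * (2 * M * N) + 1/2 * (N * (M * N)) + N * (2 * N * M)"
  proof -
    have "H1_deriv wt (\<lambda>x. (q x + (a - b)) - ((wx x * ux x + u x * (uxx x - vxx x)) + (vx x * wx x + w x * vxx x)))"
    proof -
      have "wt = (\<lambda>x. D x - (u x * wx x + w x * vx x))" by (auto simp: D_def)
      then show ?thesis
        using H1_deriv_diff[OF D H1_deriv_add[OF H1_deriv_mult[OF u(1) w(2)] H1_deriv_mult[OF w(1) v(2)]]] by simp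
    qed
    from H1_deriv_unique[OF w(4) this]
    have ae: "AE x in circle. wx x * wtx x = wx x * q x + (a - b) * wx x - wx x * ((ux x + vx x) * wx x)
       - wx x * (u x * (uxx x - vxx x)) - wx x * (w x * vxx x)"
    proof eventually_elim
      case (elim x)
      show ?case unfolding elim by (simp add: algebra_simps)
    qed
    have sqp: "sq_int (\<lambda>x. (ux x + vx x) * wx x)" "sq_int (\<lambda>x. u x * (uxx x - vxx x))" "sq_int (\<lambda>x. w x * vxx x)"
      by (intro sq_int_mult_continuous sq_int_diff continuous_intros cont sq)+
    have int: "integrable circle (\<lambda>x. wx x * q x)" "integrable circle (\<lambda>x. (a - b) * wx x)"
      "integrable circle (\<lambda>x. wx x * ((ux x + vx x) * wx x))"
      "integrable circle (\<lambda>x. wx x * (u x * (uxx x - vxx x)))" "integrable circle (\<lambda>x. wx x * (w x * vxx x))"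
      by (intro sq_int_mult_integrable sqp sq sqq sq_int_const)+
    have "(LINT x|circle. wx x * wtx x) = (LINT x|circle. wx x * q x + (a - b) * wx x - wx x * ((ux x + vx x) * wx x)
       - wx x * (u x * (uxx x - vxx x)) - wx x * (w x * vxx x))"
      using ae int by (intro integral_cong_AE) (auto intro!: borel_measurable_integrable sq_int_mult_integrable sq)
    also have "\<dots> = (LINT x|circle. wx x * q x) + (a - b) * (LINT x|circle. wx x)
       - (LINT x|circle. wx x * ((ux x + vx x) * wx x))
       - (LINT x|circle. wx x * (u x * (uxx x - vxx x))) - (LINT x|circle. wx x * (w x * vxx x))"
      using int by simp
    also have "(LINT x|circle. wx x) = 0" by (rule H1_deriv_integral_0[OF w(1)])
    also have "(LINT x|circle. wx x * (u x * (uxx x - vxx x))) = - (1/2) * (LINT x|circle. wx x * (ux x * wx x))"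
      by (rule integral_transport[OF w(2) u(1)])
    also have "(LINT x|circle. wx x * q x) + (a - b) * 0 - (LINT x|circle. wx x * ((ux x + vx x) * wx x))
       - (- (1/2) * (LINT x|circle. wx x * (ux x * wx x))) - (LINT x|circle. wx x * (w x * vxx x))
       \<le> N * L + N * (2 * M * N) + 1/2 * (N * (M * N)) + N * (2 * N * M)"
    proof -
      have "\<bar>LINT x|circle. wx x * q x\<bar> \<le> N * L"
        by (rule L2_Cauchy_Schwarz_le[OF sq(2) sqq nN(2) nq])
      moreover have "\<bar>LINT x|circle. wx x * ((ux x + vx x) * wx x)\<bar> \<le> N * (2 * M * N)"
      proof (intro L2_Cauchy_Schwarz_le sq nN nmult sqp)
        show "\<bar>ux x + vx x\<bar> \<le> 2 * M" for x using M(2,3)[of x] by linarith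
      qed (use meas in auto)
      moreover have "\<bar>LINT x|circle. wx x * (ux x * wx x)\<bar> \<le> N * (M * N)"
        by (intro L2_Cauchy_Schwarz_le sq nN nmult M meas sq_int_mult_continuous cont)
      moreover have "\<bar>LINT x|circle. wx x * (w x * vxx x)\<bar> \<le> N * (2 * N * M)"
        by (intro L2_Cauchy_Schwarz_le sq nN nmult M meas sq_int_mult_continuous cont supw)
      moreover have "N * (2 * M * N) = 2 * (N * (M * N))" "N * (2 * N * M) = 2 * (N * (M * N))"
        by simp_all
      ultimately show ?thesis unfolding abs_le_iff by linarith
    qed
    finally show ?thesis .
  qed
  have I3: "(LINT x|circle. \<tau> x * \<tau>t x) \<le> \<bar>\<alpha>\<bar> * (N * (M * N)) + \<bar>\<alpha>\<bar> * (N * (M * N))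
     + 1/2 * (N * (M * N)) + N * (2 * N * M)"
  proof -
    from eqr eqs
    have ae: "AE x in circle. \<tau> x * \<tau>t x = \<alpha> * (\<tau> x * (ux x * \<tau> x)) + \<alpha> * (\<tau> x * (\<sigma> x * wx x))
       - \<tau> x * (u x * (\<rho>x x - \<sigma>x x)) - \<tau> x * (w x * \<sigma>x x)"
    proof eventually_elim
      case (elim x)
      then have 1: "\<rho>t x = \<alpha> * ux x * \<rho> x - u x * \<rho>x x" "\<sigma>t x = \<alpha> * vx x * \<sigma> x - v x * \<sigma>x x" by auto
      show ?case unfolding \<tau>t_def 1 by (simp add: \<tau>_def w_def wx_def algebra_simps)
    qed
    have sqp: "sq_int (\<lambda>x. ux x * \<tau> x)" "sq_int (\<lambda>x. \<sigma> x * wx x)" "sq_int (\<lambda>x. u x * (\<rho>x x - \<sigma>x x))" "sq_int (\<lambda>x. w x * \<sigma>x x)"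
      by (intro sq_int_mult_continuous sq_int_diff continuous_intros cont sq)+
    have int: "integrable circle (\<lambda>x. \<tau> x * (ux x * \<tau> x))" "integrable circle (\<lambda>x. \<tau> x * (\<sigma> x * wx x))"
      "integrable circle (\<lambda>x. \<tau> x * (u x * (\<rho>x x - \<sigma>x x)))" "integrable circle (\<lambda>x. \<tau> x * (w x * \<sigma>x x))"
      "integrable circle (\<lambda>x. \<tau> x * \<tau>t x)"
      unfolding \<tau>t_def by (intro sq_int_mult_integrable sqp sq sq_int_diff)+
    have "(LINT x|circle. \<tau> x * \<tau>t x) = (LINT x|circle. \<alpha> * (\<tau> x * (ux x * \<tau> x)) + \<alpha> * (\<tau> x * (\<sigma> x * wx x))
       - \<tau> x * (u x * (\<rho>x x - \<sigma>x x)) - \<tau> x * (w x * \<sigma>x x))"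
      using ae int by (intro integral_cong_AE) (auto intro!: borel_measurable_integrable)
    also have "\<dots> = \<alpha> * (LINT x|circle. \<tau> x * (ux x * \<tau> x)) + \<alpha> * (LINT x|circle. \<tau> x * (\<sigma> x * wx x))
       - (LINT x|circle. \<tau> x * (u x * (\<rho>x x - \<sigma>x x))) - (LINT x|circle. \<tau> x * (w x * \<sigma>x x))"
      using int by simp
    also have "(LINT x|circle. \<tau> x * (u x * (\<rho>x x - \<sigma>x x))) = - (1/2) * (LINT x|circle. \<tau> x * (ux x * \<tau> x))"
      by (rule integral_transport[OF w(3) u(1)])
    also have "\<alpha> * (LINT x|circle. \<tau> x * (ux x * \<tau> x)) + \<alpha> * (LINT x|circle. \<tau> x * (\<sigma> x * wx x))
       - (- (1/2) * (LINT x|circle. \<tau> x * (ux x * \<tau> x))) - (LINT x|circle. \<tau> x * (w x * \<sigma>x x))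
       \<le> \<bar>\<alpha>\<bar> * (N * (M * N)) + \<bar>\<alpha>\<bar> * (N * (M * N)) + 1/2 * (N * (M * N)) + N * (2 * N * M)"
    proof -
      have a: "\<bar>LINT x|circle. \<tau> x * (ux x * \<tau> x)\<bar> \<le> N * (M * N)"
        by (intro L2_Cauchy_Schwarz_le sq nN nmult M meas sq_int_mult_continuous cont)
      have b: "\<bar>LINT x|circle. \<tau> x * (\<sigma> x * wx x)\<bar> \<le> N * (M * N)"
        by (intro L2_Cauchy_Schwarz_le sq nN nmult M meas sq_int_mult_continuous cont)
      have c: "\<bar>LINT x|circle. \<tau> x * (w x * \<sigma>x x)\<bar> \<le> N * (2 * N * M)"
        by (intro L2_Cauchy_Schwarz_le sq nN nmult M meas sq_int_mult_continuous cont supw)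
      have "\<alpha> * z \<le> \<bar>\<alpha>\<bar> * C" if "\<bar>z\<bar> \<le> C" for z C
        using mult_left_mono[OF that, of "\<bar>\<alpha>\<bar>"] by (simp add: abs_mult[symmetric])
      from this[OF a] this[OF b] a c show ?thesis unfolding abs_le_iff by linarith
    qed
    finally show ?thesis .
  qed
  have "(LINT x|circle. w x * wt x) + (LINT x|circle. wx x * wtx x) + (LINT x|circle. \<tau> x * \<tau>t x)
     \<le> 3 * (N * L) + (2 * \<bar>\<alpha>\<bar> + 9) * M * (N * N)"
    using I1 I2 I3 by (simp add: algebra_simps)
  also have "3 * (N * L) = 3 * (\<bar>\<kappa>\<bar> + \<bar>\<alpha> + 2\<bar>) * M * (N * N)" by (simp add: L_def algebra_simps)
  also have "3 * (\<bar>\<kappa>\<bar> + \<bar>\<alpha> + 2\<bar>) * M * (N * N) + (2 * \<bar>\<alpha>\<bar> + 9) * M * (N * N)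
     \<le> (3 * \<bar>\<kappa>\<bar> + 3 * \<bar>\<alpha> + 2\<bar> + 2 * \<bar>\<alpha>\<bar> + 10) * M * (N * N)"
    using M0 N0 by (simp add: algebra_simps)
  finally show ?thesis by (simp add: NN)
qed


text \<open>What the uniqueness proof uses of a solution: representatives of all derivatives, chosen once for
  all times, with their regularity in time, and the equations in terms of these representatives.\<close>

definition hs_data where
  "hs_data \<alpha> \<kappa> h I u \<rho> ux uxx \<rho>x ut utx \<rho>t \<longleftrightarrow>
    (\<forall>t\<in>I. H1_deriv (u t) (ux t) \<and> H1_deriv (ux t) (uxx t) \<and> H1_deriv (\<rho> t) (\<rho>x t) \<and>
       H1_deriv (ut t) (utx t) \<and> sq_int (\<rho>t t)) \<and>
    (\<forall>t\<in>I. L2_tendsto u (u t) (at t within I) \<and> L2_tendsto ux (ux t) (at t within I) \<and>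
       L2_tendsto uxx (uxx t) (at t within I) \<and>
       L2_tendsto \<rho> (\<rho> t) (at t within I) \<and> L2_tendsto \<rho>x (\<rho>x t) (at t within I)) \<and>
    (\<forall>t\<in>I. L2_tendsto (\<lambda>s x. (u s x - u t x) / (s - t)) (ut t) (at t within I) \<and>
       L2_tendsto (\<lambda>s x. (ux s x - ux t x) / (s - t)) (utx t) (at t within I) \<and>
       L2_tendsto (\<lambda>s x. (\<rho> s x - \<rho> t x) / (s - t)) (\<rho>t t) (at t within I)) \<and>
    (\<forall>t\<in>I. H1_deriv (\<lambda>x. ut t x + u t x * ux t x - h t)
           (\<lambda>x. \<kappa> / 2 * (\<rho> t x)\<^sup>2 + (\<alpha> + 2) / 2 * (ux t x)\<^sup>2 + hs_a \<alpha> \<kappa> (u t) (\<rho> t)) \<and>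
       ut t 0 + u t 0 * ux t 0 = h t \<and>
       (AE x in circle. \<rho>t t x + u t x * \<rho>x t x = \<alpha> * ux t x * \<rho> t x))"

lemma hs_solution_data:
  assumes sol: "hs_solution \<alpha> \<kappa> h u0 \<rho>0 T u \<rho>"
  defines "I \<equiv> {t. 0 \<le> t \<and> ereal t < T}"
  obtains ux uxx \<rho>x ut utx \<rho>t where "hs_data \<alpha> \<kappa> h I u \<rho> ux uxx \<rho>x ut utx \<rho>t"
proof -
  from sol obtain u' \<rho>' where c: "sobolev_continuous_on 2 I u" "sobolev_continuous_on 1 I \<rho>"
     and d: "sobolev_has_deriv_on 1 I u u'" "sobolev_has_deriv_on 0 I \<rho> \<rho>'"
     and e1: "\<And>t. t \<in> I \<Longrightarrow> AE x in circle. u' t x + u t x * wderiv (u t) x = hs_primitive \<alpha> \<kappa> (u t) (\<rho> t) x + h t"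
     and e2: "\<And>t. t \<in> I \<Longrightarrow> AE x in circle. \<rho>' t x + u t x * wderiv (\<rho> t) x = \<alpha> * wderiv (u t) x * \<rho> t x"
    unfolding hs_solution_def Let_def I_def[symmetric] by blast
  have "\<forall>t\<in>I. \<exists>g k. H1_deriv (u t) g \<and> H1_deriv g k"
    using c(1) by (simp add: sobolev_continuous_on_def sobolev_2_iff)
  then obtain ux uxx where u: "\<And>t. t \<in> I \<Longrightarrow> H1_deriv (u t) (ux t)" "\<And>t. t \<in> I \<Longrightarrow> H1_deriv (ux t) (uxx t)"
    by metis
  have "\<forall>t\<in>I. \<exists>g. H1_deriv (\<rho> t) g"
    using c(2) unfolding sobolev_continuous_on_def sobolev_1_iff by blast
  then obtain \<rho>x where r: "\<And>t. t \<in> I \<Longrightarrow> H1_deriv (\<rho> t) (\<rho>x t)" by metis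
  have "\<forall>t\<in>I. \<exists>g. H1_deriv (u' t) g"
    using d(1) unfolding sobolev_has_deriv_on_def sobolev_1_iff by blast
  then obtain utx where ut: "\<And>t. t \<in> I \<Longrightarrow> H1_deriv (u' t) (utx t)" by metis
  have L0: "L2_circle (\<rho> t)" "L2_circle (\<rho>' t)" if "t \<in> I" for t
    using d(2) that by (auto simp: sobolev_has_deriv_on_def sobolev_def)
  note cu = iffD1[OF sobolev_continuous_on_2_iff[of I u ux uxx] c(1), OF u, rule_format]
  note cr = iffD1[OF sobolev_continuous_on_1_iff[of I \<rho> \<rho>x] c(2), OF r, rule_format]
  note du = iffD1[OF sobolev_has_deriv_on_1_iff[of I u ux u' utx] d(1), OF u(1) ut, rule_format]
  note dr = iffD1[OF sobolev_has_deriv_on_0_iff[of I \<rho> \<rho>'] d(2), OF L0, rule_format]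
  note pr = hs_primitive_H1[OF u(1) u(2) r ut e1]
  have e2': "AE x in circle. \<rho>' t x + u t x * \<rho>x t x = \<alpha> * ux t x * \<rho> t x" if "t \<in> I" for t
    using e2[OF that] wderiv_H1(2)[OF u(1)[OF that]] wderiv_H1(2)[OF r[OF that]]
    by eventually_elim simp
  have "hs_data \<alpha> \<kappa> h I u \<rho> ux uxx \<rho>x u' utx \<rho>'"
    unfolding hs_data_def using u r ut L0 cu cr du dr pr e2' by (simp add: L2_circle_iff)
  then show ?thesis by (rule that)
qed

lemma hs_dataD:
  assumes "hs_data \<alpha> \<kappa> h I u \<rho> ux uxx \<rho>x ut utx \<rho>t" "t \<in> I"
  shows "H1_deriv (u t) (ux t)" "H1_deriv (ux t) (uxx t)" "H1_deriv (\<rho> t) (\<rho>x t)" "H1_deriv (ut t) (utx t)"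
    "sq_int (\<rho>t t)"
    and "L2_tendsto u (u t) (at t within I)" "L2_tendsto ux (ux t) (at t within I)"
    "L2_tendsto uxx (uxx t) (at t within I)"
    "L2_tendsto \<rho> (\<rho> t) (at t within I)" "L2_tendsto \<rho>x (\<rho>x t) (at t within I)"
    and "L2_tendsto (\<lambda>s x. (u s x - u t x) / (s - t)) (ut t) (at t within I)"
    "L2_tendsto (\<lambda>s x. (ux s x - ux t x) / (s - t)) (utx t) (at t within I)"
    "L2_tendsto (\<lambda>s x. (\<rho> s x - \<rho> t x) / (s - t)) (\<rho>t t) (at t within I)"
    and "H1_deriv (\<lambda>x. ut t x + u t x * ux t x - h t)
           (\<lambda>x. \<kappa> / 2 * (\<rho> t x)\<^sup>2 + (\<alpha> + 2) / 2 * (ux t x)\<^sup>2 + hs_a \<alpha> \<kappa> (u t) (\<rho> t))"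
    "ut t 0 + u t 0 * ux t 0 = h t"
    "AE x in circle. \<rho>t t x + u t x * \<rho>x t x = \<alpha> * ux t x * \<rho> t x"
  using assms unfolding hs_data_def by blast+

lemma L2_continuous_bounded:
  fixes b :: real
  assumes "\<And>t. t \<in> {0..b} \<Longrightarrow> L2_tendsto f (f t) (at t within {0..b})"
  shows "\<exists>C. \<forall>t\<in>{0..b}. L2_norm (f t) \<le> C"
proof -
  have "continuous_on {0..b} (\<lambda>t. L2_norm (f t))"
    unfolding continuous_on_def using L2_tendsto_imp_tendsto_norm assms by blast
  then have "compact ((\<lambda>t. L2_norm (f t)) ` {0..b})"
    by (intro compact_continuous_image) auto
  then have "bounded ((\<lambda>t. L2_norm (f t)) ` {0..b})" by (rule compact_imp_bounded)
  then obtain C where "\<forall>y\<in>(\<lambda>t. L2_norm (f t)) ` {0..b}. norm y \<le> C" unfolding bounded_iff by metis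
  then show ?thesis by (intro exI[of _ C]) auto
qed

lemma L2_quotient_diff:
  assumes "L2_tendsto (\<lambda>s x. (f s x - f t x) / (s - t)) f' F" "L2_tendsto (\<lambda>s x. (g s x - g t x) / (s - t)) g' F"
  shows "L2_tendsto (\<lambda>s x. ((f s x - g s x) - (f t x - g t x)) / (s - t)) (\<lambda>x. f' x - g' x) F"
proof -
  have "(\<lambda>s x. ((f s x - g s x) - (f t x - g t x)) / (s - t))
     = (\<lambda>s x. (f s x - f t x) / (s - t) - (g s x - g t x) / (s - t))"
    by (intro ext) (simp add: diff_divide_distrib)
  then show ?thesis using L2_tendsto_diff[OF assms] by simp
qed

text \<open>The squared norm of the difference of two solutions in \<open>H\<^sup>1 \<times> L\<^sup>2\<close>, one derivative below the regularity of
  the solutions, satisfies a linear differential inequality.\<close>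

lemma hs_solution_unique:
  fixes \<alpha> \<kappa> :: real
  assumes su: "hs_solution \<alpha> \<kappa> h u0 \<rho>0 T u \<rho>" and sv: "hs_solution \<alpha> \<kappa> h u0 \<rho>0 T' v \<sigma>"
    and b: "0 \<le> b" "ereal b < T" "ereal b < T'"
  shows "u b = v b" "\<rho> b = \<sigma> b"
proof -
  define I where "I = {t. 0 \<le> t \<and> ereal t < T}"
  define I' where "I' = {t. 0 \<le> t \<and> ereal t < T'}"
  have sub: "{0..b} \<subseteq> I" "{0..b} \<subseteq> I'"
    using b unfolding I_def I'_def by (auto intro: le_less_trans[of "ereal _" "ereal b"])
  then have mem: "t \<in> I" "t \<in> I'" if "t \<in> {0..b}" for t using that by auto
  have filt: "at t within {0..b} \<le> at t within I" "at t within {0..b} \<le> at t within I'" for t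
    using sub by (auto intro: at_le)
  obtain ux uxx \<rho>x ut utx \<rho>t where
    dat: "hs_data \<alpha> \<kappa> h I u \<rho> ux uxx \<rho>x ut utx \<rho>t"
    by (rule hs_solution_data[OF su, folded I_def])
  note U = hs_dataD(1-5)[OF dat] and cU = hs_dataD(6-10)[OF dat] and dU = hs_dataD(11-13)[OF dat]
    and eU = hs_dataD(14-16)[OF dat]
  obtain vx vxx \<sigma>x vt vtx \<sigma>t where
    dat': "hs_data \<alpha> \<kappa> h I' v \<sigma> vx vxx \<sigma>x vt vtx \<sigma>t"
    by (rule hs_solution_data[OF sv, folded I'_def])
  note V = hs_dataD(1-5)[OF dat'] and cV = hs_dataD(6-10)[OF dat'] and dV = hs_dataD(11-13)[OF dat']
    and eV = hs_dataD(14-16)[OF dat']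
  \<comment> \<open>Continuity in time bounds all norms on the compact interval \<open>[0,b]\<close>.\<close>
  have bnd: "\<exists>C. \<forall>t\<in>{0..b}. L2_norm (f t) \<le> C"
    if f: "\<And>t. t \<in> J \<Longrightarrow> L2_tendsto f (f t) (at t within J)" and J: "{0..b} \<subseteq> J" for f J
  proof -
    have "L2_tendsto f (f t) (at t within {0..b})" if "t \<in> {0..b}" for t
      by (rule L2_tendsto_mono[OF f at_le[OF J]]) (use J that in auto)
    then show ?thesis by (rule L2_continuous_bounded)
  qed
  obtain c1 c2 c3 c4 c5 where CU: "\<forall>t\<in>{0..b}. L2_norm (u t) \<le> c1" "\<forall>t\<in>{0..b}. L2_norm (ux t) \<le> c2"
     "\<forall>t\<in>{0..b}. L2_norm (uxx t) \<le> c3" "\<forall>t\<in>{0..b}. L2_norm (\<rho> t) \<le> c4" "\<forall>t\<in>{0..b}. L2_norm (\<rho>x t) \<le> c5"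
    using bnd[OF cU(1) sub(1)] bnd[OF cU(2) sub(1)] bnd[OF cU(3) sub(1)] bnd[OF cU(4) sub(1)] bnd[OF cU(5) sub(1)]
    by blast
  obtain d2 d3 d4 d5 where CV: "\<forall>t\<in>{0..b}. L2_norm (vx t) \<le> d2"
     "\<forall>t\<in>{0..b}. L2_norm (vxx t) \<le> d3" "\<forall>t\<in>{0..b}. L2_norm (\<sigma> t) \<le> d4" "\<forall>t\<in>{0..b}. L2_norm (\<sigma>x t) \<le> d5"
    using bnd[OF cV(2) sub(2)] bnd[OF cV(3) sub(2)] bnd[OF cV(4) sub(2)] bnd[OF cV(5) sub(2)]
    by blast
  have cpos: "0 \<le> c1" "0 \<le> c2" "0 \<le> c3" "0 \<le> c4" "0 \<le> c5" "0 \<le> d2" "0 \<le> d3" "0 \<le> d4" "0 \<le> d5"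
    using b(1) by (auto intro!: order_trans[OF L2_norm_nonneg CU(1)[THEN bspec, of 0]]
      order_trans[OF L2_norm_nonneg CU(2)[THEN bspec, of 0]] order_trans[OF L2_norm_nonneg CU(3)[THEN bspec, of 0]]
      order_trans[OF L2_norm_nonneg CU(4)[THEN bspec, of 0]] order_trans[OF L2_norm_nonneg CU(5)[THEN bspec, of 0]]
      order_trans[OF L2_norm_nonneg CV(1)[THEN bspec, of 0]] order_trans[OF L2_norm_nonneg CV(2)[THEN bspec, of 0]]
      order_trans[OF L2_norm_nonneg CV(3)[THEN bspec, of 0]] order_trans[OF L2_norm_nonneg CV(4)[THEN bspec, of 0]])
  define M where "M = c1 + c2 + c3 + c4 + c5 + d2 + d3 + d4 + d5"
  have M: "\<bar>u t x\<bar> \<le> M" "\<bar>ux t x\<bar> \<le> M" "\<bar>vx t x\<bar> \<le> M" "\<bar>\<rho> t x\<bar> \<le> M" "\<bar>\<sigma> t x\<bar> \<le> M"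
      "L2_norm (vxx t) \<le> M" "L2_norm (\<sigma>x t) \<le> M" if t: "t \<in> {0..b}" for t x
  proof -
    note m = mem[OF t]
    note s = H1_deriv_sup[OF U(1)[OF m(1)], of x] H1_deriv_sup[OF U(2)[OF m(1)], of x]
      H1_deriv_sup[OF V(2)[OF m(2)], of x] H1_deriv_sup[OF U(3)[OF m(1)], of x] H1_deriv_sup[OF V(3)[OF m(2)], of x]
    note c = CU[THEN bspec, OF t] CV[THEN bspec, OF t]
    show "\<bar>u t x\<bar> \<le> M" "\<bar>ux t x\<bar> \<le> M" "\<bar>vx t x\<bar> \<le> M" "\<bar>\<rho> t x\<bar> \<le> M" "\<bar>\<sigma> t x\<bar> \<le> M"
      "L2_norm (vxx t) \<le> M" "L2_norm (\<sigma>x t) \<le> M"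
      using s c cpos unfolding M_def by linarith+
  qed
  define w where "w t x = u t x - v t x" for t x
  define wx where "wx t x = ux t x - vx t x" for t x
  define \<tau> where "\<tau> t x = \<rho> t x - \<sigma> t x" for t x
  have sq: "sq_int (w t)" "sq_int (wx t)" "sq_int (\<tau> t)" if "t \<in> {0..b}" for t
    unfolding w_def wx_def \<tau>_def
    by (intro sq_int_diff H1_deriv_sq_int[OF U(1)] H1_deriv_sq_int[OF U(2)] H1_deriv_sq_int[OF U(3)]
      H1_deriv_sq_int[OF V(1)] H1_deriv_sq_int[OF V(2)] H1_deriv_sq_int[OF V(3)] mem that)+
  define E where "E t = (L2_norm (w t))\<^sup>2 + (L2_norm (wx t))\<^sup>2 + (L2_norm (\<tau> t))\<^sup>2" for t
  define E' where "E' t = 2 * (LINT x|circle. w t x * (ut t x - vt t x)) +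
     2 * (LINT x|circle. wx t x * (utx t x - vtx t x)) + 2 * (LINT x|circle. \<tau> t x * (\<rho>t t x - \<sigma>t t x))" for t
  define K where "K = (3 * \<bar>\<kappa>\<bar> + 3 * \<bar>\<alpha> + 2\<bar> + 2 * \<bar>\<alpha>\<bar> + 10) * M"
  have "E b = 0"
  proof (rule gronwall_zero[of b E E' "2 * K"])
    fix t assume t: "t \<in> {0..b}"
    note m = mem[OF t]
    have dw: "L2_tendsto (\<lambda>s x. (w s x - w t x) / (s - t)) (\<lambda>x. ut t x - vt t x) (at t within {0..b})"
      unfolding w_def using m
      by (intro L2_quotient_diff L2_tendsto_mono[OF dU(1) filt(1)] L2_tendsto_mono[OF dV(1) filt(2)])
    have dwx: "L2_tendsto (\<lambda>s x. (wx s x - wx t x) / (s - t)) (\<lambda>x. utx t x - vtx t x) (at t within {0..b})"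
      unfolding wx_def using m
      by (intro L2_quotient_diff L2_tendsto_mono[OF dU(2) filt(1)] L2_tendsto_mono[OF dV(2) filt(2)])
    have d\<tau>: "L2_tendsto (\<lambda>s x. (\<tau> s x - \<tau> t x) / (s - t)) (\<lambda>x. \<rho>t t x - \<sigma>t t x) (at t within {0..b})"
      unfolding \<tau>_def using m
      by (intro L2_quotient_diff L2_tendsto_mono[OF dU(3) filt(1)] L2_tendsto_mono[OF dV(3) filt(2)])
    show "(E has_real_derivative E' t) (at t within {0..b})"
      unfolding E_def E'_def
      by (intro DERIV_add L2_norm_sq_has_derivative dw dwx d\<tau> sq t)
    show "E' t \<le> 2 * K * E t"
      using energy_inequality[OF U(1)[OF m(1)] U(2)[OF m(1)] V(1)[OF m(2)] V(2)[OF m(2)] U(3)[OF m(1)] V(3)[OF m(2)]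
        U(4)[OF m(1)] V(4)[OF m(2)] U(5)[OF m(1)] V(5)[OF m(2)] eU(1)[OF m(1)] eU(2)[OF m(1)]
        eV(1)[OF m(2)] eV(2)[OF m(2)] eU(3)[OF m(1)] eV(3)[OF m(2)] M[OF t]]
      unfolding E_def E'_def K_def w_def wx_def \<tau>_def by (simp add: algebra_simps)
  next
    show "0 \<le> E t" for t by (simp add: E_def)
    have "0 \<in> {0..b}" using b by auto
    note m0 = mem[OF this]
    have uv: "u 0 = v 0" "\<rho> 0 = \<sigma> 0" using su sv by (auto simp: hs_solution_def)
    have "AE x in circle. ux 0 x = vx 0 x"
      using H1_deriv_unique[OF U(1)[OF m0(1)]] V(1)[OF m0(2)] uv by simp
    then have "L2_norm (wx 0) = L2_norm (\<lambda>x. 0)"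
      using sq[OF \<open>0 \<in> {0..b}\<close>] by (intro L2_norm_cong_AE) (auto simp: wx_def sq_int_measurable elim: eventually_mono)
    then show "E 0 = 0" using uv by (simp add: E_def w_def[abs_def] \<tau>_def[abs_def] L2_norm_const)
  qed (rule b(1))
  then have "L2_norm (w b) = 0" "L2_norm (\<tau> b) = 0"
    unfolding E_def by (auto simp: add_nonneg_eq_0_iff)
  moreover have bb: "b \<in> {0..b}" using b by auto
  note m = mem[OF bb]
  ultimately have "AE x in circle. w b x = 0" "AE x in circle. \<tau> b x = 0"
    using L2_norm_eq_0_AE sq[OF bb] by blast+
  then have ae: "AE x in circle. u b x = v b x" "AE x in circle. \<rho> b x = \<sigma> b x"
    by (simp_all add: w_def \<tau>_def)
  show "u b = v b"
    by (intro periodic_AE_eq_imp_eq[OF ae(1)] H1_deriv_continuous[OF U(1)] H1_deriv_continuous[OF V(1)]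
       H1_deriv_periodic[OF U(1)] H1_deriv_periodic[OF V(1)] m)
  show "\<rho> b = \<sigma> b"
    by (intro periodic_AE_eq_imp_eq[OF ae(2)] H1_deriv_continuous[OF U(3)] H1_deriv_continuous[OF V(3)]
       H1_deriv_periodic[OF U(3)] H1_deriv_periodic[OF V(3)] m)
qed


section \<open>Composition with diffeomorphisms of the circle\<close>

lemma absolutely_integrable_iff_integrable:
  fixes f :: "real \<Rightarrow> real"
  shows "S \<in> sets lebesgue \<Longrightarrow> f absolutely_integrable_on S \<longleftrightarrow> integrable (lebesgue_on S) f"
  by (simp add: set_integrable_def integrable_restrict_space)

lemma periodic_integral_translate:
  fixes f :: "real \<Rightarrow> real"
  assumes p: "periodic1 f" and S: "S \<in> sets lebesgue" and f: "f absolutely_integrable_on S"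
  shows "f absolutely_integrable_on ((\<lambda>x. x + of_int k) ` S)"
    "integral ((\<lambda>x. x + of_int k) ` S) f = integral S f"
proof -
  have "(\<lambda>x. \<bar>1\<bar> * f (x + of_int k)) absolutely_integrable_on S \<and> integral S (\<lambda>x. \<bar>1\<bar> * f (x + of_int k)) = integral S f
     \<longleftrightarrow> f absolutely_integrable_on ((\<lambda>x. x + of_int k) ` S) \<and> integral ((\<lambda>x. x + of_int k) ` S) f = integral S f"
    by (rule has_absolute_integral_change_of_variables_1'[OF S])
      (auto intro!: derivative_eq_intros simp: inj_on_def)
  moreover have "(\<lambda>x. \<bar>1\<bar> * f (x + of_int k)) = f" using periodic1_int[OF p] by simp
  ultimately show "f absolutely_integrable_on ((\<lambda>x. x + of_int k) ` S)"
    "integral ((\<lambda>x. x + of_int k) ` S) f = integral S f" using f by auto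
qed

lemma periodic_integral_shift:
  fixes f :: "real \<Rightarrow> real"
  assumes p: "periodic1 f" and f: "f absolutely_integrable_on {0..1}"
  shows "f absolutely_integrable_on {a..a+1}" "integral {a..a+1} f = integral {0..1} f"
proof -
  define c where "c = frac a"
  have c: "0 \<le> c" "c \<le> 1" using frac_01 by (auto simp: c_def)
  have f1: "f absolutely_integrable_on {c..1}" "f absolutely_integrable_on {0..c}"
    using c by (auto intro: absolutely_integrable_on_subinterval[OF f])
  have im: "(\<lambda>x. x + of_int 1) ` {0..c} = {1..c+1}" by (simp add: image_add_atLeastAtMost' add.commute)
  have f2: "f absolutely_integrable_on {1..c+1}" "integral {1..c+1} f = integral {0..c} f"
    using periodic_integral_translate[OF p _ f1(2), of 1] unfolding im by auto
  have un: "{c..1} \<union> {1..c+1} = {c..c+1}" using c by auto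
  have f3: "f absolutely_integrable_on {c..c+1}"
    using absolutely_integrable_Un[OF f1(1) f2(1)] unfolding un .
  then have "integral {c..1} f + integral {1..c+1} f = integral {c..c+1} f"
    using c by (intro Henstock_Kurzweil_Integration.integral_combine set_lebesgue_integral_eq_integral(1)) auto
  moreover have "integral {0..c} f + integral {c..1} f = integral {0..1} f"
    using c f by (intro Henstock_Kurzweil_Integration.integral_combine set_lebesgue_integral_eq_integral(1)) auto
  ultimately have f4: "integral {c..c+1} f = integral {0..1} f" using f2 by simp
  have im2: "(\<lambda>x. x + of_int \<lfloor>a\<rfloor>) ` {c..c+1} = {a..a+1}"
    by (simp add: image_add_atLeastAtMost' c_def frac_def add.commute)
  show "f absolutely_integrable_on {a..a+1}" "integral {a..a+1} f = integral {0..1} f"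
    using periodic_integral_translate[OF p _ f3, of "\<lfloor>a\<rfloor>"] f4 unfolding im2 by auto
qed

text \<open>Orientation-preserving diffeomorphisms of the circle, lifted to the line, together with their derivative.\<close>

definition circle_diffeo :: "(real \<Rightarrow> real) \<Rightarrow> (real \<Rightarrow> real) \<Rightarrow> bool" where
  "circle_diffeo \<psi> \<eta> \<longleftrightarrow> (\<forall>y. (\<psi> has_real_derivative \<eta> y) (at y)) \<and> continuous_on UNIV \<eta> \<and>
     (\<forall>y. \<eta> y > 0) \<and> (\<forall>y. \<psi> (y + 1) = \<psi> y + 1)"

lemma circle_diffeo_continuous: "circle_diffeo \<psi> \<eta> \<Longrightarrow> continuous_on A \<psi>"
  unfolding circle_diffeo_def by (meson DERIV_continuous continuous_at_imp_continuous_on)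

lemma circle_diffeo_deriv_periodic:
  assumes "circle_diffeo \<psi> \<eta>" shows "periodic1 \<eta>"
  unfolding periodic1_def
proof
  fix y
  have "((\<lambda>y. \<psi> (y + 1)) has_real_derivative \<eta> (y + 1)) (at y)"
    using assms DERIV_shift[of \<psi> "\<eta> (y + 1)" y 1] by (simp add: circle_diffeo_def)
  moreover have "((\<lambda>y. \<psi> y + 1) has_real_derivative \<eta> y) (at y)"
    using assms by (auto simp: circle_diffeo_def intro!: derivative_eq_intros)
  ultimately show "\<eta> (y + 1) = \<eta> y" using assms DERIV_unique by (auto simp: circle_diffeo_def)
qed

lemma circle_diffeo_lower_bound:
  assumes "circle_diffeo \<psi> \<eta>"
  obtains \<delta> where "\<delta> > 0" "\<And>y. \<delta> \<le> \<eta> y"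
proof -
  have "continuous_on {0..1} \<eta>" using assms by (auto simp: circle_diffeo_def intro: continuous_on_subset)
  then have "\<exists>x\<in>{0..1}. \<forall>y\<in>{0..1}. \<eta> x \<le> \<eta> y"
    by (intro continuous_attains_inf) auto
  then obtain y0 where y0: "\<And>y. y \<in> {0..1} \<Longrightarrow> \<eta> y0 \<le> \<eta> y" by blast
  have "\<eta> y0 \<le> \<eta> y" for y
    using periodic1_bound[OF circle_diffeo_deriv_periodic[OF assms], of "\<lambda>z. \<eta> y0 \<le> z"] y0 by auto
  then show ?thesis using that assms by (auto simp: circle_diffeo_def)
qed

lemma circle_diffeo_periodic: "circle_diffeo \<psi> \<eta> \<Longrightarrow> periodic1 f \<Longrightarrow> periodic1 (\<lambda>y. f (\<psi> y))"
  by (simp add: circle_diffeo_def periodic1_def)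

lemma circle_diffeo_substitution:
  assumes d: "circle_diffeo \<psi> \<eta>" and p: "periodic1 f" and f: "integrable circle f"
  shows "integrable circle (\<lambda>y. \<eta> y * f (\<psi> y))" "(LINT y|circle. \<eta> y * f (\<psi> y)) = (LINT x|circle. f x)"
proof -
  have der: "(\<psi> has_real_derivative \<eta> y) (at y)" and pos: "\<eta> y > 0" for y using d by (auto simp: circle_diffeo_def)
  have mono: "\<psi> x < \<psi> y" if "x < y" for x y
    using that der pos by (meson DERIV_pos_imp_increasing)
  have mono_le: "\<psi> x \<le> \<psi> y" if "x \<le> y" for x y
    using that mono[of x y] by (cases "x = y") auto
  have inj: "inj_on \<psi> {0..1}"
    using mono by (intro linorder_inj_onI) (auto simp: less_imp_neq)
  have psi1: "\<psi> 1 = \<psi> 0 + 1"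
  proof -
    have "\<psi> (0 + 1) = \<psi> 0 + 1" using d unfolding circle_diffeo_def by blast
    then show ?thesis by simp
  qed
  have "\<psi> ` {0..1} = {\<psi> 0..\<psi> 0 + 1}"
  proof (intro equalityI subsetI)
    fix z assume "z \<in> \<psi> ` {0..1}"
    then obtain y where "0 \<le> y" "y \<le> 1" "z = \<psi> y" by auto
    then show "z \<in> {\<psi> 0..\<psi> 0 + 1}"
      using mono_le[of 0 y] mono_le[of y 1] psi1 by simp
  next
    fix z assume "z \<in> {\<psi> 0..\<psi> 0 + 1}"
    then show "z \<in> \<psi> ` {0..1}"
      using IVT'[of \<psi> 0 z 1] circle_diffeo_continuous[OF d] psi1 by auto
  qed
  moreover have fa: "f absolutely_integrable_on {0..1}"
    using f by (simp add: absolutely_integrable_iff_integrable)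
  ultimately have *: "f absolutely_integrable_on (\<psi> ` {0..1}) \<and> integral (\<psi> ` {0..1}) f = integral {0..1} f"
    using periodic_integral_shift[OF p fa, of "\<psi> 0"] by simp
  have "(\<lambda>y. \<bar>\<eta> y\<bar> * f (\<psi> y)) absolutely_integrable_on {0..1} \<and>
      integral {0..1} (\<lambda>y. \<bar>\<eta> y\<bar> * f (\<psi> y)) = integral {0..1} f"
    by (rule iffD2[OF has_absolute_integral_change_of_variables_1' *])
      (auto intro: has_field_derivative_at_within der inj)
  moreover have "\<bar>\<eta> y\<bar> = \<eta> y" for y using pos[of y] by simp
  ultimately have **: "(\<lambda>y. \<eta> y * f (\<psi> y)) absolutely_integrable_on {0..1}"
      "integral {0..1} (\<lambda>y. \<eta> y * f (\<psi> y)) = integral {0..1} f" by auto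
  then show i: "integrable circle (\<lambda>y. \<eta> y * f (\<psi> y))"
    by (simp add: absolutely_integrable_iff_integrable)
  show "(LINT y|circle. \<eta> y * f (\<psi> y)) = (LINT x|circle. f x)"
    using **(2) lebesgue_integral_eq_integral[OF i] lebesgue_integral_eq_integral[OF f] by simp
qed

text \<open>A lower bound on the derivative of the diffeomorphism bounds the Jacobian of its inverse.\<close>

lemma circle_diffeo_L2:
  assumes d: "circle_diffeo \<psi> \<eta>" and del: "\<delta> > 0" "\<And>y. \<delta> \<le> \<eta> y" and e: "L2_circle e"
  shows "L2_circle (\<lambda>y. e (\<psi> y))" "L2_norm (\<lambda>y. e (\<psi> y)) \<le> L2_norm e / sqrt \<delta>"
proof -
  have pe: "periodic1 e" and se: "sq_int e" using e by (auto simp: L2_circle_iff)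
  have pe2: "periodic1 (\<lambda>x. (e x)\<^sup>2)" using pe by (simp add: periodic1_def)
  have c\<eta>: "continuous_on {0..1} \<eta>" using d by (auto simp: circle_diffeo_def intro: continuous_on_subset)
  have \<eta>0: "\<eta> y \<noteq> 0" for y using del(1) del(2)[of y] by linarith
  have "(\<lambda>y. inverse (\<eta> y) * (\<eta> y * e (\<psi> y))) \<in> borel_measurable circle"
    using circle_diffeo_substitution(1)[OF d pe sq_int_integrable[OF se]] c\<eta> \<eta>0
    by (intro borel_measurable_times continuous_measurable_circle continuous_intros borel_measurable_integrable) auto
  then have m [measurable]: "(\<lambda>y. e (\<psi> y)) \<in> borel_measurable circle"
    using \<eta>0 by (simp add: mult.assoc[symmetric])
  note sub = circle_diffeo_substitution[OF d pe2 sq_int_sq_integrable[OF se]]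
  have le: "(e (\<psi> y))\<^sup>2 \<le> 1 / \<delta> * (\<eta> y * (e (\<psi> y))\<^sup>2)" for y
    using mult_right_mono[OF del(2)[of y], of "(e (\<psi> y))\<^sup>2"] del(1) by (simp add: field_simps)
  have i1: "integrable circle (\<lambda>y. 1 / \<delta> * (\<eta> y * (e (\<psi> y))\<^sup>2))" using sub(1) by simp
  have i2: "integrable circle (\<lambda>y. (e (\<psi> y))\<^sup>2)"
  proof (rule integrable_circle_bound[OF i1])
    fix y show "\<bar>(e (\<psi> y))\<^sup>2\<bar> \<le> \<bar>1 / \<delta> * (\<eta> y * (e (\<psi> y))\<^sup>2)\<bar>"
      unfolding abs_of_nonneg[OF zero_le_power2] by (rule order_trans[OF le abs_ge_self])
  qed simp
  show "L2_circle (\<lambda>y. e (\<psi> y))"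
    using i2 m circle_diffeo_periodic[OF d pe] by (simp add: L2_circle_def)
  have "(LINT y|circle. (e (\<psi> y))\<^sup>2) \<le> (LINT y|circle. 1 / \<delta> * (\<eta> y * (e (\<psi> y))\<^sup>2))"
    by (rule integral_mono[OF i2 i1 le])
  also have "\<dots> = (LINT x|circle. (e x)\<^sup>2) / \<delta>" using sub by simp
  finally show "L2_norm (\<lambda>y. e (\<psi> y)) \<le> L2_norm e / sqrt \<delta>"
    unfolding L2_norm_def real_sqrt_divide[symmetric] by (rule real_sqrt_le_mono)
qed

lemma H1_deriv_compose:
  assumes d: "circle_diffeo \<psi> \<eta>" and fg: "H1_deriv f g"
  shows "H1_deriv (\<lambda>y. f (\<psi> y)) (\<lambda>y. \<eta> y * g (\<psi> y))"
proof -
  obtain \<delta> where del: "\<delta> > 0" "\<And>y. \<delta> \<le> \<eta> y" using circle_diffeo_lower_bound[OF d] by blast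
  obtain F G where FG: "\<And>n. C1_periodic (F n) (G n)" "uniform_limit UNIV F f sequentially"
     "L2_tendsto G g sequentially" using H1_derivE[OF fg] by blast
  have L: "L2_circle (\<lambda>x. G n x - g x)" "L2_circle (G n)" for n
    using C1_periodic_sq_int[OF FG(1)] C1_periodic_deriv_periodic[OF FG(1)] H1_deriv_L2[OF fg]
    by (auto simp: L2_circle_iff periodic1_def)
  have c\<eta>: "continuous_on A \<eta>" for A using d by (auto simp: circle_diffeo_def intro: continuous_on_subset)
  have Lg: "L2_circle (\<lambda>y. g (\<psi> y))" using circle_diffeo_L2[OF d del H1_deriv_L2(1)[OF fg]] by simp
  have LG: "L2_circle (\<lambda>y. G n (\<psi> y))" for n using circle_diffeo_L2[OF d del L(2)] by simp
  have "L2_tendsto (\<lambda>n y. G n (\<psi> y)) (\<lambda>y. g (\<psi> y)) sequentially"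
  proof (rule L2_tendstoI_le)
    show "(\<lambda>n. L2_norm (\<lambda>x. G n x - g x) / sqrt \<delta>) \<longlonglongrightarrow> 0"
      using tendsto_divide[OF _ tendsto_const, of "\<lambda>n. L2_norm (\<lambda>x. G n x - g x)" 0 sequentially "sqrt \<delta>"] FG(3) del
      by (simp add: L2_tendsto_def)
    show "\<forall>\<^sub>F n in sequentially. L2_norm (\<lambda>y. G n (\<psi> y) - g (\<psi> y)) \<le> L2_norm (\<lambda>x. G n x - g x) / sqrt \<delta>"
      using circle_diffeo_L2(2)[OF d del L(1)] by simp
  qed (use Lg LG in \<open>auto simp: L2_circle_iff\<close>)
  then have lim: "L2_tendsto (\<lambda>n y. \<eta> y * G n (\<psi> y)) (\<lambda>y. \<eta> y * g (\<psi> y)) sequentially"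
    by (intro L2_tendsto_mult[where a="\<lambda>_. \<eta>"] uniform_limit_const) (auto intro: c\<eta>)
  show ?thesis
    unfolding H1_deriv_def
  proof (intro conjI exI allI)
    show "L2_circle (\<lambda>y. \<eta> y * g (\<psi> y))"
      using Lg c\<eta> circle_diffeo_deriv_periodic[OF d] by (auto simp: L2_circle_iff periodic1_def)
    show "uniform_limit UNIV (\<lambda>n y. F n (\<psi> y)) (\<lambda>y. f (\<psi> y)) sequentially"
      by (rule uniform_limit_compose'[OF FG(2)]) auto
    show "C1_periodic (\<lambda>y. F n (\<psi> y)) (\<lambda>y. \<eta> y * G n (\<psi> y))" for n
      unfolding C1_periodic_def
    proof (intro conjI allI)
      show "periodic1 (\<lambda>y. F n (\<psi> y))" using circle_diffeo_periodic[OF d] FG(1) by (auto simp: C1_periodic_def)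
      show "continuous_on UNIV (\<lambda>y. \<eta> y * G n (\<psi> y))"
        by (intro continuous_intros c\<eta> continuous_on_compose2[OF C1_periodic_continuous(2)[OF FG(1)] circle_diffeo_continuous[OF d]]) auto
      show "((\<lambda>y. F n (\<psi> y)) has_real_derivative \<eta> y * G n (\<psi> y)) (at y)" for y
        using DERIV_chain2[of "F n" "G n (\<psi> y)" \<psi> y "\<eta> y"] FG(1)[of n] d
        by (simp add: C1_periodic_def circle_diffeo_def mult.commute)
    qed
  qed (rule lim)
qed

section \<open>Composition with flows of the circle\<close>

lemma jointly_continuous_slice:
  assumes "continuous_on UNIV (\<lambda>z. a (fst z) (snd z) :: real)"
  shows "continuous_on A (\<lambda>y. a t y)" "continuous_on B (\<lambda>t. a t y)"
proof -
  have "continuous_on A (\<lambda>y. a (fst (t, y)) (snd (t, y)))"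
    by (rule continuous_on_compose2[OF assms]) (auto intro: continuous_intros)
  then show "continuous_on A (\<lambda>y. a t y)" by simp
  have "continuous_on B (\<lambda>t. a (fst (t, y)) (snd (t, y)))"
    by (rule continuous_on_compose2[OF assms]) (auto intro: continuous_intros)
  then show "continuous_on B (\<lambda>t. a t y)" by simp
qed

lemma jointly_continuous_uniform_limit:
  fixes a :: "real \<Rightarrow> real \<Rightarrow> real"
  assumes c: "continuous_on UNIV (\<lambda>z. a (fst z) (snd z))"
  shows "uniform_limit {0..1} a (a t) (at t)"
proof (rule uniform_limitI)
  fix e :: real assume e: "e > 0"
  have "uniformly_continuous_on ({t-1..t+1} \<times> {0..1}) (\<lambda>z. a (fst z) (snd z))"
    by (intro compact_uniformly_continuous continuous_on_subset[OF c] compact_Times) auto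
  then obtain d where d: "d > 0" "\<And>z z'. z \<in> {t-1..t+1} \<times> {0..1} \<Longrightarrow> z' \<in> {t-1..t+1} \<times> {0..1} \<Longrightarrow>
      dist z' z < d \<Longrightarrow> dist (a (fst z') (snd z')) (a (fst z) (snd z)) < e"
    using e unfolding uniformly_continuous_on_def by metis
  have "dist (a s y) (a t y) < e" if "dist s t < min d 1" "y \<in> {0..1}" for s y
  proof -
    have "t - 1 \<le> s" "s \<le> t + 1" using that by (auto simp: dist_real_def)
    then show ?thesis
      using d(2)[of "(t, y)" "(s, y)"] that by (simp add: dist_Pair_Pair)
  qed
  then show "\<forall>\<^sub>F s in at t. \<forall>y\<in>{0..1}. dist (a s y) (a t y) < e"
    unfolding eventually_at using d(1) by (intro exI[of _ "min d 1"]) auto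
qed

lemma uniform_limit_difference_quotient:
  fixes g :: "real \<Rightarrow> real \<Rightarrow> real"
  assumes der: "\<And>s y. ((\<lambda>s. g s y) has_real_derivative g' s y) (at s)"
    and c: "continuous_on UNIV (\<lambda>z. g' (fst z) (snd z))"
  shows "uniform_limit {0..1} (\<lambda>s y. (g s y - g t y) / (s - t)) (g' t) (at t)"
proof (rule uniform_limitI)
  fix e :: real assume e: "e > 0"
  then have "\<forall>\<^sub>F s in at t. \<forall>y\<in>{0..1}. dist (g' s y) (g' t y) < e"
    using jointly_continuous_uniform_limit[OF c] by (auto simp: uniform_limit_iff)
  then obtain d where d: "d > 0" "\<And>s y. s \<noteq> t \<Longrightarrow> dist s t < d \<Longrightarrow> y \<in> {0..1} \<Longrightarrow> dist (g' s y) (g' t y) < e"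
    unfolding eventually_at by auto
  have "dist ((g s y - g t y) / (s - t)) (g' t y) < e" if s: "s \<noteq> t" "dist s t < d" and y: "y \<in> {0..1}" for s y
  proof -
    have "\<exists>x. x \<noteq> t \<and> dist x t < d \<and> (g s y - g t y) / (s - t) = g' x y"
    proof (cases "s < t")
      case True
      obtain x where "s < x" "x < t" "g t y - g s y = (t - s) * g' x y"
        using MVT2[OF True, of "\<lambda>s. g s y" "\<lambda>s. g' s y"] der by blast
      then show ?thesis using s True by (intro exI[of _ x]) (auto simp: dist_real_def field_simps)
    next
      case False
      then have "t < s" using s by simp
      then obtain x where "t < x" "x < s" "g s y - g t y = (s - t) * g' x y"
        using MVT2[of t s "\<lambda>s. g s y" "\<lambda>s. g' s y"] der by blast
      then show ?thesis using s by (intro exI[of _ x]) (auto simp: dist_real_def field_simps)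
    qed
    then show ?thesis using d(2)[OF _ _ y] by metis
  qed
  then show "\<forall>\<^sub>F s in at t. \<forall>y\<in>{0..1}. dist ((g s y - g t y) / (s - t)) (g' t y) < e"
    unfolding eventually_at using d(1) by blast
qed

lemma integral_square_le:
  fixes f :: "real \<Rightarrow> real"
  assumes f: "continuous_on {a..b} f" and ab: "a \<le> b"
  shows "(integral {a..b} f)\<^sup>2 \<le> (b - a) * integral {a..b} (\<lambda>x. (f x)\<^sup>2)"
proof (cases "a = b")
  case False
  then have ab': "b - a > 0" using ab by simp
  define m where "m = integral {a..b} f / (b - a)"
  have "0 \<le> integral {a..b} (\<lambda>x. (f x - m)\<^sup>2)"
    by (intro integral_nonneg integrable_continuous_real continuous_intros f) auto
  also have "(\<lambda>x. (f x - m)\<^sup>2) = (\<lambda>x. (f x)\<^sup>2 + (- 2 * m) * f x + m\<^sup>2)"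
    by (auto simp: power2_diff)
  also have "integral {a..b} \<dots> = integral {a..b} (\<lambda>x. (f x)\<^sup>2) + (- 2 * m) * integral {a..b} f + m\<^sup>2 * (b - a)"
    using ab
    by (subst Henstock_Kurzweil_Integration.integral_add, intro integrable_continuous_real continuous_intros f,
        intro integrable_continuous_real continuous_intros f,
        subst Henstock_Kurzweil_Integration.integral_add, intro integrable_continuous_real continuous_intros f,
        intro integrable_continuous_real continuous_intros f) simp
  also have "\<dots> = integral {a..b} (\<lambda>x. (f x)\<^sup>2) - (integral {a..b} f)\<^sup>2 / (b - a)"
  proof -
    have "m * (b - a) = integral {a..b} f" using ab' by (simp add: m_def)
    then have "m\<^sup>2 * (b - a) = m * integral {a..b} f" by (metis power2_eq_square mult.assoc)
    moreover have "m * integral {a..b} f = (integral {a..b} f)\<^sup>2 / (b - a)" by (simp add: m_def power2_eq_square)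
    ultimately show ?thesis by linarith
  qed
  finally have "(integral {a..b} f)\<^sup>2 / (b - a) \<le> integral {a..b} (\<lambda>x. (f x)\<^sup>2)" by simp
  then show ?thesis using ab' by (simp add: pos_divide_le_eq mult.commute)
qed simp

text \<open>Families of diffeomorphisms with time derivative \<open>\<xi>\<close> and space derivative \<open>\<eta>\<close>. The bound \<open>\<delta>\<close> is uniform in
  time, and so is the resulting bound on the composition operators.\<close>

locale circle_flow =
  fixes \<psi> \<xi> \<eta> :: "real \<Rightarrow> real \<Rightarrow> real" and \<delta> :: real
  assumes diffeo: "\<And>t. circle_diffeo (\<psi> t) (\<eta> t)"
    and delta: "\<delta> > 0" "\<And>t y. \<delta> \<le> \<eta> t y"
    and deriv_t: "\<And>t y. ((\<lambda>t. \<psi> t y) has_real_derivative \<xi> t y) (at t)"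
    and cont: "continuous_on UNIV (\<lambda>z. \<psi> (fst z) (snd z))" "continuous_on UNIV (\<lambda>z. \<xi> (fst z) (snd z))"
      "continuous_on UNIV (\<lambda>z. \<eta> (fst z) (snd z))"
begin

lemma cont_compose:
  "continuous_on UNIV e \<Longrightarrow> continuous_on UNIV (\<lambda>z. e (\<psi> (fst z) (snd z)))"
  by (rule continuous_on_compose2[OF _ cont(1)]) auto

lemma L2_compose: "L2_circle e \<Longrightarrow> L2_circle (\<lambda>y. e (\<psi> t y))"
    "L2_circle e \<Longrightarrow> L2_norm (\<lambda>y. e (\<psi> t y)) \<le> L2_norm e / sqrt \<delta>"
  using circle_diffeo_L2[OF diffeo delta] by auto

lemma L2_compose_sq_int: "L2_circle e \<Longrightarrow> sq_int (\<lambda>y. e (\<psi> t y))"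
  using L2_compose(1) by (auto simp: L2_circle_iff)

text \<open>For continuous functions this is uniform continuity; the general case follows by density, since the
  composition operators are uniformly bounded in the mean.\<close>

lemma L2_tendsto_compose:
  assumes e: "L2_circle e"
  shows "L2_tendsto (\<lambda>s y. e (\<psi> s y)) (\<lambda>y. e (\<psi> t y)) (at t)"
proof (rule L2_tendstoI)
  have pe: "periodic1 e" and se: "sq_int e" using e by (auto simp: L2_circle_iff)
  fix r :: real assume r: "r > 0"
  define r' where "r' = r / 3 * sqrt \<delta>"
  have r': "r' > 0" using r delta by (simp add: r'_def)
  obtain G where G: "\<And>n. continuous_on UNIV (G n)" "\<And>n. periodic1 (G n)" "L2_tendsto G e sequentially"
    using L2_approx_continuous[OF se] by blast
  obtain n where n: "L2_norm (\<lambda>x. G n x - e x) < r'"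
    using L2_tendstoD[OF G(3) r'] by (auto simp: eventually_sequentially)
  define g where "g = G n"
  have g: "continuous_on A g" "periodic1 g" for A using G(1)[of n] G(2)[of n] unfolding g_def by (auto intro: continuous_on_subset)
  have sg: "sq_int g" using g by (intro sq_int_continuous)
  have Lg: "L2_circle g" "L2_circle (\<lambda>x. g x - e x)" using g sg pe se by (auto simp: L2_circle_iff periodic1_def)
  have close: "L2_norm (\<lambda>y. g (\<psi> s y) - e (\<psi> s y)) < r / 3" for s
  proof -
    have "L2_norm (\<lambda>y. g (\<psi> s y) - e (\<psi> s y)) \<le> L2_norm (\<lambda>x. g x - e x) / sqrt \<delta>"
      by (rule L2_compose(2)[OF Lg(2)])
    also have "\<dots> < r' / sqrt \<delta>" using n delta by (intro divide_strict_right_mono) (auto simp: g_def)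
    also have "\<dots> = r / 3" using delta by (simp add: r'_def)
    finally show ?thesis .
  qed
  note sq = L2_compose_sq_int[OF e] L2_compose_sq_int[OF Lg(1)]
  have "L2_tendsto (\<lambda>s y. g (\<psi> s y)) (\<lambda>y. g (\<psi> t y)) (at t)"
    using jointly_continuous_uniform_limit[OF cont_compose[OF g(1)]] sq
    by (intro uniform_limit_imp_L2_tendsto) auto
  then have "\<forall>\<^sub>F s in at t. L2_norm (\<lambda>y. g (\<psi> s y) - g (\<psi> t y)) < r / 3"
    using r L2_tendstoD[of _ _ _ "r / 3"] by (fastforce elim: eventually_mono)
  then show "\<forall>\<^sub>F s in at t. L2_norm (\<lambda>y. e (\<psi> s y) - e (\<psi> t y)) < r"
  proof eventually_elim
    case (elim s)
    have "L2_norm (\<lambda>y. e (\<psi> s y) - e (\<psi> t y)) \<le> L2_norm (\<lambda>y. e (\<psi> s y) - g (\<psi> s y)) + L2_norm (\<lambda>y. g (\<psi> s y) - e (\<psi> t y))"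
      by (intro L2_norm_triangle3 sq)
    also have "L2_norm (\<lambda>y. g (\<psi> s y) - e (\<psi> t y)) \<le> L2_norm (\<lambda>y. g (\<psi> s y) - g (\<psi> t y)) + L2_norm (\<lambda>y. g (\<psi> t y) - e (\<psi> t y))"
      by (intro L2_norm_triangle3 sq)
    finally show ?case
      using close[of s] close[of t] elim L2_norm_minus_commute[of "\<lambda>y. e (\<psi> s y)" "\<lambda>y. g (\<psi> s y)"] by linarith
  qed
qed (use L2_compose_sq_int[OF e] in auto)

lemma speed_bound:
  obtains X where "\<And>s y. t - 1 \<le> s \<Longrightarrow> s \<le> t + 1 \<Longrightarrow> 0 \<le> y \<Longrightarrow> y \<le> 1 \<Longrightarrow> \<bar>\<xi> s y\<bar> \<le> X" "0 \<le> X"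
proof -
  have "compact ((\<lambda>z. \<xi> (fst z) (snd z)) ` ({t-1..t+1} \<times> {0..1}))"
    by (intro compact_continuous_image continuous_on_subset[OF cont(2)] compact_Times) auto
  then have "bounded ((\<lambda>z. \<xi> (fst z) (snd z)) ` ({t-1..t+1} \<times> {0..1}))" by (rule compact_imp_bounded)
  then obtain X where "\<forall>w\<in>(\<lambda>z. \<xi> (fst z) (snd z)) ` ({t-1..t+1} \<times> {0..1}). norm w \<le> X"
    unfolding bounded_iff by metis
  then have X: "\<bar>\<xi> s y\<bar> \<le> X" if "t - 1 \<le> s" "s \<le> t + 1" "0 \<le> y" "y \<le> 1" for s y using that by force
  moreover have "0 \<le> X" using X[of t 0] by auto
  ultimately show ?thesis using that by blast
qed

text \<open>No norm of \<open>E\<close> other than the mean square of its derivative enters, so that the bound survives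
  the passage to \<open>H\<^sup>1\<close>.\<close>

lemma C1_increment_bound:
  assumes E: "C1_periodic E e" and ab: "a \<le> b"
    and X: "\<And>s y. a \<le> s \<Longrightarrow> s \<le> b \<Longrightarrow> 0 \<le> y \<Longrightarrow> y \<le> 1 \<Longrightarrow> \<bar>\<xi> s y\<bar> \<le> X"
  shows "L2_norm (\<lambda>y. E (\<psi> b y) - E (\<psi> a y)) \<le> (b - a) * (X / sqrt \<delta> * L2_norm e)"
proof -
  have X0: "0 \<le> X" using X[of a 0] ab by auto
  note cE = C1_periodic_continuous(1)[OF E, of UNIV]
  note ce = C1_periodic_continuous(2)[OF E, of UNIV]
  have Le: "L2_circle e" using C1_periodic_sq_int[OF E] C1_periodic_deriv_periodic[OF E] by (simp add: L2_circle_iff)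
  define g where "g s y = (e (\<psi> s y))\<^sup>2" for s y
  have cg: "continuous_on UNIV (\<lambda>z. g (fst z) (snd z))"
    unfolding g_def by (intro continuous_intros cont_compose ce)
  have pt: "(E (\<psi> b y) - E (\<psi> a y))\<^sup>2 \<le> (b - a) * X\<^sup>2 * integral {a..b} (\<lambda>s. g s y)" if y: "0 \<le> y" "y \<le> 1" for y
  proof -
    have cf: "continuous_on {a..b} (\<lambda>s. e (\<psi> s y) * \<xi> s y)"
      by (intro continuous_intros jointly_continuous_slice(2)[OF cont(2)]
          jointly_continuous_slice(2)[of "\<lambda>s y. e (\<psi> s y)", OF cont_compose[OF ce]])
    have "((\<lambda>s. e (\<psi> s y) * \<xi> s y) has_integral (E (\<psi> b y) - E (\<psi> a y))) {a..b}"
    proof (rule fundamental_theorem_of_calculus[OF ab])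
      fix s
      have "((\<lambda>s. E (\<psi> s y)) has_real_derivative e (\<psi> s y) * \<xi> s y) (at s)"
        using E by (intro DERIV_chain2[OF _ deriv_t]) (auto simp: C1_periodic_def)
      then show "((\<lambda>s. E (\<psi> s y)) has_vector_derivative e (\<psi> s y) * \<xi> s y) (at s within {a..b})"
        by (simp add: has_real_derivative_iff_has_vector_derivative has_vector_derivative_at_within)
    qed
    then have "(E (\<psi> b y) - E (\<psi> a y))\<^sup>2 = (integral {a..b} (\<lambda>s. e (\<psi> s y) * \<xi> s y))\<^sup>2"
      by (simp add: integral_unique)
    also have "\<dots> \<le> (b - a) * integral {a..b} (\<lambda>s. (e (\<psi> s y) * \<xi> s y)\<^sup>2)"
      by (rule integral_square_le[OF cf ab])
    also have "\<dots> \<le> (b - a) * integral {a..b} (\<lambda>s. X\<^sup>2 * g s y)"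
    proof (intro mult_left_mono integral_le)
      show "(\<lambda>s. (e (\<psi> s y) * \<xi> s y)\<^sup>2) integrable_on {a..b}"
        by (intro integrable_continuous_real continuous_intros cf)
      show "(\<lambda>s. X\<^sup>2 * g s y) integrable_on {a..b}"
        by (intro integrable_continuous_real continuous_intros jointly_continuous_slice(2)[OF cg])
      show "(e (\<psi> s y) * \<xi> s y)\<^sup>2 \<le> X\<^sup>2 * g s y" if "s \<in> {a..b}" for s
      proof -
        have "(\<xi> s y)\<^sup>2 \<le> X\<^sup>2" using X[of s y] that y X0 by (simp add: abs_le_square_iff[symmetric])
        then show ?thesis unfolding g_def power_mult_distrib by (subst mult.commute) (rule mult_right_mono, auto)
      qed
    qed (use ab in simp)
    finally show ?thesis by (simp add: mult.assoc)
  qed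
  have "continuous_on UNIV (\<lambda>z :: real \<times> real. (snd z, fst z))" by (intro continuous_intros)
  from continuous_on_compose2[OF cg this]
  have cg': "continuous_on UNIV (\<lambda>z. g (snd z) (fst z))" by simp
  have sw: "integral {0..1} (\<lambda>y. integral {a..b} (\<lambda>s. g s y)) = integral {a..b} (\<lambda>s. integral {0..1} (\<lambda>y. g s y))"
    using integral_swap_continuous[of 0 a 1 b "\<lambda>y s. g s y"] continuous_on_subset[OF cg', of "cbox (0,a) (1,b)"]
    by (simp add: case_prod_unfold)
  have cI: "continuous_on {0..1} (\<lambda>y. integral {a..b} (\<lambda>s. g s y))"
    using integral_continuous_on_param[of "{0..1}" a b "\<lambda>y s. g s y"] continuous_on_subset[OF cg', of "{0..1} \<times> cbox a b"]
    by (simp add: case_prod_unfold)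
  have inner: "integral {0..1} (\<lambda>y. g s y) \<le> (L2_norm e)\<^sup>2 / \<delta>" for s
  proof -
    have "integral {0..1} (\<lambda>y. g s y) = (L2_norm (\<lambda>y. e (\<psi> s y)))\<^sup>2"
      unfolding L2_norm_sq g_def[symmetric]
      by (intro lebesgue_integral_eq_integral[symmetric] continuous_integrable_circle jointly_continuous_slice(1)[OF cg]) auto
    also have "\<dots> \<le> (L2_norm e / sqrt \<delta>)\<^sup>2" by (intro power_mono L2_compose(2)[OF Le]) auto
    finally show ?thesis using delta by (simp add: power_divide)
  qed
  have cD: "continuous_on {0..1} (\<lambda>y. (E (\<psi> b y) - E (\<psi> a y))\<^sup>2)"
    by (intro continuous_intros jointly_continuous_slice(1)[of "\<lambda>s y. E (\<psi> s y)", OF cont_compose[OF cE]])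
  have "(L2_norm (\<lambda>y. E (\<psi> b y) - E (\<psi> a y)))\<^sup>2 = integral {0..1} (\<lambda>y. (E (\<psi> b y) - E (\<psi> a y))\<^sup>2)"
    unfolding L2_norm_sq by (intro lebesgue_integral_eq_integral continuous_integrable_circle cD) auto
  also have "\<dots> \<le> integral {0..1} (\<lambda>y. (b - a) * X\<^sup>2 * integral {a..b} (\<lambda>s. g s y))"
    by (intro integral_le integrable_continuous_real cD continuous_intros cI) (use pt in auto)
  also have "\<dots> = (b - a) * X\<^sup>2 * integral {a..b} (\<lambda>s. integral {0..1} (\<lambda>y. g s y))"
    using sw by simp
  also have "\<dots> \<le> (b - a) * X\<^sup>2 * integral {a..b} (\<lambda>s. (L2_norm e)\<^sup>2 / \<delta>)"
  proof (intro mult_left_mono integral_le)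
    show "(\<lambda>s. integral {0..1} (\<lambda>y. g s y)) integrable_on {a..b}"
      using integral_continuous_on_param[of "{a..b}" 0 1 "\<lambda>s y. g s y"] continuous_on_subset[OF cg, of "{a..b} \<times> cbox 0 1"]
      by (intro integrable_continuous_real) (auto simp: case_prod_unfold)
  qed (use inner ab in \<open>auto intro: integrable_const_ivl\<close>)
  also have "\<dots> = ((b - a) * (X / sqrt \<delta> * L2_norm e))\<^sup>2"
    using ab delta by (simp add: power_mult_distrib power_divide) (simp add: power2_eq_square)
  finally show ?thesis
    by (rule power2_le_imp_le) (use ab X0 delta in auto)
qed

lemma H1_increment_bound:
  assumes E: "H1_deriv E e" and ab: "a \<le> b"
    and X: "\<And>s y. a \<le> s \<Longrightarrow> s \<le> b \<Longrightarrow> 0 \<le> y \<Longrightarrow> y \<le> 1 \<Longrightarrow> \<bar>\<xi> s y\<bar> \<le> X"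
  shows "L2_norm (\<lambda>y. E (\<psi> b y) - E (\<psi> a y)) \<le> (b - a) * (X / sqrt \<delta> * L2_norm e)"
proof -
  obtain F G where FG: "\<And>n. C1_periodic (F n) (G n)" "uniform_limit UNIV F E sequentially"
     "L2_tendsto G e sequentially" using H1_derivE[OF E] by blast
  have cc: "continuous_on A (\<lambda>y. f (\<psi> t y))" if "continuous_on UNIV f" for f :: "real \<Rightarrow> real" and t A
    using jointly_continuous_slice(1)[of "\<lambda>s y. f (\<psi> s y)", OF cont_compose[OF that]] .
  have "uniform_limit {0..1} (\<lambda>n y. F n (\<psi> t y)) (\<lambda>y. E (\<psi> t y)) sequentially" for t
    by (rule uniform_limit_compose'[OF FG(2)]) auto
  then have "L2_tendsto (\<lambda>n y. F n (\<psi> b y) - F n (\<psi> a y)) (\<lambda>y. E (\<psi> b y) - E (\<psi> a y)) sequentially"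
    by (intro uniform_limit_imp_L2_tendsto uniform_limit_minus always_eventually allI sq_int_continuous
        continuous_intros cc C1_periodic_continuous[OF FG(1)] H1_deriv_continuous[OF E]) auto
  from L2_tendsto_imp_tendsto_norm[OF this]
  have 1: "(\<lambda>n. L2_norm (\<lambda>y. F n (\<psi> b y) - F n (\<psi> a y))) \<longlonglongrightarrow> L2_norm (\<lambda>y. E (\<psi> b y) - E (\<psi> a y))" .
  have 2: "(\<lambda>n. (b - a) * (X / sqrt \<delta> * L2_norm (G n))) \<longlonglongrightarrow> (b - a) * (X / sqrt \<delta> * L2_norm e)"
    by (intro tendsto_intros L2_tendsto_imp_tendsto_norm FG)
  show ?thesis
    by (rule LIMSEQ_le[OF 1 2]) (use C1_increment_bound[OF FG(1) ab X] in auto)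
qed

text \<open>For continuously differentiable functions the difference quotients converge uniformly. The
  increment bound makes the error of approximating \<open>k\<close> by such functions small uniformly in \<open>s\<close>.\<close>

lemma L2_difference_quotient_compose:
  assumes k: "H1_deriv k k'"
  shows "L2_tendsto (\<lambda>s y. (k (\<psi> s y) - k (\<psi> t y)) / (s - t)) (\<lambda>y. \<xi> t y * k' (\<psi> t y)) (at t)"
proof (rule L2_tendstoI)
  have cc: "continuous_on A (\<lambda>y. f (\<psi> t y))" if "continuous_on UNIV f" for f :: "real \<Rightarrow> real" and t A
    using jointly_continuous_slice(1)[of "\<lambda>s y. f (\<psi> s y)", OF cont_compose[OF that]] .
  have c\<xi>: "continuous_on A (\<xi> t)" for A using jointly_continuous_slice(1)[OF cont(2)] .
  have sqk: "sq_int (\<lambda>y. (k (\<psi> s y) - k (\<psi> t y)) / (s - t))" for s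
    by (intro sq_int_divide sq_int_continuous continuous_intros cc H1_deriv_continuous[OF k])
  then show "\<forall>\<^sub>F s in at t. sq_int (\<lambda>y. (k (\<psi> s y) - k (\<psi> t y)) / (s - t))" by simp
  show sq': "sq_int (\<lambda>y. \<xi> t y * k' (\<psi> t y))"
    by (intro sq_int_mult_continuous c\<xi> L2_compose_sq_int H1_deriv_L2(1)[OF k])
  obtain X where X: "\<And>s y. t - 1 \<le> s \<Longrightarrow> s \<le> t + 1 \<Longrightarrow> 0 \<le> y \<Longrightarrow> y \<le> 1 \<Longrightarrow> \<bar>\<xi> s y\<bar> \<le> X" "0 \<le> X"
    using speed_bound[of t] by blast
  define C where "C = X / sqrt \<delta>"
  have C: "0 \<le> C" using X delta by (simp add: C_def)
  have inc: "L2_norm (\<lambda>y. (E (\<psi> s y) - E (\<psi> t y)) / (s - t)) \<le> C * L2_norm e"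
    if "H1_deriv E e" "\<bar>s - t\<bar> \<le> 1" "s \<noteq> t" for E e s
  proof -
    have "L2_norm (\<lambda>y. E (\<psi> s y) - E (\<psi> t y)) \<le> \<bar>s - t\<bar> * (C * L2_norm e)"
    proof (cases "s \<le> t")
      case True
      have "L2_norm (\<lambda>y. E (\<psi> t y) - E (\<psi> s y)) \<le> (t - s) * (X / sqrt \<delta> * L2_norm e)"
        by (rule H1_increment_bound[OF that(1) True X(1)]) (use that in auto)
      then show ?thesis using True L2_norm_minus_commute[of "\<lambda>y. E (\<psi> s y)" "\<lambda>y. E (\<psi> t y)"] by (simp add: C_def)
    next
      case False
      then have "t \<le> s" by simp
      have "L2_norm (\<lambda>y. E (\<psi> s y) - E (\<psi> t y)) \<le> (s - t) * (X / sqrt \<delta> * L2_norm e)"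
        by (rule H1_increment_bound[OF that(1) \<open>t \<le> s\<close> X(1)]) (use that in auto)
      then show ?thesis using False by (simp add: C_def)
    qed
    moreover have "L2_norm (\<lambda>y. (E (\<psi> s y) - E (\<psi> t y)) / (s - t)) = L2_norm (\<lambda>y. E (\<psi> s y) - E (\<psi> t y)) / \<bar>s - t\<bar>"
      using L2_norm_cmult[of "1 / (s - t)" "\<lambda>y. E (\<psi> s y) - E (\<psi> t y)"] by simp
    ultimately show ?thesis using that by (simp add: divide_le_eq mult.commute)
  qed
  fix r :: real assume r: "r > 0"
  obtain F G where FG: "\<And>n. C1_periodic (F n) (G n)" "uniform_limit UNIV F k sequentially"
     "L2_tendsto G k' sequentially" using H1_derivE[OF k] by blast
  define r' where "r' = r / (3 * (C + 1))"
  have r': "r' > 0" using r C by (simp add: r'_def)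
  obtain n where n: "L2_norm (\<lambda>x. G n x - k' x) < r'"
    using L2_tendstoD[OF FG(3) r'] by (auto simp: eventually_sequentially)
  have Cr: "C * L2_norm (\<lambda>x. G n x - k' x) < r / 3"
  proof -
    have "C * L2_norm (\<lambda>x. G n x - k' x) \<le> C * r'" using n C by (intro mult_left_mono) auto
    also have "\<dots> < (C + 1) * r'" using r' by simp
    also have "\<dots> = r / 3" using C by (simp add: r'_def field_simps)
    finally show ?thesis .
  qed
  define E e where "E = F n" and "e = G n"
  have Ee: "C1_periodic E e" using FG(1) by (simp add: E_def e_def)
  have R: "H1_deriv (\<lambda>x. k x - E x) (\<lambda>x. k' x - e x)"
    by (intro H1_deriv_diff k C1_periodic_imp_H1_deriv Ee)
  note cE = C1_periodic_continuous(1)[OF Ee, of UNIV] and ce = C1_periodic_continuous(2)[OF Ee, of UNIV]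
  have "uniform_limit {0..1} (\<lambda>s y. (E (\<psi> s y) - E (\<psi> t y)) / (s - t)) (\<lambda>y. e (\<psi> t y) * \<xi> t y) (at t)"
  proof (rule uniform_limit_difference_quotient)
    show "((\<lambda>s. E (\<psi> s y)) has_real_derivative e (\<psi> s y) * \<xi> s y) (at s)" for s y
      using Ee by (intro DERIV_chain2[OF _ deriv_t]) (auto simp: C1_periodic_def)
    show "continuous_on UNIV (\<lambda>z. e (\<psi> (fst z) (snd z)) * \<xi> (fst z) (snd z))"
      by (intro continuous_intros cont_compose ce cont)
  qed
  then have "L2_tendsto (\<lambda>s y. (E (\<psi> s y) - E (\<psi> t y)) / (s - t)) (\<lambda>y. e (\<psi> t y) * \<xi> t y) (at t)"
    by (rule uniform_limit_imp_L2_tendsto)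
      (intro always_eventually allI sq_int_divide sq_int_continuous continuous_intros cc cE ce c\<xi>)+
  then have "\<forall>\<^sub>F s in at t. L2_norm (\<lambda>y. (E (\<psi> s y) - E (\<psi> t y)) / (s - t) - e (\<psi> t y) * \<xi> t y) < r / 3"
    using r L2_tendstoD[of _ _ _ "r / 3"] by (fastforce elim: eventually_mono)
  moreover have "\<forall>\<^sub>F s in at t. s \<noteq> t \<and> \<bar>s - t\<bar> \<le> 1"
    unfolding eventually_at by (intro exI[of _ 1]) (auto simp: dist_real_def)
  ultimately show "\<forall>\<^sub>F s in at t. L2_norm (\<lambda>y. (k (\<psi> s y) - k (\<psi> t y)) / (s - t) - \<xi> t y * k' (\<psi> t y)) < r"
  proof eventually_elim
    case (elim s)
    define q1 where "q1 y = ((k (\<psi> s y) - E (\<psi> s y)) - (k (\<psi> t y) - E (\<psi> t y))) / (s - t)" for y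
    define q2 where "q2 y = (E (\<psi> s y) - E (\<psi> t y)) / (s - t) - e (\<psi> t y) * \<xi> t y" for y
    define q3 where "q3 y = \<xi> t y * (e (\<psi> t y) - k' (\<psi> t y))" for y
    have "L2_circle (\<lambda>x. e x - k' x)"
      using C1_periodic_sq_int[OF Ee] C1_periodic_deriv_periodic[OF Ee] H1_deriv_L2[OF k]
      by (auto simp: L2_circle_iff periodic1_def)
    note Lek = L2_compose_sq_int[OF this] L2_compose(2)[OF this]
    have sq1: "sq_int q1" unfolding q1_def
      by (intro sq_int_divide sq_int_continuous continuous_on_diff cc cE H1_deriv_continuous[OF k])
    have sq2: "sq_int q2" unfolding q2_def
      by (intro sq_int_diff sq_int_divide sq_int_continuous continuous_on_diff continuous_on_mult cc cE ce c\<xi>)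
    have sq3: "sq_int q3" unfolding q3_def by (rule sq_int_mult_continuous[OF c\<xi> Lek(1)])
    note sq = sq1 sq2 sq3
    have "L2_norm q1 \<le> C * L2_norm (\<lambda>x. k' x - e x)"
      unfolding q1_def using inc[OF R, of s] elim by auto
    then have n1: "L2_norm q1 < r / 3"
      using Cr L2_norm_minus_commute[of k' e] by (simp add: e_def)
    have "L2_norm q3 \<le> X * L2_norm (\<lambda>y. e (\<psi> t y) - k' (\<psi> t y))"
      unfolding q3_def using X(1)[of t] by (intro L2_norm_mult_le Lek continuous_measurable_circle c\<xi>) auto
    also have "\<dots> \<le> X * (L2_norm (\<lambda>x. e x - k' x) / sqrt \<delta>)" using X(2) Lek(2) by (intro mult_left_mono)
    also have "\<dots> = C * L2_norm (\<lambda>x. G n x - k' x)" by (simp add: C_def e_def)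
    finally have n3: "L2_norm q3 < r / 3" using Cr by linarith
    have "(\<lambda>y. (k (\<psi> s y) - k (\<psi> t y)) / (s - t) - \<xi> t y * k' (\<psi> t y)) = (\<lambda>y. (q1 y + q2 y) + q3 y)"
      by (intro ext) (simp add: q1_def q2_def q3_def diff_divide_distrib add_divide_distrib algebra_simps)
    then have "L2_norm (\<lambda>y. (k (\<psi> s y) - k (\<psi> t y)) / (s - t) - \<xi> t y * k' (\<psi> t y)) \<le> L2_norm q1 + L2_norm q2 + L2_norm q3"
      using L2_norm_triangle[OF sq_int_add[OF sq(1,2)] sq(3)] L2_norm_triangle[OF sq(1,2)] by simp
    then show ?case using n1 n3 elim unfolding q2_def by linarith
  qed
qed

text \<open>Both the function and the point at which it is evaluated move: the total derivative along the flow.\<close>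

lemma L2_difference_quotient_compose_time:
  assumes G: "\<And>t. H1_deriv (G t) (Gx t)"
    and Gt: "\<And>s x. ((\<lambda>s. G s x) has_real_derivative Gt s x) (at s)" "\<And>t. periodic1 (Gt t)"
    and c: "continuous_on UNIV (\<lambda>z. Gt (fst z) (snd z))"
  shows "L2_tendsto (\<lambda>s y. (G s (\<psi> s y) - G t (\<psi> t y)) / (s - t))
     (\<lambda>y. Gt t (\<psi> t y) + \<xi> t y * Gx t (\<psi> t y)) (at t)"
proof -
  have cc: "continuous_on A (\<lambda>y. f (\<psi> t y))" if "continuous_on UNIV f" for f :: "real \<Rightarrow> real" and t A
    using jointly_continuous_slice(1)[of "\<lambda>s y. f (\<psi> s y)", OF cont_compose[OF that]] .
  have cGt: "continuous_on UNIV (Gt t)" using jointly_continuous_slice(1)[OF c] .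
  have "uniform_limit {0..1} (\<lambda>s y. (G s (\<psi> s y) - G t (\<psi> s y)) / (s - t)) (\<lambda>y. Gt t (\<psi> t y)) (at t)"
  proof (rule uniform_limitI)
    fix r :: real assume r: "r > 0"
    have "\<forall>\<^sub>F s in at t. \<forall>x\<in>{0..1}. dist ((G s x - G t x) / (s - t)) (Gt t x) < r / 2"
      using uniform_limit_difference_quotient[OF Gt(1) c] r unfolding uniform_limit_iff by (meson half_gt_zero)
    moreover have "\<forall>\<^sub>F s in at t. \<forall>y\<in>{0..1}. dist (Gt t (\<psi> s y)) (Gt t (\<psi> t y)) < r / 2"
      using jointly_continuous_uniform_limit[of "\<lambda>s y. Gt t (\<psi> s y)", OF cont_compose[OF cGt]] r
      unfolding uniform_limit_iff by (meson half_gt_zero)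
    ultimately show "\<forall>\<^sub>F s in at t. \<forall>y\<in>{0..1}. dist ((G s (\<psi> s y) - G t (\<psi> s y)) / (s - t)) (Gt t (\<psi> t y)) < r"
    proof eventually_elim
      case (elim s)
      show ?case
      proof
        fix y :: real assume y: "y \<in> {0..1}"
        have "dist ((G s (frac x) - G t (frac x)) / (s - t)) (Gt t (frac x)) < r / 2" for x
          using elim(1) frac_01[of x] by simp
        then have "dist ((G s x - G t x) / (s - t)) (Gt t x) < r / 2" for x
          using periodic1_frac[OF H1_deriv_periodic[OF G]] periodic1_frac[OF Gt(2)] by simp
        from this[of "\<psi> s y"] elim(2)[rule_format, OF y]
        show "dist ((G s (\<psi> s y) - G t (\<psi> s y)) / (s - t)) (Gt t (\<psi> t y)) < r"
          by (intro le_less_trans[OF dist_triangle[of _ _ "Gt t (\<psi> s y)"]]) linarith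
      qed
    qed
  qed
  then have "L2_tendsto (\<lambda>s y. (G s (\<psi> s y) - G t (\<psi> s y)) / (s - t)) (\<lambda>y. Gt t (\<psi> t y)) (at t)"
    by (rule uniform_limit_imp_L2_tendsto)
      (intro always_eventually allI sq_int_divide sq_int_continuous continuous_intros cc cGt H1_deriv_continuous[OF G])+
  from L2_tendsto_add[OF this L2_difference_quotient_compose[OF G[of t], of t]]
  show ?thesis by (simp add: add_divide_distrib[symmetric])
qed

end


section \<open>A global existence theorem for scalar equations of second order\<close>

lemma FTC_has_integral:
  fixes F f :: "real \<Rightarrow> real"
  assumes "\<And>x. (F has_real_derivative f x) (at x)" "a \<le> b"
  shows "(f has_integral (F b - F a)) {a..b}"
  by (rule fundamental_theorem_of_calculus[OF assms(2)])
    (simp add: has_vector_derivative_at_within assms(1)[unfolded has_real_derivative_iff_has_vector_derivative])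

text \<open>Picard iteration in a space with exponential weight: for a weight \<open>exp (- L t)\<close> the double
  integral has norm at most \<open>1 / L\<^sup>2\<close>, so that one application of the contraction principle covers
  the whole half-line.\<close>

lemma second_order_ode_global:
  fixes F :: "real \<Rightarrow> real \<Rightarrow> real"
  assumes cont: "continuous_on UNIV (\<lambda>z. F (fst z) (snd z))"
    and bound: "\<And>t x. \<bar>F t x\<bar> \<le> B" and lip: "\<And>t x y. \<bar>F t x - F t y\<bar> \<le> K * \<bar>x - y\<bar>"
  obtains z z' where "z 0 = 0" "z' 0 = 0" "\<And>t. (z has_real_derivative z' t) (at t)"
    "\<And>t. (z' has_real_derivative F (max 0 t) (z (max 0 t))) (at t)"
proof -
  have K0: "0 \<le> K" using lip[of 0 1 0] by (auto intro: order_trans[OF abs_ge_zero])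
  have B0: "0 \<le> B" using bound[of 0 0] by linarith
  define L where "L = K + 1"
  have L: "L > 0" "L \<ge> 1" "K / L\<^sup>2 \<le> 1 / 2"
  proof -
    show "L > 0" "L \<ge> 1" using K0 by (auto simp: L_def)
    have "2 * K \<le> (K + 1)\<^sup>2" by (simp add: power2_sum)
    then show "K / L\<^sup>2 \<le> 1 / 2" using K0 by (simp add: L_def divide_le_eq)
  qed
  define I1 where "I1 f s = integral {0..s} f" for f :: "real \<Rightarrow> real" and s :: real
  define I2 where "I2 f s = integral {0..s} (I1 f)" for f :: "real \<Rightarrow> real" and s :: real
  have cI1: "continuous_on {0..s} (I1 f)" if "continuous_on UNIV f" for f s
    unfolding I1_def by (intro indefinite_integral_continuous_1 integrable_continuous_real continuous_on_subset[OF that]) auto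
  have cI2: "continuous_on {0..s} (I2 f)" if "continuous_on UNIV f" for f s
    unfolding I2_def by (intro indefinite_integral_continuous_1 integrable_continuous_real cI1 that)
  define W where "W g = (\<lambda>s. F s (exp (L * s) * apply_bcontfun g s))" for g :: "real \<Rightarrow>\<^sub>C real"
  have cW: "continuous_on UNIV (W g)" for g
  proof -
    have "continuous_on UNIV (apply_bcontfun g)" using apply_bcontfun[of g] by (simp add: bcontfun_def)
    then have "continuous_on UNIV (\<lambda>s. (s, exp (L * s) * apply_bcontfun g s))" by (intro continuous_intros)
    from continuous_on_compose2[OF cont this] show ?thesis unfolding W_def by simp
  qed
  define \<Phi> where "\<Phi> g = (\<lambda>t. exp (- L * max 0 t) * I2 (W g) (max 0 t))" for g
  have dI: "\<bar>I2 f s - I2 g s\<bar> \<le> b s"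
    if f: "continuous_on UNIV f" and g: "continuous_on UNIV g" and s: "0 \<le> s"
      and le: "\<And>\<sigma>. 0 \<le> \<sigma> \<Longrightarrow> \<bar>f \<sigma> - g \<sigma>\<bar> \<le> b'' \<sigma>"
      and b: "\<And>\<sigma>. (b has_real_derivative b' \<sigma>) (at \<sigma>)" "\<And>\<sigma>. (b' has_real_derivative b'' \<sigma>) (at \<sigma>)"
      and b0: "0 \<le> b 0" "0 \<le> b' 0" for f g s and b b' b'' :: "real \<Rightarrow> real"
  proof -
    have hi: "(b'' has_integral (b' s - b' 0)) {0..s}" "(b' has_integral (b s - b 0)) {0..s}" if "0 \<le> s" for s
      by (intro FTC_has_integral b that)+
    have 1: "\<bar>I1 f s - I1 g s\<bar> \<le> b' s" if s: "0 \<le> s" for s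
    proof -
      have "I1 f s - I1 g s = integral {0..s} (\<lambda>\<sigma>. f \<sigma> - g \<sigma>)"
        unfolding I1_def by (intro Henstock_Kurzweil_Integration.integral_diff[symmetric] integrable_continuous_real)
          (auto intro: continuous_on_subset[OF f] continuous_on_subset[OF g])
      also have "norm \<dots> \<le> integral {0..s} b''"
      proof (rule integral_norm_bound_integral)
        show "(\<lambda>\<sigma>. f \<sigma> - g \<sigma>) integrable_on {0..s}"
          by (intro integrable_continuous_real continuous_on_diff)
            (auto intro: continuous_on_subset[OF f] continuous_on_subset[OF g])
      qed (use hi(1)[OF s] le in auto)
      also have "\<dots> = b' s - b' 0" using hi(1)[OF s] by (rule integral_unique)
      finally show ?thesis using b0 by simp
    qed
    have "I2 f s - I2 g s = integral {0..s} (\<lambda>\<sigma>. I1 f \<sigma> - I1 g \<sigma>)"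
      unfolding I2_def by (intro Henstock_Kurzweil_Integration.integral_diff[symmetric] integrable_continuous_real cI1 f g)
    also have "norm \<dots> \<le> integral {0..s} b'"
    proof (rule integral_norm_bound_integral)
      show "(\<lambda>\<sigma>. I1 f \<sigma> - I1 g \<sigma>) integrable_on {0..s}"
        by (intro integrable_continuous_real continuous_on_diff cI1 f g)
    qed (use hi(2)[OF s] 1 in auto)
    also have "\<dots> = b s - b 0" using hi(2)[OF s] by (rule integral_unique)
    finally show ?thesis using b0 by simp
  qed
  have I20: "I2 (\<lambda>_. 0) s = 0" for s unfolding I2_def I1_def by simp
  have c\<Phi>: "continuous_on UNIV (\<Phi> g)" for g
  proof -
    have "isCont (\<Phi> g) t" for t
    proof -
      define b where "b = \<bar>t\<bar> + 1"
      have "continuous_on {- b..b} (\<lambda>t. I2 (W g) (max 0 t))"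
        by (rule continuous_on_compose2[OF cI2[OF cW[of g], of b]])
          (auto intro!: continuous_intros simp: b_def)
      then have "continuous_on {- b..b} (\<Phi> g)" unfolding \<Phi>_def by (intro continuous_intros)
      then show ?thesis by (rule continuous_on_interior) (auto simp: b_def)
    qed
    then show ?thesis by (simp add: continuous_on_eq_continuous_at)
  qed
  have b\<Phi>: "\<bar>\<Phi> g t\<bar> \<le> B" for g t
  proof -
    define s where "s = max 0 t"
    have s: "0 \<le> s" by (simp add: s_def)
    have "\<bar>I2 (W g) s - I2 (\<lambda>_. 0) s\<bar> \<le> B * s\<^sup>2 / 2"
      by (rule dI[OF cW continuous_on_const s, where b'="\<lambda>s. B * s" and b''="\<lambda>_. B"])
        (use bound in \<open>auto simp: W_def intro!: derivative_eq_intros\<close>)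
    then have "\<bar>I2 (W g) s\<bar> \<le> B * (s\<^sup>2 / 2)" using I20 by simp
    also have "\<dots> \<le> B * exp (L * s)"
    proof (rule mult_left_mono[OF _ B0])
      have "s\<^sup>2 / 2 \<le> exp s" using exp_lower_Taylor_quadratic[OF s] s by simp
      also have "\<dots> \<le> exp (L * s)" using L s mult_right_mono[of 1 L s] by simp
      finally show "s\<^sup>2 / 2 \<le> exp (L * s)" .
    qed
    finally have "exp (- L * s) * \<bar>I2 (W g) s\<bar> \<le> exp (- L * s) * (B * exp (L * s))" by (intro mult_left_mono) auto
    also have "\<dots> = B" by (simp add: exp_minus)
    finally show ?thesis by (simp add: \<Phi>_def s_def abs_mult)
  qed
  have bc: "\<Phi> g \<in> bcontfun" for g
    unfolding bcontfun_def using c\<Phi> b\<Phi> by (auto intro!: boundedI[of _ B])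
  have contr: "dist (Bcontfun (\<Phi> g)) (Bcontfun (\<Phi> g')) \<le> 1/2 * dist g g'" for g g'
  proof (rule dist_bound)
    fix t :: real
    define s where "s = max 0 t"
    have s: "0 \<le> s" by (simp add: s_def)
    define D where "D = dist g g'"
    have D0: "0 \<le> D" by (simp add: D_def)
    have "\<bar>I2 (W g) s - I2 (W g') s\<bar> \<le> K * D / L\<^sup>2 * exp (L * s)"
    proof (rule dI[OF cW cW s, where b'="\<lambda>s. K * D / L * exp (L * s)" and b''="\<lambda>s. K * D * exp (L * s)"])
      fix \<sigma> :: real
      have "\<bar>W g \<sigma> - W g' \<sigma>\<bar> \<le> K * \<bar>exp (L * \<sigma>) * apply_bcontfun g \<sigma> - exp (L * \<sigma>) * apply_bcontfun g' \<sigma>\<bar>"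
        unfolding W_def by (rule lip)
      also have "\<dots> = K * (exp (L * \<sigma>) * dist (apply_bcontfun g \<sigma>) (apply_bcontfun g' \<sigma>))"
        by (simp add: right_diff_distrib[symmetric] abs_mult dist_real_def)
      also have "\<dots> \<le> K * (exp (L * \<sigma>) * D)"
        unfolding D_def using K0 by (intro mult_left_mono dist_bounded) auto
      finally show "\<bar>W g \<sigma> - W g' \<sigma>\<bar> \<le> K * D * exp (L * \<sigma>)" by (simp add: mult_ac)
    qed (use L K0 D0 in \<open>auto intro!: derivative_eq_intros simp: power2_eq_square\<close>)
    then have "exp (- L * s) * \<bar>I2 (W g) s - I2 (W g') s\<bar> \<le> exp (- L * s) * (K * D / L\<^sup>2 * exp (L * s))"
      by (intro mult_left_mono) auto
    also have "\<dots> = K / L\<^sup>2 * D" by (simp add: exp_minus)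
    also have "\<dots> \<le> 1/2 * D" using L D0 by (intro mult_right_mono)
    finally have "\<bar>exp (- L * s) * (I2 (W g) s - I2 (W g') s)\<bar> \<le> 1/2 * D" by (simp add: abs_mult)
    then show "dist (apply_bcontfun (Bcontfun (\<Phi> g)) t) (apply_bcontfun (Bcontfun (\<Phi> g')) t) \<le> 1/2 * dist g g'"
      unfolding Bcontfun_inverse[OF bc] by (simp add: \<Phi>_def s_def D_def dist_real_def right_diff_distrib)
  qed
  obtain g where g: "Bcontfun (\<Phi> g) = g"
    using banach_fix_type[of "1/2" "\<lambda>g. Bcontfun (\<Phi> g)"] contr by auto
  then have gt: "apply_bcontfun g t = \<Phi> g t" for t
    using Bcontfun_inverse[OF bc, of g] by simp
  have cw: "continuous_on UNIV (\<lambda>t. W g (max 0 t))"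
    by (rule continuous_on_compose2[OF cW]) (auto intro!: continuous_intros)
  obtain z' where z': "\<And>t. (z' has_real_derivative W g (max 0 t)) (at t)" "z' 0 = 0"
    using continuous_antiderivative[OF cw] by metis
  have "continuous_on UNIV z'" using z'(1) by (meson DERIV_continuous continuous_at_imp_continuous_on)
  then obtain z where z: "\<And>t. (z has_real_derivative z' t) (at t)" "z 0 = 0"
    using continuous_antiderivative by metis
  have "z' s = I1 (W g) s" if "0 \<le> s" for s
  proof -
    have "((\<lambda>t. W g (max 0 t)) has_integral (z' s - z' 0)) {0..s}"
      by (intro FTC_has_integral z' that)
    then have "(W g has_integral (z' s - z' 0)) {0..s}"
      by (rule has_integral_eq[rotated]) auto
    then show ?thesis using z'(2) by (simp add: I1_def integral_unique)
  qed
  then have zI: "z s = I2 (W g) s" if "0 \<le> s" for s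
  proof -
    have "(z' has_integral (z s - z 0)) {0..s}"
      by (intro FTC_has_integral z that)
    then have "(I1 (W g) has_integral (z s - z 0)) {0..s}"
      by (rule has_integral_eq[rotated]) (use \<open>\<And>s. 0 \<le> s \<Longrightarrow> z' s = I1 (W g) s\<close> in auto)
    then show ?thesis using z(2) by (simp add: I2_def integral_unique)
  qed
  have "W g (max 0 t) = F (max 0 t) (z (max 0 t))" for t
  proof -
    have "exp (L * max 0 t) * apply_bcontfun g (max 0 t) = z (max 0 t)"
      unfolding gt \<Phi>_def by (simp add: zI exp_minus mult.assoc[symmetric])
    then show ?thesis by (simp add: W_def)
  qed
  then show ?thesis using that[of z z'] z z' by simp
qed


section \<open>The explicit solution in Lagrangian coordinates\<close>

lemma doubly_periodic_attains_inf:
  fixes f :: "real \<Rightarrow> real \<Rightarrow> real"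
  assumes c: "continuous_on UNIV (\<lambda>z. f (fst z) (snd z))" and T: "T > 0"
    and p: "\<And>t x. f (t + T) x = f t x" "\<And>t. periodic1 (f t)"
  obtains t0 x0 where "\<And>t x. f t0 x0 \<le> f t x"
proof -
  have "\<exists>z\<in>{0..T} \<times> {0..1}. \<forall>z'\<in>{0..T} \<times> {0..1}. f (fst z) (snd z) \<le> f (fst z') (snd z')"
    using T by (intro continuous_attains_inf continuous_on_subset[OF c] compact_Times) auto
  then obtain t0 x0 where m: "\<And>t x. 0 \<le> t \<Longrightarrow> t \<le> T \<Longrightarrow> 0 \<le> x \<Longrightarrow> x \<le> 1 \<Longrightarrow> f t0 x0 \<le> f t x" by force
  have "f t0 x0 \<le> f t x" for t x
  proof -
    have 1: "periodic1 (\<lambda>s. f (T * s) (frac x))"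
      using p(1) by (simp add: periodic1_def distrib_left)
    have "f t0 x0 \<le> f (T * (t / T)) (frac x)"
      by (rule periodic1_bound[OF 1, of "\<lambda>v. f t0 x0 \<le> v"]) (use m frac_01 T in \<open>auto simp: mult_le_cancel_left1\<close>)
    then show ?thesis using periodic1_frac[OF p(2)] T by simp
  qed
  then show ?thesis using that by blast
qed

text \<open>Particles are labelled by their initial position \<open>x\<close>. Write \<open>p\<close> for \<open>u\<^sub>0'\<close> and \<open>r\<close> for \<open>\<rho>\<^sub>0\<close>; up to a
  translation depending on time only, the particle \<open>x\<close> is at \<open>Q t x\<close> at time \<open>t\<close>, and \<open>J\<close> is the Jacobian of
  the flow map. The functions \<open>u\<^sub>x\<close> and \<open>\<rho>\<close> along the particle paths are \<open>J\<^sub>t / J\<close> and \<open>r / J\<close>. The energy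
  \<open>\<omega>\<^sup>2\<close> is conserved, and \<open>a = - \<omega>\<^sup>2 / 2\<close>, so the square root of \<open>J\<close> obeys an Ermakov equation; its explicit
  solution yields \<open>q1\<close>, \<open>q2\<close> and \<open>q3\<close> below. Since these depend on time only and multiply functions of the label
  only, regularity in time and regularity in the label can be treated separately.\<close>

locale lagrangian =
  fixes \<kappa> \<omega> :: real and u0 p p' r r' h :: "real \<Rightarrow> real"
  assumes \<kappa>: "\<kappa> > 0" and \<omega>: "\<omega> > 0" and \<omega>2: "\<omega>\<^sup>2 = (LINT x|circle. (p x)\<^sup>2 + \<kappa> * (r x)\<^sup>2)"
    and H1_u0: "H1_deriv u0 p" and H1_p: "H1_deriv p p'" and H1_r: "H1_deriv r r'"
    and r_nonzero: "\<And>x. r x \<noteq> 0" and cont_h: "continuous_on UNIV h"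
begin

definition "e x = (p x)\<^sup>2 + \<kappa> * (r x)\<^sup>2"
definition "e' x = 2 * p x * p' x + \<kappa> * (2 * r x * r' x)"
definition "V x = u0 x - u0 0"
definition "W = (SOME W. (\<forall>x. (W has_real_derivative e x) (at x)) \<and> W 0 = 0)"

definition "q1 t = 1/2 + cos (\<omega> * t) / 2"
definition "q2 t = sin (\<omega> * t) / \<omega>"
definition "q3 t = (1 - cos (\<omega> * t)) / (2 * \<omega>\<^sup>2)"
definition "dq1 t = - \<omega> * sin (\<omega> * t) / 2"
definition "dq2 t = cos (\<omega> * t)"
definition "dq3 t = sin (\<omega> * t) / (2 * \<omega>)"
definition "ddq1 t = - \<omega>\<^sup>2 * cos (\<omega> * t) / 2"
definition "ddq2 t = - \<omega> * sin (\<omega> * t)"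
definition "ddq3 t = cos (\<omega> * t) / 2"

definition "J t x = q1 t + q2 t * p x + q3 t * e x"
definition "Jt t x = dq1 t + dq2 t * p x + dq3 t * e x"
definition "Jtt t x = ddq1 t + ddq2 t * p x + ddq3 t * e x"
definition "Q t x = q1 t * x + q2 t * V x + q3 t * W x"
definition "Qt t x = dq1 t * x + dq2 t * V x + dq3 t * W x"
definition "Qtt t x = ddq1 t * x + ddq2 t * V x + ddq3 t * W x"

lemmas q_defs = q1_def q2_def q3_def
lemmas dq_defs = dq1_def dq2_def dq3_def
lemmas ddq_defs = ddq1_def ddq2_def ddq3_def

lemma q_deriv: "(q1 has_real_derivative dq1 t) (at t)" "(q2 has_real_derivative dq2 t) (at t)"
    "(q3 has_real_derivative dq3 t) (at t)"
    "(dq1 has_real_derivative ddq1 t) (at t)" "(dq2 has_real_derivative ddq2 t) (at t)"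
    "(dq3 has_real_derivative ddq3 t) (at t)"
  unfolding q_defs[abs_def] dq_defs[abs_def] ddq_defs using \<omega>
  by (auto intro!: derivative_eq_intros simp: power2_eq_square)

lemma q_cont: "continuous_on A q1" "continuous_on A q2" "continuous_on A q3"
    "continuous_on A dq1" "continuous_on A dq2" "continuous_on A dq3"
    "continuous_on A ddq1" "continuous_on A ddq2" "continuous_on A ddq3"
  unfolding q_defs[abs_def] dq_defs[abs_def] ddq_defs[abs_def] using \<omega>
  by (auto intro!: continuous_intros)

lemma H1_e: "H1_deriv e e'"
proof -
  have 1: "(\<lambda>x. p x * p x + \<kappa> * (r x * r x)) = e" by (auto simp: e_def power2_eq_square)
  have 2: "(\<lambda>x. (p x * p' x + p x * p' x) + \<kappa> * (r x * r' x + r x * r' x)) = e'" by (auto simp: e'_def)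
  show ?thesis
    using H1_deriv_add[OF H1_deriv_mult[OF H1_p H1_p] H1_deriv_cmult[OF H1_deriv_mult[OF H1_r H1_r], of \<kappa>]]
    unfolding 1 2 .
qed

lemmas cont_per = H1_deriv_continuous[OF H1_p] H1_deriv_continuous[OF H1_e] H1_deriv_continuous[OF H1_r]
lemmas periodic_per = H1_deriv_periodic[OF H1_p] H1_deriv_periodic[OF H1_e] H1_deriv_periodic[OF H1_r]

lemma V_deriv: "(V has_real_derivative p x) (at x)"
  unfolding V_def[abs_def] using H1_deriv_classical[OF H1_u0 cont_per(1)] by (auto intro!: derivative_eq_intros)

lemma W: "(W has_real_derivative e x) (at x)" "W 0 = 0"
proof -
  have "\<exists>W. (\<forall>x. (W has_real_derivative e x) (at x)) \<and> W 0 = 0"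
    using continuous_antiderivative[OF cont_per(2), of 0] by metis
  from someI_ex[OF this] show "(W has_real_derivative e x) (at x)" "W 0 = 0" unfolding W_def by auto
qed

lemma V_periodic: "V (x + 1) = V x"
  using H1_deriv_periodic[OF H1_u0] by (simp add: V_def periodic1_def)

lemma W_shift: "W (x + 1) = W x + \<omega>\<^sup>2"
proof -
  have "((\<lambda>x. W (x + 1) - W x) has_real_derivative e (x + 1) - e x) (at x)" for x
    using W(1)[of "x + 1"] by (intro DERIV_diff W) (simp add: DERIV_shift)
  then have "((\<lambda>x. W (x + 1) - W x) has_real_derivative 0) (at x)" for x
    using periodic_per(2) by (simp add: periodic1_def)
  then have "W (x + 1) - W x = W (0 + 1) - W 0"
    using DERIV_isconst_all[of "\<lambda>x. W (x + 1) - W x"] by blast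
  also have "\<dots> = (LINT x|circle. e x)"
    using FTC_integral[of 0 1 W e] W(1) cont_per(2) by (simp add: has_field_derivative_at_within)
  also have "\<dots> = \<omega>\<^sup>2" unfolding \<omega>2 e_def ..
  finally show ?thesis by simp
qed

lemma Q_shift: "Q t (x + 1) = Q t x + 1" "Qt t (x + 1) = Qt t x" "Qtt t (x + 1) = Qtt t x"
  unfolding Q_def Qt_def Qtt_def V_periodic W_shift q_defs dq_defs ddq_defs using \<omega>
  by (auto simp: field_simps power2_eq_square)

lemma Q_0: "Q t 0 = 0" "Qt t 0 = 0" "Qtt t 0 = 0"
  by (simp_all add: Q_def Qt_def Qtt_def W V_def)

lemma Q_deriv_x: "(Q t has_real_derivative J t x) (at x)" "(Qt t has_real_derivative Jt t x) (at x)"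
    "(Qtt t has_real_derivative Jtt t x) (at x)"
  unfolding Q_def[abs_def] Qt_def[abs_def] Qtt_def[abs_def] J_def Jt_def Jtt_def
  by (auto intro!: derivative_eq_intros V_deriv W)

lemma Q_deriv_t: "((\<lambda>t. Q t x) has_real_derivative Qt t x) (at t)" "((\<lambda>t. Qt t x) has_real_derivative Qtt t x) (at t)"
    "((\<lambda>t. J t x) has_real_derivative Jt t x) (at t)" "((\<lambda>t. Jt t x) has_real_derivative Jtt t x) (at t)"
  unfolding Q_def Qt_def Qtt_def J_def Jt_def Jtt_def
  by (auto intro!: derivative_eq_intros q_deriv)

lemma cont2_fst: "continuous_on UNIV f \<Longrightarrow> continuous_on UNIV (\<lambda>z :: real \<times> real. f (fst z) :: real)" for f :: "real \<Rightarrow> real"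
  by (rule continuous_on_compose2[where s=UNIV]) (auto intro: continuous_intros)

lemma cont2_snd: "continuous_on UNIV f \<Longrightarrow> continuous_on UNIV (\<lambda>z :: real \<times> real. f (snd z) :: real)" for f :: "real \<Rightarrow> real"
  by (rule continuous_on_compose2[where s=UNIV]) (auto intro: continuous_intros)

lemma cont_V: "continuous_on UNIV V" and cont_W: "continuous_on UNIV W"
  using V_deriv W(1) by (meson DERIV_continuous continuous_at_imp_continuous_on)+

lemma cont_J: "continuous_on UNIV (\<lambda>z. J (fst z) (snd z))" "continuous_on UNIV (\<lambda>z. Jt (fst z) (snd z))"
    "continuous_on UNIV (\<lambda>z. Jtt (fst z) (snd z))"
  unfolding J_def Jt_def Jtt_def
  by (intro continuous_on_add continuous_on_mult cont2_fst cont2_snd q_cont cont_per)+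

lemma cont_Q: "continuous_on UNIV (\<lambda>z. Q (fst z) (snd z))" "continuous_on UNIV (\<lambda>z. Qt (fst z) (snd z))"
    "continuous_on UNIV (\<lambda>z. Qtt (fst z) (snd z))"
  unfolding Q_def Qt_def Qtt_def
  by (intro continuous_on_add continuous_on_mult cont2_fst[OF q_cont(1)] cont2_fst[OF q_cont(2)] cont2_fst[OF q_cont(3)]
    cont2_fst[OF q_cont(4)] cont2_fst[OF q_cont(5)] cont2_fst[OF q_cont(6)]
    cont2_fst[OF q_cont(7)] cont2_fst[OF q_cont(8)] cont2_fst[OF q_cont(9)]
    cont2_snd[OF cont_V] cont2_snd[OF cont_W] continuous_on_snd continuous_on_id)+

lemma J_periodic: "periodic1 (J t)" "periodic1 (Jt t)" "periodic1 (Jtt t)"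
  using periodic_per by (simp_all add: periodic1_def J_def Jt_def Jtt_def)

text \<open>\<open>J\<close> is the squared modulus of the solution \<open>cos (\<omega> t / 2) + sin (\<omega> t / 2) (p + \<i> \<surd>\<kappa> r) / \<omega>\<close> of a
  harmonic oscillator; since \<open>r\<close> does not vanish, neither does this solution.\<close>

lemma J_pos: "J t x > 0"
proof -
  define A B where "A = cos (\<omega> * t / 2)" and "B = sin (\<omega> * t / 2) / \<omega>"
  have c: "cos (\<omega> * t) = 1 - 2 * (sin (\<omega> * t / 2))\<^sup>2" "cos (\<omega> * t) = 2 * (cos (\<omega> * t / 2))\<^sup>2 - 1"
    and s: "sin (\<omega> * t) = 2 * sin (\<omega> * t / 2) * cos (\<omega> * t / 2)"
    using cos_double_sin[of "\<omega> * t / 2"] cos_double_cos[of "\<omega> * t / 2"] sin_double[of "\<omega> * t / 2"] by auto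
  have q: "q1 t = A\<^sup>2" "q2 t = 2 * A * B" "q3 t = B\<^sup>2"
  proof -
    show "q1 t = A\<^sup>2" unfolding q1_def A_def c(2) by (simp add: field_simps)
    show "q2 t = 2 * A * B" unfolding q2_def A_def B_def s by simp
    show "q3 t = B\<^sup>2" unfolding q3_def B_def c(1) by (simp add: power_divide)
  qed
  have J: "J t x = (A + B * p x)\<^sup>2 + \<kappa> * (B * r x)\<^sup>2"
    unfolding J_def q e_def by (simp add: power2_eq_square algebra_simps)
  show ?thesis
  proof (cases "B = 0")
    case True
    then have "sin (\<omega> * t / 2) = 0" using \<omega> by (simp add: B_def)
    then have "A\<^sup>2 = 1" using sin_cos_squared_add[of "\<omega> * t / 2"] by (simp add: A_def)
    then show ?thesis using True J by simp
  next
    case False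
    then have "\<kappa> * (B * r x)\<^sup>2 > 0" using \<kappa> r_nonzero by simp
    then show ?thesis unfolding J using zero_le_power2[of "A + B * p x"] by linarith
  qed
qed

lemma J_nonzero: "J t x \<noteq> 0" using J_pos[of t x] by simp

text \<open>With \<open>U = J\<^sub>t / J\<close> and \<open>R = r / J\<close> this says \<open>J\<^sub>t\<^sub>t / J = U\<^sup>2 / 2 + \<kappa> R\<^sup>2 / 2 - \<omega>\<^sup>2 / 2\<close>, which is the first
  equation of the system, differentiated in space, along the particle paths.\<close>

lemma J_identity: "2 * J t x * Jtt t x = (Jt t x)\<^sup>2 + \<kappa> * (r x)\<^sup>2 - \<omega>\<^sup>2 * (J t x)\<^sup>2"
proof -
  define c s P E where "c = cos (\<omega> * t)" and "s = sin (\<omega> * t)" and "P = p x / \<omega>" and "E = e x / \<omega>\<^sup>2"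
  have cs: "s\<^sup>2 = 1 - c\<^sup>2" unfolding c_def s_def by (simp add: sin_squared_eq)
  have P: "p x = \<omega> * P" and E: "e x = \<omega>\<^sup>2 * E" using \<omega> by (auto simp: P_def E_def)
  have J: "2 * J t x = 1 + c + 2 * s * P + (1 - c) * E"
    unfolding J_def q_defs P E using \<omega> by (simp add: c_def s_def field_simps)
  have Jt: "2 * Jt t x = \<omega> * (- s + 2 * c * P + s * E)"
    unfolding Jt_def dq_defs P E using \<omega> by (simp add: c_def s_def field_simps power2_eq_square)
  have Jtt: "2 * Jtt t x = \<omega>\<^sup>2 * (- c - 2 * s * P + c * E)"
    unfolding Jtt_def ddq_defs P E using \<omega> by (simp add: c_def s_def field_simps power2_eq_square)
  have kr: "\<kappa> * (r x)\<^sup>2 = \<omega>\<^sup>2 * (E - P\<^sup>2)"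
    using E P by (simp add: e_def power_mult_distrib algebra_simps)
  define X Y Z where "X = 1 + c + 2 * s * P + (1 - c) * E" and "Y = - s + 2 * c * P + s * E"
    and "Z = - c - 2 * s * P + c * E"
  have "2 * (1 + c + 2 * s * P + (1 - c) * E) * (- c - 2 * s * P + c * E)
     = (- s + 2 * c * P + s * E)\<^sup>2 + 4 * (E - P\<^sup>2) - (1 + c + 2 * s * P + (1 - c) * E)\<^sup>2"
    using cs by algebra
  then have "2 * X * Z = Y\<^sup>2 + 4 * (E - P\<^sup>2) - X\<^sup>2" by (simp add: X_def Y_def Z_def)
  then have "\<omega>\<^sup>2 * (2 * X * Z) = \<omega>\<^sup>2 * (Y\<^sup>2 + 4 * (E - P\<^sup>2) - X\<^sup>2)" by simp
  then have "2 * (2 * J t x) * (2 * Jtt t x) = (2 * Jt t x)\<^sup>2 + 4 * (\<kappa> * (r x)\<^sup>2) - \<omega>\<^sup>2 * (2 * J t x)\<^sup>2"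
    unfolding J Jt Jtt kr X_def[symmetric] Y_def[symmetric] Z_def[symmetric] power_mult_distrib
    by (simp add: algebra_simps)
  then show ?thesis by (simp add: power_mult_distrib)
qed

lemma time_periodic: "J (t + 2 * pi / \<omega>) x = J t x" "Jtt (t + 2 * pi / \<omega>) x = Jtt t x" "Qtt (t + 2 * pi / \<omega>) x = Qtt t x"
proof -
  have *: "\<omega> * (t + 2 * pi / \<omega>) = \<omega> * t + 2 * pi" using \<omega> by (simp add: distrib_left)
  show "J (t + 2 * pi / \<omega>) x = J t x" "Jtt (t + 2 * pi / \<omega>) x = Jtt t x" "Qtt (t + 2 * pi / \<omega>) x = Qtt t x"
    unfolding J_def Jtt_def Qtt_def q_defs ddq_defs * by simp_all
qed

text \<open>The coefficients are periodic in time as well as in the label, so their extrema are attained.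
  In particular the Jacobian stays away from zero for all times: this is where global existence comes from.\<close>

lemma uniform_bounds:
  obtains \<delta>0 M where "\<delta>0 > 0" "M > 0" "\<And>t x. \<delta>0 \<le> J t x" "\<And>t x. J t x \<le> M" "\<And>t x. \<bar>Jtt t x\<bar> \<le> M" "\<And>t x. \<bar>Qtt t x\<bar> \<le> M"
proof -
  have T: "2 * pi / \<omega> > 0" using \<omega> by simp
  have pm: "periodic1 (\<lambda>x. - J t x)" "periodic1 (\<lambda>x. - Jtt t x)" "periodic1 (\<lambda>x. - Qtt t x)" "periodic1 (Qtt t)" for t
    using J_periodic Q_shift(3) by (simp_all add: periodic1_def)
  note bounds = doubly_periodic_attains_inf[OF _ T]
  obtain t1 x1 where 1: "\<And>t x. J t1 x1 \<le> J t x"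
    using bounds[OF cont_J(1) time_periodic(1) J_periodic(1)] by metis
  obtain t2 x2 where 2: "\<And>t x. - J t2 x2 \<le> - J t x"
    using bounds[of "\<lambda>t x. - J t x", OF continuous_on_minus[OF cont_J(1)] _ pm(1)] time_periodic(1) by metis
  obtain t3 x3 where 3: "\<And>t x. Jtt t3 x3 \<le> Jtt t x"
    using bounds[OF cont_J(3) time_periodic(2) J_periodic(3)] by metis
  obtain t4 x4 where 4: "\<And>t x. - Jtt t4 x4 \<le> - Jtt t x"
    using bounds[of "\<lambda>t x. - Jtt t x", OF continuous_on_minus[OF cont_J(3)] _ pm(2)] time_periodic(2) by metis
  obtain t5 x5 where 5: "\<And>t x. Qtt t5 x5 \<le> Qtt t x"
    using bounds[OF cont_Q(3) time_periodic(3) pm(4)] by metis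
  obtain t6 x6 where 6: "\<And>t x. - Qtt t6 x6 \<le> - Qtt t x"
    using bounds[of "\<lambda>t x. - Qtt t x", OF continuous_on_minus[OF cont_Q(3)] _ pm(3)] time_periodic(3) by metis
  define M where "M = \<bar>J t2 x2\<bar> + \<bar>Jtt t3 x3\<bar> + \<bar>Jtt t4 x4\<bar> + \<bar>Qtt t5 x5\<bar> + \<bar>Qtt t6 x6\<bar> + 1"
  show ?thesis
  proof (rule that[of "J t1 x1" M])
    show "J t x \<le> M" for t x using 2[of t x] unfolding M_def by linarith
    show "\<bar>Jtt t x\<bar> \<le> M" for t x using 3[of t x] 4[of t x] unfolding M_def by linarith
    show "\<bar>Qtt t x\<bar> \<le> M" for t x using 5[of t x] 6[of t x] unfolding M_def by linarith
    show "M > 0" unfolding M_def by linarith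
  qed (use 1 J_pos in auto)
qed

subsection \<open>Inverting the flow map\<close>

definition "m t z = (SOME x. Q t x = z)"

lemma Q_mono: "x < y \<Longrightarrow> Q t x < Q t y"
  using Q_deriv_x(1) J_pos by (meson DERIV_pos_imp_increasing)

lemma Q_inj: "Q t x = Q t y \<longleftrightarrow> x = y"
  using Q_mono[of x y t] Q_mono[of y x t] by (cases x y rule: linorder_cases) auto

lemma Q_surj: "\<exists>x. Q t x = z"
proof -
  have nat: "Q t (real n) = real n" for n
    by (induction n) (auto simp: Q_0 Q_shift(1) add.commute[of 1])
  have nat': "Q t (- real n) = - real n" for n
  proof (induction n)
    case (Suc n)
    have "Q t (- real (Suc n)) = Q t (- real (Suc n) + 1) - 1"
      using Q_shift(1)[of t "- real (Suc n)"] by linarith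
    also have "- real (Suc n) + 1 = - real n" by simp
    finally show ?case using Suc by simp
  qed (simp add: Q_0)
  obtain n where n: "\<bar>z\<bar> < real n" using reals_Archimedean2 by blast
  have "continuous_on {- real n..real n} (Q t)"
    using Q_deriv_x(1) by (meson DERIV_continuous continuous_at_imp_continuous_on)
  moreover have "- real n \<le> z" "z \<le> real n" using n by linarith+
  ultimately show ?thesis
    using IVT'[of "Q t" "- real n" z "real n"] nat nat' by auto
qed

lemma Q_m: "Q t (m t z) = z"
  unfolding m_def by (rule someI_ex[OF Q_surj])

lemma m_Q: "m t (Q t x) = x"
  using Q_m[of t "Q t x"] Q_inj by blast

lemma m_shift: "m t (z + 1) = m t z + 1"
  using Q_shift(1)[of t "m t z"] Q_m[of t] m_Q[of t "m t z + 1"] by simp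

lemma Q_mean_value: "\<exists>c. \<bar>c - x\<bar> \<le> \<bar>y - x\<bar> \<and> Q t y - Q t x = J t c * (y - x)"
proof (cases x y rule: linorder_cases)
  case less
  then obtain c where "x < c" "c < y" "Q t y - Q t x = (y - x) * J t c"
    using MVT2[of x y "Q t" "J t"] Q_deriv_x(1) by blast
  then show ?thesis by (intro exI[of _ c]) auto
next
  case greater
  then obtain c where "y < c" "c < x" "Q t x - Q t y = (x - y) * J t c"
    using MVT2[of y x "Q t" "J t"] Q_deriv_x(1) by blast
  then show ?thesis by (intro exI[of _ c]) (auto simp: algebra_simps)
qed auto

lemma m_lipschitz:
  assumes d: "\<delta>0 > 0" "\<And>t x. \<delta>0 \<le> J t x"
  shows "\<bar>m t z - x\<bar> \<le> \<bar>z - Q t x\<bar> / \<delta>0"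
proof -
  obtain c where "Q t (m t z) - Q t x = J t c * (m t z - x)" using Q_mean_value by blast
  then have "\<bar>z - Q t x\<bar> = J t c * \<bar>m t z - x\<bar>" using J_pos[of t c] by (simp add: Q_m abs_mult)
  also have "\<dots> \<ge> \<delta>0 * \<bar>m t z - x\<bar>" by (intro mult_right_mono d) auto
  finally show ?thesis using d(1) by (simp add: pos_le_divide_eq mult.commute)
qed

lemma cont_m: "continuous_on UNIV (\<lambda>w. m (fst w) (snd w))"
proof -
  obtain \<delta>0 M where d: "\<delta>0 > 0" "\<And>t x. \<delta>0 \<le> J t x" using uniform_bounds by metis
  have "((\<lambda>w. m (fst w) (snd w)) \<longlongrightarrow> m (fst w0) (snd w0)) (at w0)" for w0
  proof -
    have "continuous_on UNIV (\<lambda>w :: real \<times> real. (fst w, m (fst w0) (snd w0)))" by (intro continuous_intros)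
    from continuous_on_compose2[OF cont_Q(1) this]
    have "continuous_on UNIV (\<lambda>w :: real \<times> real. Q (fst w) (m (fst w0) (snd w0)))" by simp
    then have "continuous_on UNIV (\<lambda>w. \<bar>snd w - Q (fst w) (m (fst w0) (snd w0))\<bar> / \<delta>0)"
      using d by (intro continuous_intros) auto
    then have "((\<lambda>w. \<bar>snd w - Q (fst w) (m (fst w0) (snd w0))\<bar> / \<delta>0) \<longlongrightarrow>
        \<bar>snd w0 - Q (fst w0) (m (fst w0) (snd w0))\<bar> / \<delta>0) (at w0)"
      unfolding continuous_on_def by blast
    then have lim: "((\<lambda>w. \<bar>snd w - Q (fst w) (m (fst w0) (snd w0))\<bar> / \<delta>0) \<longlongrightarrow> 0) (at w0)"
      by (simp add: Q_m)
    have "((\<lambda>w. m (fst w) (snd w) - m (fst w0) (snd w0)) \<longlongrightarrow> 0) (at w0)"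
      by (rule Lim_null_comparison[OF _ lim]) (simp add: m_lipschitz[OF d])
    then show ?thesis by (simp add: LIM_zero_iff)
  qed
  then show ?thesis by (simp add: continuous_on_def)
qed

text \<open>The position \<open>\<zeta> t\<close> at time \<open>t\<close> of the particle with label \<open>0\<close>. Its equation of motion contains
  the label \<open>m t (- \<zeta> t)\<close> of the particle that is at \<open>0\<close>, where the primitive in the
  equation for \<open>u\<close> is normalised.\<close>

lemma particle_path:
  obtains \<zeta> \<zeta>1 \<zeta>2 where "\<zeta> 0 = 0" "\<zeta>1 0 = u0 0" "\<And>t. (\<zeta> has_real_derivative \<zeta>1 t) (at t)"
    "\<And>t. (\<zeta>1 has_real_derivative \<zeta>2 t) (at t)" "continuous_on UNIV \<zeta>2"
    "\<And>t. 0 \<le> t \<Longrightarrow> \<zeta>2 t = h t - Qtt t (m t (- \<zeta> t))"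
proof -
  obtain \<delta>0 M where b: "\<delta>0 > 0" "M > 0" "\<And>t x. \<delta>0 \<le> J t x" "\<And>t x. \<bar>Jtt t x\<bar> \<le> M" "\<And>t x. \<bar>Qtt t x\<bar> \<le> M"
    using uniform_bounds by metis
  obtain h1 where h1: "\<And>t. (h1 has_real_derivative h t) (at t)" "h1 0 = 0"
    using continuous_antiderivative[OF cont_h] by metis
  have "continuous_on UNIV (\<lambda>t. u0 0 + h1 t)"
    using h1(1) by (intro continuous_intros) (meson DERIV_continuous continuous_at_imp_continuous_on)
  then obtain H where H: "\<And>t. (H has_real_derivative u0 0 + h1 t) (at t)" "H 0 = 0"
    using continuous_antiderivative by metis
  have cH: "continuous_on UNIV H" using H(1) by (meson DERIV_continuous continuous_at_imp_continuous_on)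
  define F where "F t x = - Qtt t (m t (- (H t + x)))" for t x
  have cF: "continuous_on UNIV (\<lambda>z. F (fst z) (snd z))"
  proof -
    have "continuous_on UNIV (\<lambda>z :: real \<times> real. (fst z, - (H (fst z) + snd z)))"
      by (intro continuous_intros cont2_fst cH)
    from continuous_on_compose2[OF cont_m this]
    have "continuous_on UNIV (\<lambda>z :: real \<times> real. (fst z, m (fst z) (- (H (fst z) + snd z))))"
      by (intro continuous_intros) simp
    from continuous_on_compose2[OF cont_Q(3) this] show ?thesis
      unfolding F_def by (intro continuous_intros) simp
  qed
  have lipQ: "\<bar>Qtt t x - Qtt t y\<bar> \<le> M * \<bar>x - y\<bar>" for t x y
    using field_differentiable_bound[of UNIV "Qtt t" "Jtt t" M x y] Q_deriv_x(3) b(4) by auto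
  have lipF: "\<bar>F t x - F t y\<bar> \<le> M / \<delta>0 * \<bar>x - y\<bar>" for t x y
  proof -
    have "\<bar>F t x - F t y\<bar> \<le> M * \<bar>m t (- (H t + y)) - m t (- (H t + x))\<bar>"
      unfolding F_def using lipQ[of t "m t (- (H t + y))" "m t (- (H t + x))"] by simp
    also have "\<bar>m t (- (H t + y)) - m t (- (H t + x))\<bar> \<le> \<bar>x - y\<bar> / \<delta>0"
      using m_lipschitz[OF b(1,3), of t "- (H t + y)" "m t (- (H t + x))"] by (simp add: Q_m)
    finally show ?thesis using b(2) by (simp add: mult_left_mono)
  qed
  obtain z z' where z: "z 0 = 0" "z' 0 = 0" "\<And>t. (z has_real_derivative z' t) (at t)"
    "\<And>t. (z' has_real_derivative F (max 0 t) (z (max 0 t))) (at t)"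
    using second_order_ode_global[OF cF, of M "M / \<delta>0"] lipF b(5) by (auto simp: F_def)
  have cz: "continuous_on UNIV z" using z(3) by (meson DERIV_continuous continuous_at_imp_continuous_on)
  show ?thesis
  proof (rule that[of "\<lambda>t. H t + z t" "\<lambda>t. u0 0 + h1 t + z' t" "\<lambda>t. h t + F (max 0 t) (z (max 0 t))"])
    show "((\<lambda>t. H t + z t) has_real_derivative u0 0 + h1 t + z' t) (at t)" for t
      by (intro DERIV_add H z)
    show "((\<lambda>t. u0 0 + h1 t + z' t) has_real_derivative h t + F (max 0 t) (z (max 0 t))) (at t)" for t
      using z(4)[of t] h1(1)[of t] by (auto intro!: derivative_eq_intros)
    have "continuous_on UNIV (\<lambda>t. (max 0 t, z (max 0 t)))"
      by (intro continuous_intros continuous_on_compose2[OF cz]) auto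
    from continuous_on_compose2[OF cF this]
    show "continuous_on UNIV (\<lambda>t. h t + F (max 0 t) (z (max 0 t)))"
      by (intro continuous_intros cont_h) simp
  qed (use H z h1 in \<open>auto simp: F_def\<close>)
qed

end


text \<open>The actual particle paths \<open>\<zeta> t + Q t x\<close>; \<open>\<psi> t y\<close> is the label of the particle at \<open>y\<close>.\<close>

locale lagrangian_flow = lagrangian +
  fixes \<zeta> \<zeta>1 \<zeta>2 :: "real \<Rightarrow> real"
  assumes \<zeta>_0: "\<zeta> 0 = 0" "\<zeta>1 0 = u0 0"
    and \<zeta>_deriv: "\<And>t. (\<zeta> has_real_derivative \<zeta>1 t) (at t)" "\<And>t. (\<zeta>1 has_real_derivative \<zeta>2 t) (at t)"
    and \<zeta>2_cont: "continuous_on UNIV \<zeta>2" and \<zeta>2_eq: "\<And>t. 0 \<le> t \<Longrightarrow> \<zeta>2 t = h t - Qtt t (m t (- \<zeta> t))"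
begin

definition "\<psi> t y = m t (y - \<zeta> t)"
definition "Ji t x = inverse (J t x)"
definition "\<eta> t y = Ji t (\<psi> t y)"
definition "u t y = \<zeta>1 t + Qt t (\<psi> t y)"
definition "\<xi> t y = - (u t y * \<eta> t y)"

lemma \<zeta>_cont: "continuous_on UNIV \<zeta>" "continuous_on UNIV \<zeta>1"
  using \<zeta>_deriv by (meson DERIV_continuous continuous_at_imp_continuous_on)+

lemma flow_inverse: "\<zeta> t + Q t (\<psi> t y) = y"
  by (simp add: \<psi>_def Q_m)

lemma cont_\<psi>: "continuous_on UNIV (\<lambda>z. \<psi> (fst z) (snd z))"
proof -
  have "continuous_on UNIV (\<lambda>z :: real \<times> real. (fst z, snd z - \<zeta> (fst z)))"
    by (intro continuous_intros cont2_fst \<zeta>_cont)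
  from continuous_on_compose2[OF cont_m this] show ?thesis unfolding \<psi>_def by simp
qed

lemma cont_compose_\<psi>:
  fixes f :: "real \<Rightarrow> real \<Rightarrow> real"
  assumes "continuous_on UNIV (\<lambda>z. f (fst z) (snd z))"
  shows "continuous_on UNIV (\<lambda>z. f (fst z) (\<psi> (fst z) (snd z)))"
proof -
  have "continuous_on UNIV (\<lambda>z :: real \<times> real. (fst z, \<psi> (fst z) (snd z)))"
    by (intro continuous_intros cont_\<psi>)
  from continuous_on_compose2[OF assms this] show ?thesis by simp
qed

lemma cont_Ji: "continuous_on UNIV (\<lambda>z. Ji (fst z) (snd z))"
  unfolding Ji_def by (intro continuous_on_inverse cont_J) (simp add: J_nonzero)

lemma cont_\<eta>: "continuous_on UNIV (\<lambda>z. \<eta> (fst z) (snd z))"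
  unfolding \<eta>_def by (rule cont_compose_\<psi>[OF cont_Ji])

lemma cont_u: "continuous_on UNIV (\<lambda>z. u (fst z) (snd z))"
  unfolding u_def by (intro continuous_on_add cont2_fst \<zeta>_cont cont_compose_\<psi> cont_Q)

lemma cont_\<xi>: "continuous_on UNIV (\<lambda>z. \<xi> (fst z) (snd z))"
  unfolding \<xi>_def by (intro continuous_on_minus continuous_on_mult cont_u cont_\<eta>)

lemma \<psi>_isCont: "isCont (\<psi> t) y" "isCont (\<lambda>t. \<psi> t y) t"
  using jointly_continuous_slice[OF cont_\<psi>, of UNIV] by (simp_all add: continuous_on_eq_continuous_at)

lemma \<psi>_deriv_y: "(\<psi> t has_real_derivative \<eta> t y) (at y)"
  unfolding \<eta>_def Ji_def
proof (rule DERIV_inverse_function[where f="\<lambda>x. \<zeta> t + Q t x" and a="y - 1" and b="y + 1"])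
  show "((\<lambda>x. \<zeta> t + Q t x) has_real_derivative J t (\<psi> t y)) (at (\<psi> t y))"
    by (auto intro!: derivative_eq_intros Q_deriv_x)
qed (auto simp: J_nonzero flow_inverse \<psi>_isCont)

text \<open>Differentiating \<open>\<zeta> s + Q s (\<psi> s y) = y\<close> in \<open>s\<close>, with the mean value theorem in the second argument of \<open>Q\<close>.\<close>

lemma \<psi>_deriv_t: "((\<lambda>t. \<psi> t y) has_real_derivative \<xi> t y) (at t)"
proof -
  define x0 where "x0 = \<psi> t y"
  have "\<forall>s. \<exists>c. \<bar>c - x0\<bar> \<le> \<bar>\<psi> s y - x0\<bar> \<and> Q s (\<psi> s y) - Q s x0 = J s c * (\<psi> s y - x0)"
    using Q_mean_value by blast
  then obtain c where c: "\<And>s. \<bar>c s - x0\<bar> \<le> \<bar>\<psi> s y - x0\<bar>"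
      "\<And>s. Q s (\<psi> s y) - Q s x0 = J s (c s) * (\<psi> s y - x0)"
    by metis
  have lim\<psi>: "((\<lambda>s. \<psi> s y) \<longlongrightarrow> x0) (at t)" using \<psi>_isCont(2)[of t y] by (simp add: isCont_def x0_def)
  have "((\<lambda>s. c s - x0) \<longlongrightarrow> 0) (at t)"
  proof (rule Lim_null_comparison)
    show "((\<lambda>s. \<bar>\<psi> s y - x0\<bar>) \<longlongrightarrow> 0) (at t)" using lim\<psi> by (intro tendsto_rabs_zero) (simp add: LIM_zero)
  qed (use c in simp)
  then have "(c \<longlongrightarrow> x0) (at t)" by (simp add: LIM_zero_iff)
  then have "((\<lambda>s. (s, c s)) \<longlongrightarrow> (t, x0)) (at t)" by (intro tendsto_intros)
  then have "((\<lambda>s. J (fst (s, c s)) (snd (s, c s))) \<longlongrightarrow> J (fst (t, x0)) (snd (t, x0))) (at t)"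
    using cont_J(1) by (intro isCont_tendsto_compose[of "(t, x0)" "\<lambda>z. J (fst z) (snd z)"]) (auto simp: continuous_on_eq_continuous_at)
  then have limJ: "((\<lambda>s. J s (c s)) \<longlongrightarrow> J t x0) (at t)" by simp
  have "((\<lambda>s. \<zeta> s + Q s x0) has_real_derivative \<zeta>1 t + Qt t x0) (at t)"
    by (intro DERIV_add \<zeta>_deriv Q_deriv_t)
  then have lim\<phi>: "((\<lambda>s. ((\<zeta> s + Q s x0) - (\<zeta> t + Q t x0)) / (s - t)) \<longlongrightarrow> \<zeta>1 t + Qt t x0) (at t)"
    by (simp add: has_field_derivative_iff)
  have "((\<lambda>s. - (((\<zeta> s + Q s x0) - (\<zeta> t + Q t x0)) / (s - t)) / J s (c s)) \<longlongrightarrow> - (\<zeta>1 t + Qt t x0) / J t x0) (at t)"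
    by (intro tendsto_intros lim\<phi> limJ J_nonzero)
  moreover have "- (((\<zeta> s + Q s x0) - (\<zeta> t + Q t x0)) / (s - t)) / J s (c s) = (\<psi> s y - \<psi> t y) / (s - t)" for s
  proof -
    have "(\<zeta> s + Q s x0) - (\<zeta> t + Q t x0) = - (Q s (\<psi> s y) - Q s x0)"
      using flow_inverse[of s y] flow_inverse[of t y] by (simp add: x0_def)
    then show ?thesis using J_nonzero[of s "c s"] unfolding c(2) by (simp add: x0_def)
  qed
  moreover have "- (\<zeta>1 t + Qt t x0) / J t x0 = \<xi> t y"
    by (simp add: \<xi>_def u_def \<eta>_def Ji_def x0_def divide_inverse algebra_simps)
  ultimately show ?thesis by (simp add: has_field_derivative_iff)
qed

lemma \<psi>_shift: "\<psi> t (y + 1) = \<psi> t y + 1"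
  using m_shift[of t "y - \<zeta> t"] by (simp add: \<psi>_def algebra_simps)

lemma \<psi>_diffeo: "circle_diffeo (\<psi> t) (\<eta> t)"
  unfolding circle_diffeo_def using \<psi>_deriv_y \<psi>_shift jointly_continuous_slice(1)[OF cont_\<eta>] J_pos
  by (auto simp: \<eta>_def Ji_def)

lemma flow_exists: "\<exists>\<delta>. circle_flow \<psi> \<xi> \<eta> \<delta>"
proof -
  obtain M where M: "M > 0" "\<And>t x. J t x \<le> M" using uniform_bounds by metis
  have "circle_flow \<psi> \<xi> \<eta> (inverse M)"
  proof
    show "inverse M \<le> \<eta> t y" for t y
      unfolding \<eta>_def Ji_def by (intro le_imp_inverse_le M J_pos)
  qed (use M \<psi>_diffeo \<psi>_deriv_t cont_\<psi> cont_\<xi> cont_\<eta> in auto)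
  then show ?thesis by blast
qed

definition "\<delta> = (SOME \<delta>. circle_flow \<psi> \<xi> \<eta> \<delta>)"

sublocale flow: circle_flow \<psi> \<xi> \<eta> \<delta>
  unfolding \<delta>_def by (rule someI_ex[OF flow_exists])

subsection \<open>Spatial regularity\<close>

definition "Jx t x = q2 t * p' x + q3 t * e' x"
definition "Jtx t x = dq2 t * p' x + dq3 t * e' x"
definition "U t x = Jt t x * Ji t x"
definition "Ux t x = Ji t x * Jtx t x + Jt t x * (- (Ji t x * Ji t x) * Jx t x)"
definition "R t x = r x * Ji t x"
definition "Rx t x = Ji t x * r' x + r x * (- (Ji t x * Ji t x) * Jx t x)"

definition "ux t y = U t (\<psi> t y)"
definition "uxx t y = \<eta> t y * Ux t (\<psi> t y)"
definition "\<rho> t y = R t (\<psi> t y)"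
definition "\<rho>x t y = \<eta> t y * Rx t (\<psi> t y)"
definition "ut t y = \<zeta>2 t + Qtt t (\<psi> t y) - u t y * ux t y"
definition "utx t y = \<eta> t y * Jtt t (\<psi> t y) - (ux t y * ux t y + u t y * uxx t y)"
definition "\<rho>t t y = - (\<rho> t y * ux t y) - u t y * \<rho>x t y"

lemma H1_J: "H1_deriv (J t) (Jx t)" "H1_deriv (Jt t) (Jtx t)"
  using H1_deriv_add[OF H1_deriv_add[OF H1_deriv_const[of "q1 t"] H1_deriv_cmult[OF H1_p, of "q2 t"]] H1_deriv_cmult[OF H1_e, of "q3 t"]]
    H1_deriv_add[OF H1_deriv_add[OF H1_deriv_const[of "dq1 t"] H1_deriv_cmult[OF H1_p, of "dq2 t"]] H1_deriv_cmult[OF H1_e, of "dq3 t"]]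
  by (simp_all add: J_def[abs_def] Jx_def[abs_def] Jt_def[abs_def] Jtx_def[abs_def])

lemma H1_Ji: "H1_deriv (Ji t) (\<lambda>x. - (Ji t x * Ji t x) * Jx t x)"
  using H1_deriv_inverse[OF H1_J(1) J_pos] by (simp add: Ji_def[abs_def])

lemma H1_U: "H1_deriv (U t) (Ux t)" and H1_R: "H1_deriv (R t) (Rx t)"
  using H1_deriv_mult[OF H1_J(2) H1_Ji] H1_deriv_mult[OF H1_r H1_Ji]
  by (simp_all add: U_def[abs_def] Ux_def[abs_def] R_def[abs_def] Rx_def[abs_def])

lemma cont_U: "continuous_on UNIV (\<lambda>z. U (fst z) (snd z))" and cont_R: "continuous_on UNIV (\<lambda>z. R (fst z) (snd z))"
  unfolding U_def R_def by (intro continuous_on_mult cont_J cont_Ji cont2_snd cont_per)+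

lemma cont_ux: "continuous_on UNIV (\<lambda>z. ux (fst z) (snd z))" and cont_\<rho>: "continuous_on UNIV (\<lambda>z. \<rho> (fst z) (snd z))"
  unfolding ux_def \<rho>_def by (rule cont_compose_\<psi>[OF cont_U] cont_compose_\<psi>[OF cont_R])+

lemma cont_ut: "continuous_on UNIV (\<lambda>z. ut (fst z) (snd z))"
  unfolding ut_def by (intro continuous_on_diff continuous_on_add continuous_on_mult cont2_fst \<zeta>2_cont cont_compose_\<psi> cont_Q cont_u cont_ux)

lemma H1_ux: "H1_deriv (ux t) (uxx t)" and H1_\<rho>: "H1_deriv (\<rho> t) (\<rho>x t)"
  using H1_deriv_compose[OF \<psi>_diffeo H1_U] H1_deriv_compose[OF \<psi>_diffeo H1_R]
  by (simp_all add: ux_def[abs_def] uxx_def[abs_def] \<rho>_def[abs_def] \<rho>x_def[abs_def])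

lemma Qtt_\<psi>_C1: "C1_periodic (\<lambda>y. c + Qtt t (\<psi> t y)) (\<lambda>y. \<eta> t y * Jtt t (\<psi> t y))"
  unfolding C1_periodic_def
proof (intro conjI allI)
  show "periodic1 (\<lambda>y. c + Qtt t (\<psi> t y))" by (simp add: periodic1_def \<psi>_shift Q_shift)
  show "continuous_on UNIV (\<lambda>y. \<eta> t y * Jtt t (\<psi> t y))"
    by (intro continuous_on_mult jointly_continuous_slice(1)[OF cont_\<eta>]
        jointly_continuous_slice(1)[of "\<lambda>t y. Jtt t (\<psi> t y)", OF cont_compose_\<psi>[OF cont_J(3)]])
  show "((\<lambda>y. c + Qtt t (\<psi> t y)) has_real_derivative \<eta> t y * Jtt t (\<psi> t y)) (at y)" for y
    using DERIV_chain2[OF Q_deriv_x(3) \<psi>_deriv_y] by (auto intro!: derivative_eq_intros simp: mult.commute)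
qed

lemma H1_u: "H1_deriv (u t) (ux t)"
proof (rule C1_periodic_imp_H1_deriv)
  show "C1_periodic (u t) (ux t)"
    unfolding C1_periodic_def
  proof (intro conjI allI)
    show "periodic1 (u t)" by (simp add: periodic1_def u_def \<psi>_shift Q_shift)
    show "continuous_on UNIV (ux t)" by (rule jointly_continuous_slice(1)[OF cont_ux])
    show "(u t has_real_derivative ux t y) (at y)" for y
      using DERIV_chain2[OF Q_deriv_x(2) \<psi>_deriv_y]
      unfolding u_def[abs_def] ux_def U_def \<eta>_def by (auto intro!: derivative_eq_intros)
  qed
qed

lemma H1_ut: "H1_deriv (ut t) (utx t)"
  using H1_deriv_diff[OF C1_periodic_imp_H1_deriv[OF Qtt_\<psi>_C1] H1_deriv_mult[OF H1_u H1_ux]]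
  by (simp add: ut_def[abs_def] utx_def[abs_def])

lemma L2_\<rho>t: "L2_circle (\<rho>t t)"
proof -
  have "sq_int (\<rho>t t)"
    unfolding \<rho>t_def[abs_def]
    by (intro sq_int_diff sq_int_minus sq_int_mult_continuous[OF H1_deriv_continuous[OF H1_u] H1_deriv_L2(2)[OF H1_\<rho>]]
       sq_int_mult_continuous[OF H1_deriv_continuous[OF H1_\<rho>] H1_deriv_sq_int[OF H1_ux]])
  moreover have "periodic1 (\<rho>t t)"
    using H1_deriv_periodic[OF H1_u] H1_deriv_periodic[OF H1_ux] H1_deriv_periodic[OF H1_\<rho>] H1_deriv_L2(3)[OF H1_\<rho>]
    by (simp add: \<rho>t_def periodic1_def)
  ultimately show ?thesis by (simp add: L2_circle_iff)
qed

subsection \<open>Regularity in time\<close>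

lemma L2_tendsto_joint:
  fixes f :: "real \<Rightarrow> real \<Rightarrow> real"
  assumes "continuous_on UNIV (\<lambda>z. f (fst z) (snd z))"
  shows "L2_tendsto f (f t) (at t)"
  by (intro uniform_limit_imp_L2_tendsto jointly_continuous_uniform_limit[OF assms] always_eventually allI sq_int_continuous
      jointly_continuous_slice(1)[OF assms])

lemma L2_tendsto_joint_mult:
  fixes b f :: "real \<Rightarrow> real \<Rightarrow> real"
  assumes "continuous_on UNIV (\<lambda>z. b (fst z) (snd z))" "L2_tendsto f (f t) (at t)"
  shows "L2_tendsto (\<lambda>s y. b s y * f s y) (\<lambda>y. b t y * f t y) (at t)"
  by (intro L2_tendsto_mult jointly_continuous_uniform_limit[OF assms(1)] assms(2) always_eventually allI jointly_continuous_slice(1)[OF assms(1)])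

text \<open>Up to jointly continuous terms, the derivatives of the solution are combinations of the derivatives
  of \<open>p\<close>, \<open>e\<close> and \<open>r\<close>, transported by the flow, with jointly continuous coefficients.\<close>

lemma L2_tendsto_coefficient:
  fixes a :: "real \<Rightarrow> real \<Rightarrow> real"
  assumes a: "continuous_on UNIV (\<lambda>z. a (fst z) (snd z))" and g: "L2_circle g"
  shows "L2_tendsto (\<lambda>s y. a s (\<psi> s y) * g (\<psi> s y)) (\<lambda>y. a t (\<psi> t y) * g (\<psi> t y)) (at t)"
  by (rule L2_tendsto_joint_mult[of "\<lambda>s y. a s (\<psi> s y)" "\<lambda>s y. g (\<psi> s y)"]) (intro cont_compose_\<psi> a flow.L2_tendsto_compose g)+

lemmas L2_per = H1_deriv_L2(1)[OF H1_p] H1_deriv_L2(1)[OF H1_e] H1_deriv_L2(1)[OF H1_r]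

lemma L2_tendsto_uxx: "L2_tendsto uxx (uxx t) (at t)"
proof -
  define a1 where "a1 t x = Ji t x * dq2 t - Jt t x * (Ji t x * Ji t x) * q2 t" for t x
  define a2 where "a2 t x = Ji t x * dq3 t - Jt t x * (Ji t x * Ji t x) * q3 t" for t x
  have a: "continuous_on UNIV (\<lambda>z. a1 (fst z) (snd z))" "continuous_on UNIV (\<lambda>z. a2 (fst z) (snd z))"
    unfolding a1_def a2_def by (intro continuous_on_diff continuous_on_mult cont_Ji cont_J cont2_fst q_cont)+
  have eq: "(\<lambda>t y. Ux t (\<psi> t y)) = (\<lambda>t y. a1 t (\<psi> t y) * p' (\<psi> t y) + a2 t (\<psi> t y) * e' (\<psi> t y))"
    by (intro ext) (simp add: Ux_def a1_def a2_def Jx_def Jtx_def algebra_simps)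
  have "L2_tendsto (\<lambda>t y. Ux t (\<psi> t y)) (\<lambda>y. Ux t (\<psi> t y)) (at t)"
    unfolding eq fun_cong[OF eq, of t] by (intro L2_tendsto_add L2_tendsto_coefficient a L2_per)
  from L2_tendsto_joint_mult[OF cont_\<eta> this] show ?thesis by (simp add: uxx_def[abs_def])
qed

lemma L2_tendsto_\<rho>x: "L2_tendsto \<rho>x (\<rho>x t) (at t)"
proof -
  define a1 where "a1 t x = - (r x * (Ji t x * Ji t x) * q2 t)" for t x
  define a2 where "a2 t x = - (r x * (Ji t x * Ji t x) * q3 t)" for t x
  have a: "continuous_on UNIV (\<lambda>z. a1 (fst z) (snd z))" "continuous_on UNIV (\<lambda>z. a2 (fst z) (snd z))"
    unfolding a1_def a2_def by (intro continuous_on_minus continuous_on_mult cont_Ji cont2_snd cont_per cont2_fst q_cont)+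
  have eq: "(\<lambda>t y. Rx t (\<psi> t y)) = (\<lambda>t y. Ji t (\<psi> t y) * r' (\<psi> t y) +
      (a1 t (\<psi> t y) * p' (\<psi> t y) + a2 t (\<psi> t y) * e' (\<psi> t y)))"
    by (intro ext) (simp add: Rx_def a1_def a2_def Jx_def algebra_simps)
  have "L2_tendsto (\<lambda>t y. Rx t (\<psi> t y)) (\<lambda>y. Rx t (\<psi> t y)) (at t)"
    unfolding eq fun_cong[OF eq, of t] by (intro L2_tendsto_add L2_tendsto_coefficient a cont_Ji L2_per)
  from L2_tendsto_joint_mult[OF cont_\<eta> this] show ?thesis by (simp add: \<rho>x_def[abs_def])
qed

lemma L2_tendsto_utx: "L2_tendsto utx (utx t) (at t)"
  unfolding utx_def[abs_def]
  by (intro L2_tendsto_diff L2_tendsto_add L2_tendsto_joint_mult[OF cont_u L2_tendsto_uxx]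
      L2_tendsto_joint_mult[OF cont_ux L2_tendsto_joint[OF cont_ux]]
      L2_tendsto_joint_mult[OF cont_\<eta>] L2_tendsto_joint[of "\<lambda>t y. Jtt t (\<psi> t y)"] cont_compose_\<psi> cont_J)

lemma L2_tendsto_\<rho>t: "L2_tendsto \<rho>t (\<rho>t t) (at t)"
  unfolding \<rho>t_def[abs_def]
  by (intro L2_tendsto_diff L2_tendsto_minus L2_tendsto_joint_mult[OF cont_u L2_tendsto_\<rho>x]
      L2_tendsto_joint_mult[OF cont_\<rho> L2_tendsto_joint[OF cont_ux]])

lemma u_deriv_t: "((\<lambda>t. u t y) has_real_derivative ut t y) (at t)"
proof -
  have "((\<lambda>s. Qt s (\<psi> s y)) has_real_derivative Qtt t (\<psi> t y) + Jt t (\<psi> t y) * \<xi> t y) (at t)"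
    unfolding Qt_def Qtt_def Jt_def
    by (auto intro!: derivative_eq_intros q_deriv \<psi>_deriv_t DERIV_chain2[OF V_deriv \<psi>_deriv_t] DERIV_chain2[OF W(1) \<psi>_deriv_t]
        simp: algebra_simps)
  then show ?thesis
    unfolding u_def ut_def ux_def U_def using \<zeta>_deriv(2)[of t]
    by (auto intro!: derivative_eq_intros simp: \<xi>_def \<eta>_def u_def)
qed

lemma L2_deriv_u: "L2_tendsto (\<lambda>s y. (u s y - u t y) / (s - t)) (ut t) (at t)"
  by (intro uniform_limit_imp_L2_tendsto uniform_limit_difference_quotient u_deriv_t cont_ut always_eventually allI
      sq_int_divide sq_int_diff H1_deriv_sq_int[OF H1_u] H1_deriv_sq_int[OF H1_ut])

lemma Ji_deriv_t: "((\<lambda>t. Ji t x) has_real_derivative - (Ji t x * U t x)) (at t)"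
  unfolding Ji_def U_def using Q_deriv_t(3)[of x t] J_nonzero[of t x]
  by (auto intro!: derivative_eq_intros simp: mult_ac)

text \<open>Along the flow, \<open>u\<^sub>x\<close> is the function \<open>U\<close> of time and label, so its time derivative at a fixed
  position is \<open>U\<^sub>t\<close> minus the transport term \<open>u u\<^sub>x\<^sub>x\<close>.\<close>

lemma L2_deriv_ux: "L2_tendsto (\<lambda>s y. (ux s y - ux t y) / (s - t)) (utx t) (at t)"
proof -
  define Ut where "Ut t x = Jtt t x * Ji t x - U t x * U t x" for t x
  have "L2_tendsto (\<lambda>s y. (U s (\<psi> s y) - U t (\<psi> t y)) / (s - t)) (\<lambda>y. Ut t (\<psi> t y) + \<xi> t y * Ux t (\<psi> t y)) (at t)"
  proof (rule flow.L2_difference_quotient_compose_time)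
    show "((\<lambda>s. U s x) has_real_derivative Ut s x) (at s)" for s x
      unfolding U_def using Q_deriv_t(4)[of x s] Ji_deriv_t[of x s]
      by (auto intro!: derivative_eq_intros simp: Ut_def U_def algebra_simps)
    show "periodic1 (Ut t)" for t
      using J_periodic by (simp add: periodic1_def Ut_def U_def Ji_def)
    show "continuous_on UNIV (\<lambda>z. Ut (fst z) (snd z))"
      unfolding Ut_def by (intro continuous_on_diff continuous_on_mult cont_J cont_Ji cont_U)
  qed (rule H1_U)
  moreover have "Ut t (\<psi> t y) + \<xi> t y * Ux t (\<psi> t y) = utx t y" for y
    by (simp add: Ut_def utx_def \<xi>_def uxx_def ux_def \<eta>_def algebra_simps)
  ultimately show ?thesis by (simp add: ux_def)
qed

lemma L2_deriv_\<rho>: "L2_tendsto (\<lambda>s y. (\<rho> s y - \<rho> t y) / (s - t)) (\<rho>t t) (at t)"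
proof -
  have "L2_tendsto (\<lambda>s y. (R s (\<psi> s y) - R t (\<psi> t y)) / (s - t)) (\<lambda>y. - (R t (\<psi> t y) * U t (\<psi> t y)) + \<xi> t y * Rx t (\<psi> t y)) (at t)"
  proof (rule flow.L2_difference_quotient_compose_time[where Gt = "\<lambda>t x. - (R t x * U t x)"])
    show "((\<lambda>s. R s x) has_real_derivative - (R s x * U s x)) (at s)" for s x
      unfolding R_def using Ji_deriv_t[of x s] by (auto intro!: derivative_eq_intros simp: mult_ac)
    show "periodic1 (\<lambda>x. - (R t x * U t x))" for t
      using J_periodic periodic_per by (simp add: periodic1_def R_def U_def Ji_def)
    show "continuous_on UNIV (\<lambda>z. - (R (fst z) (snd z) * U (fst z) (snd z)))"
      by (intro continuous_on_minus continuous_on_mult cont_R cont_U)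
  qed (rule H1_R)
  moreover have "- (R t (\<psi> t y) * U t (\<psi> t y)) + \<xi> t y * Rx t (\<psi> t y) = \<rho>t t y" for y
    by (simp add: \<rho>t_def \<xi>_def \<rho>x_def ux_def \<rho>_def algebra_simps)
  ultimately show ?thesis by (simp add: \<rho>_def)
qed

subsection \<open>The equations\<close>

text \<open>The coefficient is \<open>(\<alpha> + 2) / 2\<close> at \<open>\<alpha> = - 1\<close>. The right-hand side is a derivative in \<open>y\<close> up to a
  constant, which is what makes the primitive in the first equation explicit.\<close>

lemma momentum_flux: "\<kappa> / 2 * (\<rho> t y)\<^sup>2 + ((-1) + 2) / 2 * (ux t y)\<^sup>2 = \<eta> t y * Jtt t (\<psi> t y) + \<omega>\<^sup>2 / 2"
proof -
  define x where "x = \<psi> t y"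
  have J1: "J t x * Ji t x = 1" using J_nonzero[of t x] by (simp add: Ji_def)
  have "(\<kappa> * (r x)\<^sup>2 + (Jt t x)\<^sup>2) * (Ji t x)\<^sup>2 = (2 * J t x * Jtt t x + \<omega>\<^sup>2 * (J t x)\<^sup>2) * (Ji t x)\<^sup>2"
    using J_identity[of t x] by simp
  also have "\<dots> = 2 * (J t x * Ji t x) * (Ji t x * Jtt t x) + \<omega>\<^sup>2 * (J t x * Ji t x)\<^sup>2"
    by (simp add: power2_eq_square algebra_simps)
  also have "\<dots> = 2 * (Ji t x * Jtt t x) + \<omega>\<^sup>2" by (simp add: J1)
  finally have "(\<kappa> * (r x)\<^sup>2 + (Jt t x)\<^sup>2) * (Ji t x)\<^sup>2 / 2 = Ji t x * Jtt t x + \<omega>\<^sup>2 / 2" by simp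
  then show ?thesis
    by (simp add: \<rho>_def ux_def R_def U_def \<eta>_def x_def power_mult_distrib algebra_simps add_divide_distrib)
qed

lemma hs_a_solution: "hs_a (-1) \<kappa> (u t) (\<rho> t) = - (\<omega>\<^sup>2 / 2)"
proof -
  have "(LINT y|circle. \<eta> t y * Jtt t (\<psi> t y)) = 0"
    by (rule C1_periodic_integral_deriv[OF Qtt_\<psi>_C1[of 0]])
  moreover have "integrable circle (\<lambda>y. \<eta> t y * Jtt t (\<psi> t y))"
    using C1_periodic_sq_int(2)[OF Qtt_\<psi>_C1[of 0]] by (rule sq_int_integrable)
  ultimately show ?thesis
    unfolding hs_a_eq[OF H1_u H1_ux H1_\<rho>] momentum_flux by simp
qed

lemma hs_primitive_solution:
  assumes "0 \<le> y" "y \<le> 1"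
  shows "hs_primitive (-1) \<kappa> (u t) (\<rho> t) y = Qtt t (\<psi> t y) - Qtt t (\<psi> t 0)"
proof -
  have "hs_primitive (-1) \<kappa> (u t) (\<rho> t) y = (LINT x|lebesgue_on {0..y}. \<eta> t x * Jtt t (\<psi> t x))"
    unfolding hs_primitive_eq[OF H1_u H1_ux H1_\<rho> assms] hs_a_solution momentum_flux by simp
  also have "\<dots> = (0 + Qtt t (\<psi> t y)) - (0 + Qtt t (\<psi> t 0))"
    using Qtt_\<psi>_C1[of 0 t] C1_periodic_continuous(2)[OF Qtt_\<psi>_C1[of 0 t]] assms
    by (intro FTC_integral) (auto simp: C1_periodic_def has_field_derivative_at_within)
  finally show ?thesis by simp
qed

lemma initial_values: "u 0 = u0" "\<rho> 0 = r"
proof -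
  have q: "q1 0 = 1" "q2 0 = 0" "q3 0 = 0" "dq1 0 = 0" "dq2 0 = 1" "dq3 0 = 0"
    by (simp_all add: q_defs dq_defs)
  have "\<psi> 0 y = y" for y using flow_inverse[of 0 y] by (simp add: Q_def q \<zeta>_0)
  then show "u 0 = u0" "\<rho> 0 = r"
    by (auto simp: u_def[abs_def] \<rho>_def[abs_def] R_def Ji_def J_def Qt_def q \<zeta>_0 V_def)
qed

lemma global_solution:
  assumes h': "\<And>t. 0 \<le> t \<Longrightarrow> h' t = h t"
  shows "hs_solution (-1) \<kappa> h' u0 r \<infinity> u \<rho>"
proof -
  define I where "I = {t::real. 0 \<le> t \<and> ereal t < \<infinity>}"
  have le: "at t within I \<le> at t" for t by (rule at_le) simp
  note mono = L2_tendsto_mono[OF _ le]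
  have s1: "sobolev_continuous_on 2 I u"
    unfolding sobolev_continuous_on_2_iff[OF H1_u H1_ux]
    by (intro ballI conjI mono L2_tendsto_joint cont_u cont_ux L2_tendsto_uxx)
  have s2: "sobolev_continuous_on 1 I \<rho>"
    unfolding sobolev_continuous_on_1_iff[OF H1_\<rho>]
    by (intro ballI conjI mono L2_tendsto_joint cont_\<rho> L2_tendsto_\<rho>x)
  have s3: "sobolev_has_deriv_on 1 I u ut"
    unfolding sobolev_has_deriv_on_1_iff[OF H1_u H1_ut]
    by (intro ballI conjI mono L2_deriv_u L2_deriv_ux)
  have s4: "sobolev_continuous_on 1 I ut"
    unfolding sobolev_continuous_on_1_iff[OF H1_ut]
    by (intro ballI conjI mono L2_tendsto_joint cont_ut L2_tendsto_utx)
  have L\<rho>: "L2_circle (\<rho> t)" for t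
    using H1_deriv_sq_int[OF H1_\<rho>] H1_deriv_periodic[OF H1_\<rho>] by (simp add: L2_circle_iff)
  have s5: "sobolev_has_deriv_on 0 I \<rho> \<rho>t"
    unfolding sobolev_has_deriv_on_0_iff[OF L\<rho> L2_\<rho>t] by (intro ballI mono L2_deriv_\<rho>)
  have s6: "sobolev_continuous_on 0 I \<rho>t"
    unfolding sobolev_continuous_on_0_iff[OF L2_\<rho>t] by (intro ballI mono L2_tendsto_\<rho>t)
  have e1: "AE y in circle. ut t y + u t y * wderiv (u t) y = hs_primitive (-1) \<kappa> (u t) (\<rho> t) y + h' t" if "t \<in> I" for t
  proof -
    have t: "0 \<le> t" using that by (simp add: I_def)
    have "AE y in circle. 0 \<le> y \<and> y \<le> 1" by (rule AE_circleI) auto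
    with wderiv_H1(2)[OF H1_u[of t]] show ?thesis
    proof eventually_elim
      case (elim y)
      then show ?case
        using \<zeta>2_eq[OF t] h'[OF t] by (simp add: hs_primitive_solution ut_def \<psi>_def)
    qed
  qed
  have e2: "AE y in circle. \<rho>t t y + u t y * wderiv (\<rho> t) y = - 1 * wderiv (u t) y * \<rho> t y" for t
    using wderiv_H1(2)[OF H1_u[of t]] wderiv_H1(2)[OF H1_\<rho>[of t]]
    by eventually_elim (simp add: \<rho>t_def mult.commute)
  show ?thesis
    unfolding hs_solution_def Let_def I_def[symmetric]
    using initial_values s1 s2 s3 s4 s5 s6 e1 e2 by auto
qed

end

section \<open>Global solutions with nonvanishing density\<close>

theorem theorem5p1:
  fixes \<alpha> \<kappa> :: real and h u0 \<rho>0 :: "real \<Rightarrow> real"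
  assumes "\<alpha> = -1" and "\<kappa> > 0"
    and "continuous_on {0..} h"
    and "sobolev 2 u0" and "sobolev 1 \<rho>0"
    and "(\<forall>x. \<rho>0 x > 0) \<or> (\<forall>x. \<rho>0 x < 0)"
  shows "\<exists>u \<rho>. hs_maximal_solution \<alpha> \<kappa> h u0 \<rho>0 \<infinity> u \<rho>"
proof -
  obtain p p' where p: "H1_deriv u0 p" "H1_deriv p p'" using assms(4) sobolev_2_iff by blast
  obtain r' where r: "H1_deriv \<rho>0 r'" using assms(5) sobolev_1_iff by blast
  have r0: "\<rho>0 x \<noteq> 0" for x using assms(6) by (metis less_irrefl)
  \<comment> \<open>The frequency of the explicit solution is the square root of the initial energy \<open>E\<close>.\<close>
  define E where "E = (LINT x|circle. (p x)\<^sup>2 + \<kappa> * (\<rho>0 x)\<^sup>2)"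
  have cE: "continuous_on {0..1} (\<lambda>x. (p x)\<^sup>2 + \<kappa> * (\<rho>0 x)\<^sup>2)"
    by (intro continuous_intros H1_deriv_continuous[OF p(2)] H1_deriv_continuous[OF r])
  have E: "E > 0"
  proof -
    have pos: "(p x)\<^sup>2 + \<kappa> * (\<rho>0 x)\<^sup>2 > 0" for x using assms(2) r0[of x] by (intro add_nonneg_pos) auto
    have "E = integral {0..1} (\<lambda>x. (p x)\<^sup>2 + \<kappa> * (\<rho>0 x)\<^sup>2)"
      unfolding E_def by (rule lebesgue_integral_eq_integral[OF continuous_integrable_circle[OF cE]]) auto
    moreover have "E \<ge> 0" unfolding E_def by (intro integral_nonneg_AE AE_I2 less_imp_le pos)
    moreover have "integral {0..1} (\<lambda>x. (p x)\<^sup>2 + \<kappa> * (\<rho>0 x)\<^sup>2) \<noteq> 0"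
    proof
      assume "integral {0..1} (\<lambda>x. (p x)\<^sup>2 + \<kappa> * (\<rho>0 x)\<^sup>2) = 0"
      then have "\<forall>x\<in>{0..1}. (p x)\<^sup>2 + \<kappa> * (\<rho>0 x)\<^sup>2 = 0"
        using integral_eq_0_iff[OF cE] pos by (simp add: less_imp_le)
      then show False using pos[of 0] by auto
    qed
    ultimately show ?thesis by linarith
  qed
  \<comment> \<open>Extending \<open>h\<close> to negative times makes all derivatives at time \<open>0\<close> two-sided.\<close>
  have ch: "continuous_on UNIV (\<lambda>t. h (max 0 t))"
    by (rule continuous_on_compose2[OF assms(3)]) (auto intro!: continuous_intros)
  interpret lagrangian \<kappa> "sqrt E" u0 p p' \<rho>0 r' "\<lambda>t. h (max 0 t)"
    by unfold_locales (use assms(2) E p r r0 ch in \<open>auto simp: E_def\<close>)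
  obtain \<zeta> \<zeta>1 \<zeta>2 where "\<zeta> 0 = 0" "\<zeta>1 0 = u0 0" "\<And>t. (\<zeta> has_real_derivative \<zeta>1 t) (at t)"
    "\<And>t. (\<zeta>1 has_real_derivative \<zeta>2 t) (at t)" "continuous_on UNIV \<zeta>2"
    "\<And>t. 0 \<le> t \<Longrightarrow> \<zeta>2 t = h (max 0 t) - Qtt t (m t (- \<zeta> t))"
    using particle_path by metis
  then interpret lagrangian_flow \<kappa> "sqrt E" u0 p p' \<rho>0 r' "\<lambda>t. h (max 0 t)" \<zeta> \<zeta>1 \<zeta>2
    by unfold_locales
  have sol: "hs_solution \<alpha> \<kappa> h u0 \<rho>0 \<infinity> u \<rho>"
    unfolding assms(1) by (rule global_solution) simp
  have "hs_maximal_solution \<alpha> \<kappa> h u0 \<rho>0 \<infinity> u \<rho>"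
    unfolding hs_maximal_solution_def
  proof (intro conjI allI impI sol)
    fix T' v \<sigma> t
    assume "hs_solution \<alpha> \<kappa> h u0 \<rho>0 T' v \<sigma>" "0 \<le> t \<and> ereal t < T'"
    then show "v t = u t" "\<sigma> t = \<rho> t"
      using hs_solution_unique[OF _ sol, of T' v \<sigma> t] by auto
  qed simp
  then show ?thesis by blast
qed

end
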